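(* For any integer $n\geq 5$ there exist a compact complex manifold $M^n$ of complex dimension $n$ and a fibered holomorphic partially hyperbolic diffeomorphism $f:M^n\to M^n$ such that the center distribution $E^c$ of $f$ is real analytic but is not holomorphic on any non-empty open subset of $M^n$ (so that, in particular, the center fibration $W^c$ is not a holomorphic foliation).
   Context: A diffeomorphism $f:M\to M$ of a compact manifold $M$ (with some Riemannian metric) is partially hyperbolic if there are a continuous $Df$-invariant splitting $TM=E^s\oplus E^c\oplus E^u$ into nonzero subbundles and an integer $k\ge 1$ such that for all $x\in M$: $\|Df^k|_{E^s(x)}\|<1<\|(Df^k|_{E^u(x)})^{-1}\|^{-1}$, $\ \|Df^k|_{E^s(x)}\|<\|(Df^k|_{E^c(x)})^{-1}\|^{-1}$, $\ \|Df^k|_{E^c(x)}\|<\|(Df^k|_{E^u(x)})^{-1}\|^{-1}$. The bundle $E^c$ is called the center distribution. $f$ is fibered if $E^c$ is tangent to an $f$-invariant foliation $W^c$ with compact leaves which is a topological fibration of $M$, i.e. the quotient $\hat M=M/W^c$ is a topological manifold and $M\to\hat M$ is a topological fibration. "Holomorphic partially hyperbolic diffeomorphism" means $M$ is a complex manifold and $f$ is a biholomorphism that is partially hyperbolic. A foliation of a complex manifold is holomorphic if it admits a holomorphic foliation atlas (equivalently, its tangent distribution is a holomorphic subbundle of the tangent bundle). *)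

theory Defs
  imports "HOL-Analysis.Analysis"
begin

section \<open>Regularity of maps between open subsets of coordinate spaces\<close>

text \<open>All predicates of this section are meant for open sets \<open>S\<close>. The space \<open>complex^'n\<close> carries
  its structure of a real Euclidean space of dimension \<open>2 * CARD('n)\<close>; \<open>*s\<close> is the complex scalar
  multiplication.\<close>

definition holomorphic_vec_on ::
  "(complex^'m \<Rightarrow> complex^'n) \<Rightarrow> (complex^'m) set \<Rightarrow> bool" where
  "holomorphic_vec_on f S \<longleftrightarrow>
     (\<forall>z\<in>S. \<exists>D. (f has_derivative D) (at z) \<and> (\<forall>a v. D (a *s v) = a *s D v))"

primrec Ck_on :: "nat \<Rightarrow> ('a::euclidean_space \<Rightarrow> real) \<Rightarrow> 'a set \<Rightarrow> bool" where
  "Ck_on 0 f S \<longleftrightarrow> continuous_on S f"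
| "Ck_on (Suc k) f S \<longleftrightarrow>
     f differentiable_on S \<and> (\<forall>v. Ck_on k (\<lambda>x. frechet_derivative f (at x) v) S)"

definition smooth_on :: "('a::euclidean_space \<Rightarrow> real) \<Rightarrow> 'a set \<Rightarrow> bool" where
  "smooth_on f S \<longleftrightarrow> (\<forall>k. Ck_on k f S)"

text \<open>Local expansion in a multivariate power series; the multi-indices are the functions
  \<open>\<alpha> \<in> Basis \<rightarrow>\<^sub>E UNIV\<close> with values in the natural numbers.\<close>

definition real_analytic_on ::
  "('a::euclidean_space \<Rightarrow> 'b::euclidean_space) \<Rightarrow> 'a set \<Rightarrow> bool" where
  "real_analytic_on f S \<longleftrightarrow>
     (\<forall>x\<in>S. \<exists>\<rho>>0. \<exists>a. \<forall>h\<in>ball 0 \<rho>.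
        ((\<lambda>\<alpha>. (\<Prod>b\<in>Basis. (h \<bullet> b) ^ \<alpha> b) *\<^sub>R a \<alpha>) has_sum f (x + h))
          (Basis \<rightarrow>\<^sub>E (UNIV :: nat set)))"


section \<open>Complex manifolds\<close>

text \<open>A chart \<open>(U, \<phi>)\<close> is a domain together with a coordinate map, whose values outside \<open>U\<close> are
  irrelevant. The dimension is the cardinality of the index type \<open>'n\<close>. The points of a manifold
  are the elements of \<open>topspace X\<close>; as a manifold has at most the cardinality of the continuum, an
  existence statement loses nothing by taking points in a fixed type at least that large, such as
  \<open>(complex^'n) set\<close>, which contains all quotients of coordinate space.\<close>

type_synonym ('a, 'n) chart = "'a set \<times> ('a \<Rightarrow> complex^'n)"

definition is_chart :: "'a topology \<Rightarrow> ('a, 'n::finite) chart \<Rightarrow> bool" where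
  "is_chart X c \<longleftrightarrow> openin X (fst c) \<and> open (snd c ` fst c) \<and>
     homeomorphic_map (subtopology X (fst c)) (top_of_set (snd c ` fst c)) (snd c)"

definition chart_inv :: "('a, 'n) chart \<Rightarrow> complex^'n \<Rightarrow> 'a" where
  "chart_inv c = inv_into (fst c) (snd c)"

definition transition ::
  "('a, 'n) chart \<Rightarrow> ('a, 'n) chart \<Rightarrow> complex^'n \<Rightarrow> complex^'n" where
  "transition c c' = snd c' \<circ> chart_inv c"

definition holomorphically_compatible ::
  "('a, 'n::finite) chart \<Rightarrow> ('a, 'n) chart \<Rightarrow> bool" where
  "holomorphically_compatible c c' \<longleftrightarrow>
     holomorphic_vec_on (transition c c') (snd c ` (fst c \<inter> fst c')) \<and>
     holomorphic_vec_on (transition c' c) (snd c' ` (fst c \<inter> fst c'))"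

definition complex_manifold :: "'a topology \<Rightarrow> ('a, 'n::finite) chart set \<Rightarrow> bool" where
  "complex_manifold X A \<longleftrightarrow>
     Hausdorff_space X \<and> second_countable X \<and>
     (\<forall>c\<in>A. is_chart X c) \<and> \<Union> (fst ` A) = topspace X \<and>
     (\<forall>c\<in>A. \<forall>c'\<in>A. holomorphically_compatible c c')"

definition holomorphic_self_map ::
  "'a topology \<Rightarrow> ('a, 'n::finite) chart set \<Rightarrow> ('a \<Rightarrow> 'a) \<Rightarrow> bool" where
  "holomorphic_self_map X A f \<longleftrightarrow> continuous_map X X f \<and>
     (\<forall>c\<in>A. \<forall>c'\<in>A. holomorphic_vec_on (snd c' \<circ> f \<circ> chart_inv c)
                       (snd c ` {p \<in> fst c. f p \<in> fst c'}))"

definition biholomorphism ::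
  "'a topology \<Rightarrow> ('a, 'n::finite) chart set \<Rightarrow> ('a \<Rightarrow> 'a) \<Rightarrow> bool" where
  "biholomorphism X A f \<longleftrightarrow> bij_betw f (topspace X) (topspace X) \<and>
     holomorphic_self_map X A f \<and> holomorphic_self_map X A (inv_into (topspace X) f)"


section \<open>Tangent bundle, subbundles and metrics\<close>

text \<open>A tangent vector at \<open>p\<close> is the family of its coordinate vectors in the charts around \<open>p\<close>,
  related to one another by the derivatives of the transition maps (and extended by zero to all
  other charts, so that equality of tangent vectors is equality of functions). All tangent vectors
  are real ones: the tangent space has real dimension \<open>2 * CARD('n)\<close>.\<close>

type_synonym ('a, 'n) tangent = "('a, 'n) chart \<Rightarrow> complex^'n"

definition tangent_space ::
  "('a, 'n::finite) chart set \<Rightarrow> 'a \<Rightarrow> ('a, 'n) tangent set" where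
  "tangent_space A p = {v.
     (\<forall>c\<in>A. \<forall>c'\<in>A. p \<in> fst c \<inter> fst c' \<longrightarrow>
        v c' = frechet_derivative (transition c c') (at (snd c p)) (v c)) \<and>
     (\<forall>c. \<not> (c \<in> A \<and> p \<in> fst c) \<longrightarrow> v c = 0)}"

definition tangent_of_coords ::
  "('a, 'n::finite) chart set \<Rightarrow> 'a \<Rightarrow> ('a, 'n) chart \<Rightarrow> complex^'n \<Rightarrow> ('a, 'n) tangent" where
  "tangent_of_coords A p c u = (THE v. v \<in> tangent_space A p \<and> v c = u)"

definition tangent_map ::
  "('a, 'n::finite) chart set \<Rightarrow> ('a \<Rightarrow> 'a) \<Rightarrow> 'a \<Rightarrow> ('a, 'n) tangent \<Rightarrow> ('a, 'n) tangent" where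
  "tangent_map A f p v = (THE w. w \<in> tangent_space A (f p) \<and>
     (\<forall>c\<in>A. \<forall>c'\<in>A. p \<in> fst c \<and> f p \<in> fst c' \<longrightarrow>
        w c' = frechet_derivative (snd c' \<circ> f \<circ> chart_inv c) (at (snd c p)) (v c)))"

definition real_frame :: "(nat \<Rightarrow> complex^'n) \<Rightarrow> nat \<Rightarrow> (complex^'n) set \<Rightarrow> bool" where
  "real_frame e r V \<longleftrightarrow> inj_on e {..<r} \<and> independent (e ` {..<r}) \<and> span (e ` {..<r}) = V"

definition complex_frame :: "(nat \<Rightarrow> complex^'n) \<Rightarrow> nat \<Rightarrow> (complex^'n) set \<Rightarrow> bool" where
  "complex_frame e r V \<longleftrightarrow>
     inj_on e {..<r} \<and> vec.independent (e ` {..<r}) \<and> vec.span (e ` {..<r}) = V"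

text \<open>The distribution \<open>E\<close> is a subbundle of the tangent bundle over the open set \<open>W\<close>: around each
  point, in every chart, it is spanned by a frame of vector fields of regularity \<open>reg\<close>.\<close>

definition subbundle_on ::
  "((nat \<Rightarrow> complex^'n) \<Rightarrow> nat \<Rightarrow> (complex^'n) set \<Rightarrow> bool) \<Rightarrow>
   ((complex^'n \<Rightarrow> complex^'n) \<Rightarrow> (complex^'n) set \<Rightarrow> bool) \<Rightarrow>
   'a topology \<Rightarrow> ('a, 'n::finite) chart set \<Rightarrow> 'a set \<Rightarrow> ('a \<Rightarrow> ('a, 'n) tangent set) \<Rightarrow> bool" where
  "subbundle_on frame reg X A W E \<longleftrightarrow>
     (\<forall>p\<in>W. E p \<subseteq> tangent_space A p) \<and>
     (\<exists>r. \<forall>p\<in>W. \<forall>c\<in>A. p \<in> fst c \<longrightarrow>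
        (\<exists>U e. openin X U \<and> p \<in> U \<and> U \<subseteq> W \<inter> fst c \<and>
           (\<forall>i<r. reg (e i) (snd c ` U)) \<and>
           (\<forall>q\<in>U. frame (\<lambda>i. e i (snd c q)) r ((\<lambda>v. v c) ` E q))))"

abbreviation continuous_subbundle_on where
  "continuous_subbundle_on \<equiv> subbundle_on real_frame (\<lambda>f S. continuous_on S f)"

abbreviation real_analytic_subbundle_on where
  "real_analytic_subbundle_on \<equiv> subbundle_on real_frame real_analytic_on"

abbreviation holomorphic_subbundle_on where
  "holomorphic_subbundle_on \<equiv> subbundle_on complex_frame holomorphic_vec_on"

definition riemannian_metric ::
  "('a, 'n::finite) chart set \<Rightarrow> ('a \<Rightarrow> ('a, 'n) tangent \<Rightarrow> ('a, 'n) tangent \<Rightarrow> real) \<Rightarrow> bool" where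
  "riemannian_metric A g \<longleftrightarrow> (\<forall>c\<in>A.
     let G = (\<lambda>p u w. g p (tangent_of_coords A p c u) (tangent_of_coords A p c w)) in
       (\<forall>p\<in>fst c. bilinear (G p) \<and> (\<forall>u w. G p u w = G p w u) \<and> (\<forall>u. u \<noteq> 0 \<longrightarrow> G p u u > 0)) \<and>
       (\<forall>u w. smooth_on (\<lambda>x. G (chart_inv c x) u w) (snd c ` fst c)))"

text \<open>The norm of a linear map \<open>L\<close> from a subspace \<open>V\<close> of the tangent space at \<open>p\<close> to the tangent
  space at \<open>q\<close>.\<close>

definition operator_norm ::
  "('a \<Rightarrow> ('a, 'n) tangent \<Rightarrow> ('a, 'n) tangent \<Rightarrow> real) \<Rightarrow> 'a \<Rightarrow> 'a \<Rightarrow>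
   ('a, 'n) tangent set \<Rightarrow> (('a, 'n) tangent \<Rightarrow> ('a, 'n) tangent) \<Rightarrow> real" where
  "operator_norm g p q V L = (SUP v\<in>{v \<in> V. sqrt (g p v v) = 1}. sqrt (g q (L v) (L v)))"


section \<open>Partial hyperbolicity\<close>

text \<open>The three distributions are real subbundles. In the inequalities, \<open>F\<close> is \<open>Df\<^sup>k\<close> at \<open>x\<close>,
  \<open>norm_on E\<close> is the norm of its restriction to \<open>E x\<close>, and \<open>inv_norm_on E\<close> the norm of the inverse
  of the latter.\<close>

definition partially_hyperbolic ::
  "'a topology \<Rightarrow> ('a, 'n::finite) chart set \<Rightarrow> ('a \<Rightarrow> 'a) \<Rightarrow>
   ('a \<Rightarrow> ('a, 'n) tangent set) \<Rightarrow> ('a \<Rightarrow> ('a, 'n) tangent set) \<Rightarrow>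
   ('a \<Rightarrow> ('a, 'n) tangent set) \<Rightarrow> bool" where
  "partially_hyperbolic X A f Es Ec Eu \<longleftrightarrow>
     (\<forall>E\<in>{Es, Ec, Eu}. continuous_subbundle_on X A (topspace X) E \<and>
        (\<forall>x\<in>topspace X. \<exists>v\<in>E x. v \<noteq> (\<lambda>_. 0)) \<and>
        (\<forall>x\<in>topspace X. tangent_map A f x ` E x = E (f x))) \<and>
     (\<forall>x\<in>topspace X. \<forall>v\<in>tangent_space A x.
        \<exists>!(vs, vc, vu). vs \<in> Es x \<and> vc \<in> Ec x \<and> vu \<in> Eu x \<and> v = (\<lambda>c. vs c + vc c + vu c)) \<and>
     (\<exists>g. riemannian_metric A g \<and> (\<exists>k\<ge>1. \<forall>x\<in>topspace X.
        let y = (f ^^ k) x;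
            F = tangent_map A (f ^^ k) x;
            norm_on = (\<lambda>E. operator_norm g x y (E x) F);
            inv_norm_on = (\<lambda>E. operator_norm g y x (E y) (inv_into (E x) F))
        in norm_on Es < 1 \<and> 1 < inverse (inv_norm_on Eu) \<and>
           norm_on Es < inverse (inv_norm_on Ec) \<and>
           norm_on Ec < inverse (inv_norm_on Eu)))"


section \<open>Foliations\<close>

text \<open>A foliation is given by its set of leaves. The real linear subspace \<open>K\<close> of \<open>complex^'n\<close> plays
  the role of the factor of the leaf directions in the model space: the plaques of a foliation
  chart \<open>(U, h)\<close> are the level sets of \<open>h\<close> modulo \<open>K\<close>. Convexity of the image of \<open>h\<close> makes the
  plaques connected.\<close>

definition plaque :: "(complex^'n) set \<Rightarrow> ('a, 'n) chart \<Rightarrow> 'a \<Rightarrow> 'a set" where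
  "plaque K c p = {q \<in> fst c. snd c q - snd c p \<in> K}"

definition foliation_chart ::
  "'a topology \<Rightarrow> (complex^'n::finite) set \<Rightarrow> 'a set set \<Rightarrow> ('a, 'n) chart \<Rightarrow> bool" where
  "foliation_chart X K \<L> c \<longleftrightarrow> is_chart X c \<and> convex (snd c ` fst c) \<and>
     (\<forall>L\<in>\<L>. \<forall>p\<in>fst c \<inter> L.
        connected_component_of_set (subtopology X (fst c \<inter> L)) p = plaque K c p)"

definition foliation ::
  "'a topology \<Rightarrow> (complex^'n::finite) set \<Rightarrow> 'a set set \<Rightarrow> bool" where
  "foliation X K \<L> \<longleftrightarrow> subspace K \<and>
     partition_on (topspace X) \<L> \<and> (\<forall>L\<in>\<L>. path_connectedin X L) \<and>
     (\<forall>p\<in>topspace X. \<exists>c. foliation_chart X K \<L> c \<and> p \<in> fst c)"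

text \<open>The leaves are \<open>C\<^sup>1\<close> immersed submanifolds tangent to \<open>E\<close>: every point \<open>p\<close> has a neighbourhood
  in its plaque with a \<open>C\<^sup>1\<close> parametrization \<open>\<sigma>\<close> by a ball of \<open>K\<close>, whose derivative maps \<open>K\<close>
  isomorphically onto \<open>E\<close>.\<close>

definition tangent_to ::
  "'a topology \<Rightarrow> ('a, 'n::finite) chart set \<Rightarrow> (complex^'n) set \<Rightarrow> 'a set set \<Rightarrow>
   ('a \<Rightarrow> ('a, 'n) tangent set) \<Rightarrow> bool" where
  "tangent_to X A K \<L> E \<longleftrightarrow>
     (\<forall>p\<in>topspace X. \<exists>d. foliation_chart X K \<L> d \<and> p \<in> fst d \<and>
        (\<forall>c\<in>A. p \<in> fst c \<longrightarrow>
          (\<exists>\<rho>>0. \<exists>\<sigma> D. let B = K \<inter> ball 0 \<rho> in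
             \<sigma> 0 = p \<and> \<sigma> ` B \<subseteq> fst c \<and>
             openin (subtopology X (plaque K d p)) (\<sigma> ` B) \<and>
             homeomorphic_map (top_of_set B) (subtopology X (\<sigma> ` B)) \<sigma> \<and>
             (\<forall>t\<in>B. ((snd c \<circ> \<sigma>) has_derivative D t) (at t within K) \<and>
                     inj_on (D t) K \<and> D t ` K = (\<lambda>v. v c) ` E (\<sigma> t)) \<and>
             (\<forall>u\<in>K. continuous_on B (\<lambda>t. D t u)))))"

definition holomorphic_foliation ::
  "'a topology \<Rightarrow> ('a, 'n::finite) chart set \<Rightarrow> 'a set set \<Rightarrow> bool" where
  "holomorphic_foliation X A \<L> \<longleftrightarrow>
     (\<exists>K. vec.subspace K \<and> foliation X K \<L> \<and>
        (\<forall>p\<in>topspace X. \<exists>d. foliation_chart X K \<L> d \<and> p \<in> fst d \<and>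
           (\<forall>c\<in>A. holomorphically_compatible c d)))"


section \<open>Fibered partially hyperbolic diffeomorphisms\<close>

definition topological_manifold :: "nat \<Rightarrow> 'b topology \<Rightarrow> bool" where
  "topological_manifold d Y \<longleftrightarrow> Hausdorff_space Y \<and> second_countable Y \<and>
     (\<forall>y\<in>topspace Y. \<exists>V V'. openin Y V \<and> y \<in> V \<and> openin (Euclidean_space d) V' \<and>
        subtopology Y V homeomorphic_space subtopology (Euclidean_space d) V')"

text \<open>Locally trivial fibre bundles. Over a trivializing neighbourhood of \<open>y\<close>, the typical fibre may
  be taken to be the fibre over \<open>y\<close>.\<close>

definition topological_fibration :: "'a topology \<Rightarrow> 'b topology \<Rightarrow> ('a \<Rightarrow> 'b) \<Rightarrow> bool" where
  "topological_fibration X Y \<pi> \<longleftrightarrow>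
     continuous_map X Y \<pi> \<and> \<pi> ` topspace X = topspace Y \<and>
     (\<forall>y\<in>topspace Y. \<exists>V \<Phi>. openin Y V \<and> y \<in> V \<and>
        homeomorphic_map
          (subtopology X {x \<in> topspace X. \<pi> x \<in> V})
          (prod_topology (subtopology Y V) (subtopology X {x \<in> topspace X. \<pi> x = y})) \<Phi> \<and>
        (\<forall>x\<in>topspace X. \<pi> x \<in> V \<longrightarrow> fst (\<Phi> x) = \<pi> x))"

definition leaf_through :: "'a set set \<Rightarrow> 'a \<Rightarrow> 'a set" where
  "leaf_through \<L> p = (THE L. L \<in> \<L> \<and> p \<in> L)"

text \<open>The points of the quotient are the leaves themselves; \<open>quotient_map\<close> forces \<open>Y\<close> to be the
  set of leaves with the quotient topology.\<close>

definition fibered ::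
  "'a topology \<Rightarrow> ('a, 'n::finite) chart set \<Rightarrow> ('a \<Rightarrow> 'a) \<Rightarrow>
   ('a \<Rightarrow> ('a, 'n) tangent set) \<Rightarrow> 'a set set \<Rightarrow> bool" where
  "fibered X A f Ec \<W> \<longleftrightarrow>
     (\<exists>K. foliation X K \<W> \<and> tangent_to X A K \<W> Ec) \<and>
     (\<forall>L\<in>\<W>. f ` L \<in> \<W>) \<and>
     (\<forall>L\<in>\<W>. compactin X L) \<and>
     (\<exists>Y d. quotient_map X Y (leaf_through \<W>) \<and> topological_manifold d Y \<and>
        topological_fibration X Y (leaf_through \<W>))"

end

theory Submission
  imports Defs
begin

text \<open>On \<open>\<complex>\<^sup>2 = \<real>\<^sup>4\<close> with real coordinates \<open>(a, b)\<close>, the functions \<open>a + z b\<^sup>*\<close> and \<open>b - z a\<^sup>*\<close> are, for every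
  \<open>z\<close> in the Riemann sphere, the coordinates of a complex structure that depends holomorphically on \<open>z\<close>
  (a star denotes conjugation; these are the quaternionic sections of \<open>O(1) \<oplus> O(1)\<close>). The total space of
  \<open>O(1)\<^sup>4\<close>, divided by the lattice of the sections with Gaussian integers \<open>a, b, a', b'\<close>, is thus a
  compact complex manifold of dimension 5, diffeomorphic to \<open>S\<^sup>2 \<times> T\<^sup>8\<close>; factors \<open>\<complex>/\<int>[\<i>]\<close> raise the
  dimension. The cat map with matrix \<open>(2 1; 1 1)\<close> on the pair \<open>(a, b), (a', b')\<close> is holomorphic,
  hyperbolic in the directions of \<open>T\<^sup>8\<close>, and isometric along the spheres \<open>(a, b, a', b') = const\<close>, which
  are the leaves of the center fibration. The spheres are holomorphic curves, but their tangent
  direction \<open>(1, b\<^sup>*, - a\<^sup>*, \<dots>)\<close> violates the Cauchy-Riemann equations. For the foliation, let \<open>\<psi>\<close> be a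
  holomorphic foliation chart, with leaf direction \<open>K\<close>. The difference of the derivatives of \<open>\<psi>\<close> at two
  points of a leaf is the sum of a complex linear and an antilinear function of \<open>(a, b, a', b')\<close> modulo
  \<open>K\<close>, so both vanish modulo \<open>K\<close>; this forces \<open>K\<close> to be the whole space.\<close>

section \<open>Manifolds covered by local parametrizations\<close>

text \<open>A linear map of the torus directions that is holomorphic for every \<open>z\<close>
  commutes with the quaternionic structure. On a single pair \<open>(a, b)\<close> it would be
  multiplication by a quaternion, and one that preserves a lattice has norm 1, hence is an isometry.
  On two pairs all integer matrices are available; this accounts for the dimension 1 + 4 = 5. The
  extra factors belong to the center: for \<open>n > 5\<close> a leaf is the product of a sphere
  with them, and the cat map acts on them as the identity.

  The metric carries the weight \<open>1 + |z|^2\<close>, which cancels the factors of the chart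
  changes. With it each invariant bundle is stretched by one constant, so the first iterate already
  satisfies all inequalities and no estimates are needed.

  Failure of holomorphy of the foliation is not derived from that of the center distribution. All
  that is used of a holomorphic foliation chart is that its increments along a leaf lie in
  \<open>K\<close>; these are differentiated transversally and along the leaf.\<close>

lemma has_derivative_cong_nhds:
  assumes "(f has_derivative D) (at x)" "\<forall>\<^sub>F v in nhds x. f v = g v"
  shows "(g has_derivative D) (at x)"
proof -
  from assms(2) obtain S where "open S" "x \<in> S" "\<And>v. v \<in> S \<Longrightarrow> f v = g v"
    by (auto simp: eventually_nhds)
  then show ?thesis using has_derivative_transform_within_open[OF assms(1)] by blast
qed

lemma eventually_nhds_in_open: "open B \<Longrightarrow> x \<in> B \<Longrightarrow> \<forall>\<^sub>F v in nhds x. v \<in> B"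
  by (auto simp: eventually_nhds)

text \<open>Charts are inverses of parametrizations: the maps from coordinate space onto the
  quotient are explicit and global, whereas their inverses exist only on sets where they are
  injective.\<close>

definition chart_of :: "('s \<Rightarrow> complex^'n \<Rightarrow> 'a) \<Rightarrow> 's \<Rightarrow> (complex^'n) set \<Rightarrow> ('a,'n) chart"
  where "chart_of q s B = (q s ` B, inv_into B (q s))"

lemma fst_chart_of [simp]: "fst (chart_of q s B) = q s ` B"
  by (simp add: chart_of_def)

lemma snd_chart_of [simp]: "snd (chart_of q s B) = inv_into B (q s)"
  by (simp add: chart_of_def)

lemma snd_image_chart_of [simp]: "inj_on (q s) B \<Longrightarrow> inv_into B (q s) ` q s ` B = B"
  by (simp add: image_image)

lemma chart_inv_chart_of: "inj_on (q s) B \<Longrightarrow> x \<in> B \<Longrightarrow> chart_inv (chart_of q s B) x = q s x"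
  using inv_into_f_f[OF inj_on_inv_into[of "q s ` B" "q s" B], of "q s x"]
  by (simp add: chart_inv_def)

text \<open>\<open>X\<close> carries the final topology of the family \<open>q\<close>, so
  continuity of maps out of \<open>X\<close> is tested on coordinate space; openness of the
  \<open>q s\<close> makes them local homeomorphisms wherever they are injective.\<close>

locale coordinate_cover =
  fixes X :: "'a topology" and q :: "'s \<Rightarrow> complex^'n::finite \<Rightarrow> 'a"
  assumes openin_iff: "openin X U \<longleftrightarrow> U \<subseteq> (\<Union>s. range (q s)) \<and> (\<forall>s. open (q s -` U))"
    and open_image: "open B \<Longrightarrow> openin X (q s ` B)"
begin

lemma topspace_eq: "topspace X = (\<Union>s. range (q s))"
proof -
  have "openin X (\<Union>s. range (q s))"
  proof -
    have "q s -` (\<Union>s. range (q s)) = UNIV" for s by auto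
    then show ?thesis unfolding openin_iff by simp
  qed
  then show ?thesis
    using openin_subset[of X "\<Union>s. range (q s)"] openin_iff[of "topspace X"] openin_topspace[of X] by simp
qed

lemma in_topspace [simp]: "q s x \<in> topspace X"
  by (auto simp: topspace_eq)

lemma topspaceE: assumes "p \<in> topspace X" obtains s x where "p = q s x"
  using assms by (auto simp: topspace_eq)

lemma continuous_map_iff: "continuous_map X Y g \<longleftrightarrow> (\<forall>s. continuous_map euclidean Y (g \<circ> q s))"
proof
  assume "continuous_map X Y g"
  moreover have "continuous_map euclidean X (q s)" for s
    by (auto simp: continuous_map_def openin_iff vimage_def)
  ultimately show "\<forall>s. continuous_map euclidean Y (g \<circ> q s)"
    using continuous_map_compose by blast
next
  assume *: "\<forall>s. continuous_map euclidean Y (g \<circ> q s)"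
  show "continuous_map X Y g" unfolding continuous_map_def
  proof (intro conjI allI impI Pi_I)
    fix p assume "p \<in> topspace X"
    then obtain s x where "p = q s x" by (rule topspaceE)
    moreover have "(g \<circ> q s) x \<in> topspace Y" using * by (simp add: continuous_map_def Pi_def)
    ultimately show "g p \<in> topspace Y" by simp
  next
    fix U assume U: "openin Y U"
    have "q s -` {x \<in> topspace X. g x \<in> U} = {x. (g \<circ> q s) x \<in> U}" for s by auto
    then show "openin X {x \<in> topspace X. g x \<in> U}"
      using * U unfolding openin_iff by (auto simp: continuous_map_def elim!: topspaceE)
  qed
qed

lemma continuous_param: "continuous_map euclidean X (q s)"
  by (auto simp: continuous_map_def openin_iff vimage_def)

lemma homeomorphic_param:
  assumes "open B" "inj_on (q s) B"
  shows "homeomorphic_map (top_of_set B) (subtopology X (q s ` B)) (q s)"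
proof (rule bijective_open_imp_homeomorphic_map)
  show "continuous_map (top_of_set B) (subtopology X (q s ` B)) (q s)"
    by (auto simp: continuous_map_in_subtopology continuous_map_from_subtopology continuous_param)
  show "open_map (top_of_set B) (subtopology X (q s ` B)) (q s)"
    unfolding open_map_def
  proof (intro allI impI)
    fix U assume "openin (top_of_set B) U"
    then have "open U" "U \<subseteq> B" using assms(1) openin_open_eq by auto
    then have "openin X (q s ` U)" "q s ` U = q s ` U \<inter> q s ` B" by (auto intro: open_image)
    then show "openin (subtopology X (q s ` B)) (q s ` U)"
      by (metis openin_subtopology)
  qed
qed (use assms in auto)

lemma is_chart_chart_of:
  assumes "open B" "inj_on (q s) B"
  shows "is_chart X (chart_of q s B)"
proof -
  have h: "homeomorphic_map (top_of_set B) (subtopology X (q s ` B)) (q s)"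
    using homeomorphic_param assms by blast
  then obtain g where g: "homeomorphic_maps (top_of_set B) (subtopology X (q s ` B)) (q s) g"
    using homeomorphic_map_maps by blast
  then have "homeomorphic_map (subtopology X (q s ` B)) (top_of_set B) g"
    using homeomorphic_maps_map by blast
  moreover have "g p = inv_into B (q s) p" if "p \<in> q s ` B" for p
    using that g assms(2) by (auto simp: homeomorphic_maps_def)
  ultimately have "homeomorphic_map (subtopology X (q s ` B)) (top_of_set B) (inv_into B (q s))"
    using homeomorphic_map_eq by (metis (no_types, lifting) Int_iff topspace_subtopology)
  then show ?thesis using assms by (auto simp: is_chart_def open_image)
qed

end

text \<open>Coordinate changes are required only as germs at coinciding points. Applied with the two
  points exchanged, the same assumption yields the inverse germ.\<close>

locale holomorphic_cover = coordinate_cover X q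
  for X :: "'a topology" and q :: "'s \<Rightarrow> complex^'n::finite \<Rightarrow> 'a" +
  assumes ex_transition: "q s x = q s' x' \<Longrightarrow> \<exists>T D. (T has_derivative D) (at x) \<and>
      (\<forall>a v. D (a *s v) = a *s D v) \<and> T x = x' \<and> (\<forall>\<^sub>F v in nhds x. q s' (T v) = q s v)"
    and ex_injective: "\<exists>B. open B \<and> x \<in> B \<and> inj_on (q s) B"
begin

definition atlas where "atlas = {chart_of q s B | s B. open B \<and> inj_on (q s) B}"

text \<open>\<open>T\<close> represents a germ of a coordinate change from \<open>(s, x)\<close> to
  \<open>(s', x')\<close>. Its derivative \<open>D\<close> is recorded because tangent vectors are
  transported by \<open>D\<close>.\<close>

definition is_trans where
  "is_trans s x s' x' T D \<longleftrightarrow> (T has_derivative D) (at x) \<and>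
      (\<forall>a v. D (a *s v) = a *s D v) \<and> T x = x' \<and> (\<forall>\<^sub>F v in nhds x. q s' (T v) = q s v)"

lemma ex_trans: assumes "q s x = q s' x'" obtains T D where "is_trans s x s' x' T D"
  using ex_transition[OF assms] by (auto simp: is_trans_def)

lemma is_trans_eq: "is_trans s x s' x' T D \<Longrightarrow> q s x = q s' x'"
  using eventually_nhds_x_imp_x[of "\<lambda>v. q s' (T v) = q s v" x] by (auto simp: is_trans_def)

lemma is_trans_tendsto: "is_trans s x s' x' T D \<Longrightarrow> (T \<longlongrightarrow> x') (nhds x)"
  using has_derivative_continuous[of T D x UNIV] tendsto_at_iff_tendsto_nhds[of T x]
  by (auto simp: is_trans_def continuous_within)

lemma is_trans_id: "is_trans s x s x id id"
  by (auto simp: is_trans_def id_def)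

lemma is_trans_compose:
  assumes "is_trans s x s' x' T D" "is_trans s' x' s2 x2 T2 D2"
  shows "is_trans s x s2 x2 (T2 \<circ> T) (D2 \<circ> D)"
proof -
  have 1: "((T2 \<circ> T) has_derivative (D2 \<circ> D)) (at x)"
    using assms by (auto simp: is_trans_def intro!: diff_chain_at)
  have "\<forall>\<^sub>F w in nhds x'. q s2 (T2 w) = q s' w" using assms by (auto simp: is_trans_def)
  then have "\<forall>\<^sub>F v in nhds x. q s2 (T2 (T v)) = q s' (T v)"
    using is_trans_tendsto[OF assms(1)] by (auto simp: filterlim_iff)
  moreover have "\<forall>\<^sub>F v in nhds x. q s' (T v) = q s v" using assms by (auto simp: is_trans_def)
  ultimately have "\<forall>\<^sub>F v in nhds x. q s2 ((T2 \<circ> T) v) = q s v"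
    by eventually_elim auto
  with 1 show ?thesis using assms by (auto simp: is_trans_def)
qed

text \<open>By continuity \<open>T v\<close> stays in \<open>B\<close>, where injectivity identifies
  it with the chart value. Thus every chart expression has the germ \<open>T\<close>.\<close>

lemma coord_eventually:
  assumes B: "open B" "inj_on (q s') B" "x' \<in> B" and T: "is_trans s x s' x' T D"
  shows "\<forall>\<^sub>F v in nhds x. T v = inv_into B (q s') (q s v)"
proof -
  have "\<forall>\<^sub>F v in nhds x. T v \<in> B"
    using is_trans_tendsto[OF T] eventually_nhds_in_open[OF B(1,3)] by (auto simp: filterlim_iff)
  moreover have "\<forall>\<^sub>F v in nhds x. q s' (T v) = q s v" using T by (auto simp: is_trans_def)
  ultimately show ?thesis
  proof eventually_elim
    case (elim v)
    then show ?case using inv_into_f_f[OF B(2), of "T v"] by simp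
  qed
qed

lemma coord_derivative:
  assumes B: "open B" "inj_on (q s') B" "x' \<in> B" and T: "is_trans s x s' x' T D"
  shows "((inv_into B (q s') \<circ> q s) has_derivative D) (at x)"
  using has_derivative_cong_nhds[of T D x] coord_eventually[OF assms] T
  by (auto simp: is_trans_def o_def)

lemma trans_id_derivative:
  assumes "is_trans s x s x T D" shows "D = id"
proof -
  obtain B where B: "open B" "x \<in> B" "inj_on (q s) B" using ex_injective by blast
  have "((inv_into B (q s) \<circ> q s) has_derivative D) (at x)"
    "((inv_into B (q s) \<circ> q s) has_derivative id) (at x)"
    by (rule coord_derivative[OF B(1,3,2) assms], rule coord_derivative[OF B(1,3,2) is_trans_id])
  then show ?thesis using has_derivative_unique by blast
qed

lemma atlasE:
  assumes "c \<in> atlas" "p \<in> fst c"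
  obtains s B x where "c = chart_of q s B" "open B" "inj_on (q s) B" "x \<in> B" "p = q s x" "snd c p = x"
  using assms by (auto simp: atlas_def)

lemma atlasI: "open B \<Longrightarrow> inj_on (q s) B \<Longrightarrow> chart_of q s B \<in> atlas"
  by (auto simp: atlas_def)

lemma snd_chart_fst_Int:
  assumes "inj_on (q s) B"
  shows "inv_into B (q s) ` (q s ` B \<inter> P) = {x\<in>B. q s x \<in> P}"
  using assms by (force simp: image_iff)

lemma transition_derivative:
  assumes B: "open B" "inj_on (q s) B" "x \<in> B" and B': "open B'" "inj_on (q s') B'" "x' \<in> B'"
    and T: "is_trans s x s' x' T D"
  shows "(transition (chart_of q s B) (chart_of q s' B') has_derivative D) (at x)"
proof (rule has_derivative_cong_nhds[OF coord_derivative[OF B' T]])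
  show "\<forall>\<^sub>F v in nhds x. (inv_into B' (q s') \<circ> q s) v = transition (chart_of q s B) (chart_of q s' B') v"
    using eventually_nhds_in_open[OF B(1,3)]
    by eventually_elim (simp add: transition_def chart_inv_chart_of B)
qed

lemma complex_manifold_atlas:
  assumes "Hausdorff_space X" "second_countable X"
  shows "complex_manifold X atlas"
proof -
  have half: "holomorphic_vec_on (transition (chart_of q s B) (chart_of q s' B'))
            (snd (chart_of q s B) ` (fst (chart_of q s B) \<inter> fst (chart_of q s' B')))"
    if "open B" "inj_on (q s) B" "open B'" "inj_on (q s') B'" for s B s' B'
    unfolding holomorphic_vec_on_def
  proof
    fix x assume "x \<in> snd (chart_of q s B) ` (fst (chart_of q s B) \<inter> fst (chart_of q s' B'))"
    then have x: "x \<in> B" "q s x \<in> q s' ` B'" using that by (auto simp: snd_chart_fst_Int)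
    then obtain x' where x': "x' \<in> B'" "q s x = q s' x'" by auto
    then obtain T D where T: "is_trans s x s' x' T D" using ex_trans by blast
    then show "\<exists>D. (transition (chart_of q s B) (chart_of q s' B') has_derivative D) (at x) \<and> (\<forall>a v. D (a *s v) = a *s D v)"
      using transition_derivative[OF that(1,2) x(1) that(3,4) x'(1) T] T
      unfolding is_trans_def by blast
  qed
  have "\<Union> (fst ` atlas) = topspace X"
  proof (intro set_eqI iffI)
    fix p assume "p \<in> topspace X"
    then obtain s x where p: "p = q s x" by (rule topspaceE)
    obtain B where "open B" "x \<in> B" "inj_on (q s) B" using ex_injective by blast
    then show "p \<in> \<Union> (fst ` atlas)" using atlasI[of B s] p by force
  next
    fix p assume "p \<in> \<Union> (fst ` atlas)"
    then obtain c where "c \<in> atlas" "p \<in> fst c" by auto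
    then obtain s x where "p = q s x" by (elim atlasE)
    then show "p \<in> topspace X" by simp
  qed
  moreover have "holomorphically_compatible c c'" if "c \<in> atlas" "c' \<in> atlas" for c c'
  proof -
    from that obtain s B s' B' where c: "c = chart_of q s B" "open B" "inj_on (q s) B"
      "c' = chart_of q s' B'" "open B'" "inj_on (q s') B'" unfolding atlas_def by blast
    show ?thesis
      using half[OF c(2,3,5,6)] half[OF c(5,6,2,3)] unfolding holomorphically_compatible_def c(1,4)
      by (simp add: Int_commute)
  qed
  moreover have "is_chart X c" if "c \<in> atlas" for c
    using that is_chart_chart_of unfolding atlas_def by blast
  ultimately show ?thesis using assms by (simp add: complex_manifold_def)
qed

text \<open>The tangent vector at \<open>q s x\<close> whose coordinates in the parametrization \<open>q s\<close> are \<open>u\<close>.\<close>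

definition tv where
  "tv s x u = (\<lambda>c. if c \<in> atlas \<and> q s x \<in> fst c then frechet_derivative (snd c \<circ> q s) (at x) u else 0)"

lemma tv_chart:
  assumes B: "open B" "inj_on (q s') B" "x' \<in> B" and T: "is_trans s x s' x' T D"
  shows "tv s x u (chart_of q s' B) = D u"
  using frechet_derivative_at[OF coord_derivative[OF assms]] B is_trans_eq[OF T] atlasI[of B s']
  by (auto simp: tv_def)

lemma tv_self: "open B \<Longrightarrow> inj_on (q s) B \<Longrightarrow> x \<in> B \<Longrightarrow> tv s x u (chart_of q s B) = u"
  using tv_chart[OF _ _ _ is_trans_id] by simp

lemma tv_change:
  assumes T: "is_trans s x s' x' T D"
  shows "tv s x u = tv s' x' (D u)"
proof
  fix c
  show "tv s x u c = tv s' x' (D u) c"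
  proof (cases "c \<in> atlas \<and> q s x \<in> fst c")
    case True
    then obtain s2 B x2 where c: "c = chart_of q s2 B" "open B" "inj_on (q s2) B" "x2 \<in> B" "q s x = q s2 x2"
      using atlasE by metis
    then obtain T2 D2 where T2: "is_trans s' x' s2 x2 T2 D2" using ex_trans is_trans_eq[OF T] by metis
    show ?thesis using tv_chart[OF c(2,3,4) T2] tv_chart[OF c(2,3,4) is_trans_compose[OF T T2]] c(1) by simp
  qed (auto simp: tv_def is_trans_eq[OF T])
qed

lemma tv_inj: "tv s x u = tv s x u' \<Longrightarrow> u = u'"
  by (metis ex_injective tv_self)

lemma trans_linear: "is_trans s x s' x' T D \<Longrightarrow> linear D"
  using has_derivative_linear by (auto simp: is_trans_def)

lemma tv_linear: "\<exists>D. linear D \<and> (\<forall>u. tv s x u c = D u)"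
proof (cases "c \<in> atlas \<and> q s x \<in> fst c")
  case True
  then obtain s2 B x2 where c: "c = chart_of q s2 B" "open B" "inj_on (q s2) B" "x2 \<in> B" "q s x = q s2 x2"
    using atlasE by metis
  then obtain T2 D2 where T2: "is_trans s x s2 x2 T2 D2" using ex_trans by metis
  then show ?thesis using tv_chart[OF c(2,3,4) T2] c(1) trans_linear by blast
next
  case False
  then show ?thesis by (intro exI[of _ "\<lambda>_. 0"]) (auto simp: tv_def linear_zero)
qed

lemma tv_add: "tv s x (u + v) = (\<lambda>c. tv s x u c + tv s x v c)"
proof
  fix c show "tv s x (u + v) c = tv s x u c + tv s x v c"
    using tv_linear[of s x c] by (auto simp: linear_add)
qed

lemma tv_0: "tv s x 0 = (\<lambda>_. 0)"
proof
  fix c show "tv s x 0 c = 0"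
    using tv_linear[of s x c] by (auto simp: linear_0)
qed

text \<open>A compatible family is determined by its value in one chart: the derivatives of the
  transitions force the others. Conversely, compatibility of \<open>tv\<close> is the chain rule for
  composed germs.\<close>

lemma tangent_space_eq: "tangent_space atlas (q s x) = range (tv s x)"
proof (intro set_eqI iffI)
  fix v assume v: "v \<in> tangent_space atlas (q s x)"
  obtain B where B: "open B" "x \<in> B" "inj_on (q s) B" using ex_injective by blast
  define u where "u = v (chart_of q s B)"
  have "v c = tv s x u c" for c
  proof (cases "c \<in> atlas \<and> q s x \<in> fst c")
    case True
    then obtain s2 B2 x2 where c: "c = chart_of q s2 B2" "open B2" "inj_on (q s2) B2" "x2 \<in> B2" "q s x = q s2 x2"
      using atlasE by metis
    then obtain T2 D2 where T2: "is_trans s x s2 x2 T2 D2" using ex_trans by metis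
    have "v c = frechet_derivative (transition (chart_of q s B) c) (at (snd (chart_of q s B) (q s x))) u"
    proof -
      have "\<forall>c\<in>atlas. \<forall>c'\<in>atlas. q s x \<in> fst c \<inter> fst c' \<longrightarrow>
          v c' = frechet_derivative (transition c c') (at (snd c (q s x))) (v c)"
        using v unfolding tangent_space_def mem_Collect_eq by (rule conjunct1)
      moreover have "q s x \<in> fst (chart_of q s B) \<inter> fst c" using True B by simp
      ultimately show ?thesis unfolding u_def using True atlasI[OF B(1,3)] by blast
    qed
    also have "\<dots> = D2 u"
      using frechet_derivative_at[OF transition_derivative[OF B(1,3,2) c(2-4) T2]]
      by (simp add: inv_into_f_f[OF B(3,2)] c(1))
    finally show ?thesis using tv_chart[OF c(2,3,4) T2] c(1) by simp
  next
    case False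
    have "\<forall>c. \<not> (c \<in> atlas \<and> q s x \<in> fst c) \<longrightarrow> v c = 0"
      using v unfolding tangent_space_def mem_Collect_eq by (rule conjunct2)
    then have "v c = 0" using False by blast
    then show ?thesis using False by (auto simp: tv_def)
  qed
  then have "v = tv s x u" by auto
  then show "v \<in> range (tv s x)" by blast
next
  fix v assume "v \<in> range (tv s x)"
  then obtain u where v: "v = tv s x u" by auto
  have "v c' = frechet_derivative (transition c c') (at (snd c (q s x))) (v c)"
    if c: "c \<in> atlas" "c' \<in> atlas" "q s x \<in> fst c" "q s x \<in> fst c'" for c c'
  proof -
    obtain s1 B1 x1 where 1: "c = chart_of q s1 B1" "open B1" "inj_on (q s1) B1" "x1 \<in> B1" "q s x = q s1 x1"
      using c atlasE by metis
    obtain s2 B2 x2 where 2: "c' = chart_of q s2 B2" "open B2" "inj_on (q s2) B2" "x2 \<in> B2" "q s x = q s2 x2"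
      using c atlasE by metis
    obtain T1 D1 where T1: "is_trans s x s1 x1 T1 D1" using ex_trans 1 by metis
    obtain T2 D2 where T2: "is_trans s1 x1 s2 x2 T2 D2" using ex_trans 1 2 by metis
    show ?thesis
      using tv_chart[OF 1(2,3,4) T1] tv_chart[OF 2(2,3,4) is_trans_compose[OF T1 T2]] v
        frechet_derivative_at[OF transition_derivative[OF 1(2-4) 2(2-4) T2]]
      by (simp add: 1 2)
  qed
  moreover have "v c = 0" if "\<not> (c \<in> atlas \<and> q s x \<in> fst c)" for c
    using that by (auto simp: v tv_def)
  ultimately show "v \<in> tangent_space atlas (q s x)"
    unfolding tangent_space_def by blast
qed

lemma tangent_of_coords_eq:
  assumes "open B" "inj_on (q s) B" "x \<in> B"
  shows "tangent_of_coords atlas (q s x) (chart_of q s B) u = tv s x u"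
  unfolding tangent_of_coords_def
  by (rule the_equality) (use assms in \<open>auto simp: tangent_space_eq tv_self\<close>)

text \<open>\<open>f\<close> lifts to the same linear map \<open>F\<close> in each parametrization,
  so in charts it is \<open>F\<close> followed by a coordinate change.\<close>

lemma self_map_derivative:
  assumes f: "\<And>s x. f (q s x) = q s (F x)" and F: "bounded_linear F"
    and B: "open B" "inj_on (q s) B" "x \<in> B"
    and B': "open B'" "inj_on (q s') B'" "x' \<in> B'" and T: "is_trans s (F x) s' x' T D"
  shows "((snd (chart_of q s' B') \<circ> f \<circ> chart_inv (chart_of q s B)) has_derivative (D \<circ> F)) (at x)"
proof -
  have "((inv_into B' (q s') \<circ> q s) \<circ> F has_derivative D \<circ> F) (at x)"
    by (intro diff_chain_at coord_derivative[OF B' T] bounded_linear.has_derivative[OF F] has_derivative_ident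
      bounded_linear_imp_has_derivative[OF F])
  then show ?thesis
  proof (rule has_derivative_cong_nhds)
    show "\<forall>\<^sub>F v in nhds x. (inv_into B' (q s') \<circ> q s \<circ> F) v = (snd (chart_of q s' B') \<circ> f \<circ> chart_inv (chart_of q s B)) v"
      using eventually_nhds_in_open[OF B(1,3)]
      by eventually_elim (simp add: chart_inv_chart_of B f)
  qed
qed

lemma holomorphic_self_mapI:
  assumes f: "\<And>s x. f (q s x) = q s (F x)" and F: "bounded_linear F" "\<And>a v. F (a *s v) = a *s F v"
  shows "holomorphic_self_map X atlas f"
  unfolding holomorphic_self_map_def
proof (intro conjI ballI)
  have "continuous_map euclidean X (q s \<circ> F)" for s
    by (rule continuous_map_compose[OF _ continuous_param])
      (use linear_continuous_on[OF F(1)] in auto)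
  moreover have "f \<circ> q s = q s \<circ> F" for s by (auto simp: f)
  ultimately show "continuous_map X X f" unfolding continuous_map_iff by simp
next
  fix c c' assume c: "c \<in> atlas" "c' \<in> atlas"
  show "holomorphic_vec_on (snd c' \<circ> f \<circ> chart_inv c) (snd c ` {p \<in> fst c. f p \<in> fst c'})"
    unfolding holomorphic_vec_on_def
  proof
    fix z assume "z \<in> snd c ` {p \<in> fst c. f p \<in> fst c'}"
    then obtain p where p: "p \<in> fst c" "f p \<in> fst c'" "z = snd c p" by auto
    obtain s B x where 1: "c = chart_of q s B" "open B" "inj_on (q s) B" "x \<in> B" "p = q s x" "snd c p = x"
      using c p atlasE by metis
    obtain s' B' x' where 2: "c' = chart_of q s' B'" "open B'" "inj_on (q s') B'" "x' \<in> B'" "f p = q s' x'"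
      using c p atlasE by metis
    then have "q s (F x) = q s' x'" using f 1 by simp
    then obtain T D where T: "is_trans s (F x) s' x' T D" using ex_trans by blast
    show "\<exists>D. (snd c' \<circ> f \<circ> chart_inv c has_derivative D) (at z) \<and> (\<forall>a v. D (a *s v) = a *s D v)"
      using self_map_derivative[OF f F(1) 1(2-4) 2(2-4) T] T F(2) 1 2 p
      by (intro exI[of _ "D \<circ> F"]) (auto simp: is_trans_def)
  qed
qed

text \<open>For the definite description, one pair of charts gives uniqueness. Existence compares
  two ways of computing one germ: coordinate change, then \<open>f\<close> in charts; or
  \<open>F\<close>, then coordinate change.\<close>

lemma tangent_map_eq:
  assumes f: "\<And>s x. f (q s x) = q s (F x)" and F: "bounded_linear F" "\<And>a v. F (a *s v) = a *s F v"
  shows "tangent_map atlas f (q s x) (tv s x u) = tv s (F x) (F u)"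
  unfolding tangent_map_def
proof (rule the_equality)
  have *: "tv s (F x) (F u) c' = frechet_derivative (snd c' \<circ> f \<circ> chart_inv c) (at (snd c (q s x))) (tv s x u c)"
    if c: "c\<in>atlas" "c'\<in>atlas" "q s x \<in> fst c" "f (q s x) \<in> fst c'" for c c'
  proof -
    obtain s1 B1 x1 where 1: "c = chart_of q s1 B1" "open B1" "inj_on (q s1) B1" "x1 \<in> B1" "q s x = q s1 x1" "snd c (q s x) = x1"
      using c atlasE by metis
    obtain s2 B2 x2 where 2: "c' = chart_of q s2 B2" "open B2" "inj_on (q s2) B2" "x2 \<in> B2" "f (q s x) = q s2 x2"
      using c atlasE by metis
    obtain T1 D1 where T1: "is_trans s x s1 x1 T1 D1" using ex_trans 1 by metis
    obtain T2 D2 where T2: "is_trans s (F x) s2 x2 T2 D2" using ex_trans 2 f by metis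
    have "q s1 (F x1) = q s2 x2" using 1 2 f by metis
    then obtain T3 D3 where T3: "is_trans s1 (F x1) s2 x2 T3 D3" using ex_trans by blast
    have d3: "((snd c' \<circ> f \<circ> chart_inv c) has_derivative (D3 \<circ> F)) (at x1)"
      using self_map_derivative[OF f F(1) 1(2-4) 2(2-4) T3] 1 2 by simp
    have "((snd c' \<circ> f \<circ> chart_inv c) \<circ> (inv_into B1 (q s1) \<circ> q s) has_derivative (D3 \<circ> F \<circ> D1)) (at x)"
      using diff_chain_at[OF coord_derivative[OF 1(2-4) T1]] d3 1 by auto
    moreover have "(inv_into B2 (q s2) \<circ> q s \<circ> F has_derivative D2 \<circ> F) (at x)"
      by (intro diff_chain_at coord_derivative[OF 2(2-4) T2] bounded_linear_imp_has_derivative[OF F(1)])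
    moreover have "\<forall>\<^sub>F v in nhds x. ((snd c' \<circ> f \<circ> chart_inv c) \<circ> (inv_into B1 (q s1) \<circ> q s)) v = (inv_into B2 (q s2) \<circ> q s \<circ> F) v"
      using coord_eventually[OF 1(2-4) T1] 
        eventually_nhds_in_open[OF 1(2,4), THEN is_trans_tendsto[OF T1, unfolded filterlim_iff, rule_format]]
        T1[unfolded is_trans_def, THEN conjunct2, THEN conjunct2, THEN conjunct2]
      by eventually_elim (simp add: chart_inv_chart_of 1(1,3) 2(1) f)
    ultimately have "D3 \<circ> F \<circ> D1 = D2 \<circ> F"
      by (intro has_derivative_unique[OF has_derivative_cong_nhds])
    then show ?thesis
      using tv_chart[OF 1(2,3,4) T1] tv_chart[OF 2(2,3,4) T2] frechet_derivative_at[OF d3] 1(6)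
      by (simp add: 1(1) 2(1) fun_eq_iff)
  qed
  show "tv s (F x) (F u) \<in> tangent_space atlas (f (q s x)) \<and>
    (\<forall>c\<in>atlas. \<forall>c'\<in>atlas. q s x \<in> fst c \<and> f (q s x) \<in> fst c' \<longrightarrow>
        tv s (F x) (F u) c' = frechet_derivative (snd c' \<circ> f \<circ> chart_inv c) (at (snd c (q s x))) (tv s x u c))"
    using * by (auto simp: f tangent_space_eq)
  fix w assume w: "w \<in> tangent_space atlas (f (q s x)) \<and>
    (\<forall>c\<in>atlas. \<forall>c'\<in>atlas. q s x \<in> fst c \<and> f (q s x) \<in> fst c' \<longrightarrow>
        w c' = frechet_derivative (snd c' \<circ> f \<circ> chart_inv c) (at (snd c (q s x))) (tv s x u c))"
  then obtain w0 where w0: "w = tv s (F x) w0" by (auto simp: f tangent_space_eq)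
  obtain B where B: "open B" "x \<in> B" "inj_on (q s) B" using ex_injective by blast
  obtain B' where B': "open B'" "F x \<in> B'" "inj_on (q s) B'" using ex_injective by blast
  have "w (chart_of q s B') = tv s (F x) (F u) (chart_of q s B')"
    using w *[of "chart_of q s B" "chart_of q s B'"] atlasI[of B s] atlasI[of B' s] B B' f by auto
  then show "w = tv s (F x) (F u)" using tv_self[OF B'(1,3,2)] w0 by simp
qed

section \<open>Distributions given by fields of subspaces in coordinates\<close>

definition distribution where
  "distribution V p = {tv s x u | s x u. p = q s x \<and> u \<in> V x}"

text \<open>Inclusion suffices, because the condition is also imposed with the two points
  exchanged.\<close>

definition invariant_field where
  "invariant_field V \<longleftrightarrow> (\<forall>s x s' x'. q s x = q s' x' \<longrightarrow> (\<exists>T D. is_trans s x s' x' T D \<and> D ` V x \<subseteq> V x'))"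

lemma distribution_eq:
  assumes "invariant_field V"
  shows "distribution V (q s x) = tv s x ` V x"
proof -
  have "tv s' x' u \<in> tv s x ` V x" if "q s x = q s' x'" "u \<in> V x'" for s' x' u
  proof -
    have "q s' x' = q s x" using that by simp
    then obtain T D where "is_trans s' x' s x T D" "D ` V x' \<subseteq> V x"
      using assms unfolding invariant_field_def by blast
    then show ?thesis using tv_change that by blast
  qed
  then show ?thesis by (auto simp: distribution_def)
qed

lemma distribution_coords:
  assumes "invariant_field V" "open B" "inj_on (q s) B" "x \<in> B"
  shows "(\<lambda>v. v (chart_of q s B)) ` distribution V (q s x) = V x"
  by (auto simp: distribution_eq[OF assms(1)] image_image tv_self[OF assms(2-4)])

text \<open>The field \<open>V\<close> is given by one formula in all parametrizations, so a single
  global frame in coordinate space serves all charts.\<close>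

lemma subbundle_distribution:
  assumes V: "invariant_field V"
    and e: "\<And>i S. i < r \<Longrightarrow> open S \<Longrightarrow> reg (e i) S" "\<And>x. frame (\<lambda>i. e i x) r (V x)"
  shows "subbundle_on frame reg X atlas (topspace X) (distribution V)"
  unfolding subbundle_on_def
proof (intro conjI ballI exI[of _ r] impI)
  fix p assume "p \<in> topspace X"
  then obtain s x where "p = q s x" by (rule topspaceE)
  then show "distribution V p \<subseteq> tangent_space atlas p"
    by (auto simp: distribution_eq V tangent_space_eq)
next
  fix p c assume c: "c \<in> atlas" "p \<in> fst c"
  obtain s B x where 1: "c = chart_of q s B" "open B" "inj_on (q s) B" "x \<in> B" "p = q s x"
    using c atlasE by metis
  show "\<exists>U e. openin X U \<and> p \<in> U \<and> U \<subseteq> topspace X \<inter> fst c \<and>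
           (\<forall>i<r. reg (e i) (snd c ` U)) \<and>
           (\<forall>q\<in>U. frame (\<lambda>i. e i (snd c q)) r ((\<lambda>v. v c) ` distribution V q))"
    apply (intro exI[of _ "fst c"] exI[of _ e])
    using 1 c e by (auto simp: open_image distribution_coords V)
qed

end

section \<open>Smooth functions and polynomials\<close>

text \<open>Replaces \<open>frechet_derivative\<close> by a given derivative on \<open>S\<close>.
  Congruence at order \<open>k\<close> is a premise because the induction that proves it passes
  through this rule.\<close>

lemma Ck_on_SucI:
  assumes "open S" "\<And>x. x \<in> S \<Longrightarrow> (f has_derivative f' x) (at x)" "\<And>v. Ck_on k (\<lambda>x. f' x v) S"
    and cong: "\<And>g h. Ck_on k g S \<Longrightarrow> (\<And>x. x \<in> S \<Longrightarrow> g x = h x) \<Longrightarrow> Ck_on k h S"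
  shows "Ck_on (Suc k) f S"
proof -
  have "f differentiable_on S"
    using assms(1,2) by (auto simp: differentiable_on_eq_differentiable_at differentiable_def)
  moreover have "Ck_on k (\<lambda>x. frechet_derivative f (at x) v) S" for v
    by (rule cong[OF assms(3)[of v]]) (use frechet_derivative_at[OF assms(2)] in auto)
  ultimately show ?thesis by simp
qed

lemma Ck_on_SucD:
  assumes "Ck_on (Suc k) f S" "open S" "x \<in> S"
  shows "(f has_derivative frechet_derivative f (at x)) (at x)"
  using assms by (auto simp: differentiable_on_eq_differentiable_at frechet_derivative_works)

lemma Ck_on_cong:
  assumes "open S" "Ck_on k g S" "\<And>x. x \<in> S \<Longrightarrow> g x = h x"
  shows "Ck_on k h S"
  using assms(2,3)
proof (induction k arbitrary: g h)
  case 0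
  then show ?case using continuous_on_cong[of S S g h] by simp
next
  case (Suc k)
  show ?case
  proof (rule Ck_on_SucI[OF assms(1)])
    fix x assume x: "x \<in> S"
    show "(h has_derivative frechet_derivative g (at x)) (at x)"
      using Ck_on_SucD[OF Suc.prems(1) assms(1) x] has_derivative_transform_within_open[OF _ assms(1) x] Suc.prems(2)
      by blast
  next
    fix v show "Ck_on k (\<lambda>x. frechet_derivative g (at x) v) S" using Suc.prems(1) by simp
  qed (use Suc.IH in blast)
qed

lemma Ck_on_SucI':
  assumes "open S" "\<And>x. x \<in> S \<Longrightarrow> (f has_derivative f' x) (at x)" "\<And>v. Ck_on k (\<lambda>x. f' x v) S"
  shows "Ck_on (Suc k) f S"
  by (rule Ck_on_SucI[OF assms]) (use assms(1) Ck_on_cong in blast)+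

lemma Ck_on_Suc_imp: "Ck_on (Suc k) f S \<Longrightarrow> Ck_on k f S"
proof (induction k arbitrary: f)
  case 0 then show ?case by (auto intro: differentiable_imp_continuous_on)
next
  case (Suc k)
  have "f differentiable_on S" "\<And>v. Ck_on (Suc k) (\<lambda>x. frechet_derivative f (at x) v) S"
    using Suc.prems unfolding Ck_on.simps(2)[of "Suc k"] by blast+
  then show ?case using Suc.IH unfolding Ck_on.simps(2)[of k] by blast
qed

lemma Ck_on_const: "open S \<Longrightarrow> Ck_on k (\<lambda>x. c) S"
proof (induction k arbitrary: c)
  case (Suc k)
  then show ?case by (intro Ck_on_SucI'[where f'="\<lambda>x v. 0"]) auto
qed auto

lemma Ck_on_linear: "open S \<Longrightarrow> bounded_linear f \<Longrightarrow> Ck_on k f S"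
proof (cases k)
  case 0 then show "bounded_linear f \<Longrightarrow> ?thesis" by (simp add: linear_continuous_on)
next
  case (Suc j)
  assume "open S" "bounded_linear f"
  then show ?thesis unfolding Suc
    by (intro Ck_on_SucI'[where f'="\<lambda>x. f"]) (auto intro: bounded_linear_imp_has_derivative Ck_on_const)
qed

lemma Ck_on_add: 
  assumes "open S" "Ck_on k f S" "Ck_on k g S" shows "Ck_on k (\<lambda>x. f x + g x) S"
  using assms(2,3)
proof (induction k arbitrary: f g)
  case 0 then show ?case by (auto intro: continuous_intros)
next
  case (Suc k)
  show ?case
    by (rule Ck_on_SucI'[OF assms(1) has_derivative_add[OF Ck_on_SucD[OF Suc.prems(1) assms(1)] Ck_on_SucD[OF Suc.prems(2) assms(1)]]])
      (use Suc assms(1) in auto)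
qed

lemma Ck_on_mult: 
  assumes "open S" "Ck_on k f S" "Ck_on k g S" shows "Ck_on k (\<lambda>x. f x * g x) S"
  using assms(2,3)
proof (induction k arbitrary: f g)
  case 0 then show ?case by (auto intro: continuous_intros)
next
  case (Suc k)
  note * = Suc.prems[THEN Ck_on_Suc_imp]
  show ?case
    by (rule Ck_on_SucI'[OF assms(1) has_derivative_mult[OF Ck_on_SucD[OF Suc.prems(1) assms(1)] Ck_on_SucD[OF Suc.prems(2) assms(1)]]])
      (use Suc * assms(1) in \<open>auto intro!: Ck_on_add\<close>)
qed

lemma Ck_on_inverse: 
  assumes "open S" "Ck_on k f S" "\<And>x. x \<in> S \<Longrightarrow> f x \<noteq> 0" shows "Ck_on k (\<lambda>x. inverse (f x)) S"
  using assms(2)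
proof (induction k)
  case 0 then show ?case using assms(3) by (auto intro: continuous_intros)
next
  case (Suc k)
  note * = Suc.prems[THEN Ck_on_Suc_imp]
  have "((\<lambda>x. inverse (f x)) has_derivative
      (\<lambda>v. - 1 * (inverse (f x) * frechet_derivative f (at x) v * inverse (f x)))) (at x)" if "x \<in> S" for x
    using Deriv.has_derivative_inverse[OF assms(3)[OF that] Ck_on_SucD[OF Suc.prems assms(1) that]] by simp
  moreover have "Ck_on k (\<lambda>x. - 1 * (inverse (f x) * frechet_derivative f (at x) v * inverse (f x))) S" for v
    by (intro Ck_on_mult Ck_on_const assms(1) Suc.IH[OF *]) (use Suc.prems in simp)
  ultimately show ?case
    by (rule Ck_on_SucI'[OF assms(1)])
qed

lemma smooth_on_add: "open S \<Longrightarrow> smooth_on f S \<Longrightarrow> smooth_on g S \<Longrightarrow> smooth_on (\<lambda>x. f x + g x) S"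
  by (simp add: smooth_on_def Ck_on_add)

lemma smooth_on_mult: "open S \<Longrightarrow> smooth_on f S \<Longrightarrow> smooth_on g S \<Longrightarrow> smooth_on (\<lambda>x. f x * g x) S"
  by (simp add: smooth_on_def Ck_on_mult)

lemma smooth_on_inverse:
  "open S \<Longrightarrow> smooth_on f S \<Longrightarrow> (\<And>x. x \<in> S \<Longrightarrow> f x \<noteq> 0) \<Longrightarrow> smooth_on (\<lambda>x. inverse (f x)) S"
  by (simp add: smooth_on_def Ck_on_inverse)

lemma smooth_on_polynomial: "real_polynomial_function f \<Longrightarrow> open S \<Longrightarrow> smooth_on f S"
  by (induction rule: real_polynomial_function.induct)
    (auto simp: smooth_on_def Ck_on_linear Ck_on_const Ck_on_add Ck_on_mult)

lemma smooth_on_sum: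
  assumes "open S" "\<And>i. i \<in> I \<Longrightarrow> smooth_on (f i) S" shows "smooth_on (\<lambda>x. \<Sum>i\<in>I. f i x) S"
  using assms(2)
  by (induction I rule: infinite_finite_induct)
    (auto simp: smooth_on_add[OF assms(1)] smooth_on_polynomial[OF real_polynomial_function.intros(2) assms(1)])

lemma smooth_on_cong:
  "open S \<Longrightarrow> smooth_on g S \<Longrightarrow> (\<And>x. x \<in> S \<Longrightarrow> g x = h x) \<Longrightarrow> smooth_on h S"
  unfolding smooth_on_def using Ck_on_cong by blast

section \<open>Power series of polynomials\<close>

definition monomial_at :: "('a::euclidean_space \<Rightarrow> nat) \<Rightarrow> 'a \<Rightarrow> real" where
  "monomial_at \<alpha> h = (\<Prod>b\<in>Basis. (h \<bullet> b) ^ \<alpha> b)"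

lemma monomial_at_mult:
  "monomial_at \<alpha> h * monomial_at \<beta> h = monomial_at (restrict (\<lambda>b. \<alpha> b + \<beta> b) Basis) h"
  by (simp add: monomial_at_def prod.distrib[symmetric] power_add)

lemma monomial_at_0: "monomial_at (restrict (\<lambda>_. 0) Basis) h = 1"
  by (simp add: monomial_at_def)

lemma monomial_at_Basis:
  assumes "b \<in> Basis"
  shows "monomial_at (restrict (\<lambda>b'. if b' = b then 1 else 0) Basis) h = h \<bullet> b"
proof -
  have "(\<Prod>b'\<in>Basis. (h \<bullet> b') ^ (if b' = b then 1 else 0)) = (\<Prod>b'\<in>Basis. if b' = b then h \<bullet> b' else 1)"
    by (rule prod.cong) auto
  then show ?thesis using assms by (simp add: monomial_at_def prod.delta)
qed

text \<open>An exponent may occur several times in the list, which makes sums and products of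
  polynomials available without normal forms.\<close>

definition eval_terms :: "(real \<times> ('a::euclidean_space \<Rightarrow> nat)) list \<Rightarrow> 'a \<Rightarrow> real" where
  "eval_terms xs h = (\<Sum>(c, \<alpha>)\<leftarrow>xs. c * monomial_at \<alpha> h)"

lemma eval_terms_simps [simp]: "eval_terms [] h = 0"
  "eval_terms (x # xs) h = fst x * monomial_at (snd x) h + eval_terms xs h"
  "eval_terms (xs @ ys) h = eval_terms xs h + eval_terms ys h"
  by (auto simp: eval_terms_def case_prod_beta)

abbreviation multi_indices :: "('a::euclidean_space \<Rightarrow> nat) set" where
  "multi_indices \<equiv> Basis \<rightarrow>\<^sub>E UNIV"

lemma ex_terms_scale:
  "\<exists>zs. snd ` set zs \<subseteq> multi_indices \<and> (\<forall>h. eval_terms zs h = c * monomial_at \<alpha> h * eval_terms ys h)"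
proof (induction ys)
  case Nil show ?case by (intro exI[of _ "[]"]) auto
next
  case (Cons y ys)
  then obtain zs where zs: "snd ` set zs \<subseteq> multi_indices" "\<And>h. eval_terms zs h = c * monomial_at \<alpha> h * eval_terms ys h" by blast
  show ?case
    by (rule exI[of _ "(c * fst y, restrict (\<lambda>b. \<alpha> b + snd y b) Basis) # zs"])
      (use zs in \<open>auto simp: monomial_at_mult[symmetric] algebra_simps\<close>)
qed

lemma ex_terms_mult:
  "\<exists>zs. snd ` set zs \<subseteq> multi_indices \<and> (\<forall>h. eval_terms zs h = eval_terms xs h * eval_terms ys h)"
proof (induction xs)
  case Nil show ?case by (intro exI[of _ "[]"]) auto
next
  case (Cons x xs)
  then obtain zs where zs: "snd ` set zs \<subseteq> multi_indices" "\<And>h. eval_terms zs h = eval_terms xs h * eval_terms ys h" by blast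
  obtain ws where ws: "snd ` set ws \<subseteq> multi_indices" "\<And>h. eval_terms ws h = fst x * monomial_at (snd x) h * eval_terms ys h"
    using ex_terms_scale[of "fst x" "snd x" ys] by blast
  show ?case
    by (rule exI[of _ "ws @ zs"]) (use zs ws in \<open>auto simp: algebra_simps\<close>)
qed

lemma ex_terms_linear:
  assumes "finite B" "B \<subseteq> Basis"
  shows "\<exists>zs. snd ` set zs \<subseteq> multi_indices \<and> (\<forall>h. eval_terms zs h = (\<Sum>b\<in>B. (h \<bullet> b) * c b))"
  using assms
proof (induction rule: finite_induct)
  case empty show ?case by (intro exI[of _ "[]"]) auto
next
  case (insert b B)
  then obtain zs where zs: "snd ` set zs \<subseteq> multi_indices" "\<And>h. eval_terms zs h = (\<Sum>b\<in>B. (h \<bullet> b) * c b)" by auto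
  have b: "b \<in> Basis" using insert by auto
  show ?case
    by (rule exI[of _ "(c b, restrict (\<lambda>b'. if b' = b then 1 else 0) Basis) # zs"])
      (use zs insert monomial_at_Basis[OF b] in \<open>auto simp: algebra_simps\<close>)
qed

lemma ex_terms_polynomial:
  fixes p :: "'a::euclidean_space \<Rightarrow> real"
  assumes "real_polynomial_function p"
  shows "\<exists>zs. snd ` set zs \<subseteq> multi_indices \<and> (\<forall>h. eval_terms zs h = p h)"
  using assms
proof induction
  case (linear f)
  have f: "(\<Sum>b\<in>Basis. (h \<bullet> b) * f b) = f h" for h
    using linear_sum[OF bounded_linear.linear[OF linear], of "\<lambda>b. (h \<bullet> b) *\<^sub>R b" Basis]
    by (simp add: euclidean_representation linear_cmul[OF bounded_linear.linear[OF linear]])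
  then show ?case using ex_terms_linear[of Basis f] unfolding f by simp
next
  case (const c)
  show ?case by (rule exI[of _ "[(c, restrict (\<lambda>_. 0) Basis)]"]) (auto simp: monomial_at_0)
next
  case (add f g)
  then obtain xs ys where "snd ` set xs \<subseteq> multi_indices" "\<And>h. eval_terms xs h = f h"
    "snd ` set ys \<subseteq> multi_indices" "\<And>h. eval_terms ys h = g h" by blast
  then show ?case by (intro exI[of _ "xs @ ys"]) auto
next
  case (mult f g)
  then obtain xs ys where "snd ` set xs \<subseteq> multi_indices" "\<And>h. eval_terms xs h = f h"
    "snd ` set ys \<subseteq> multi_indices" "\<And>h. eval_terms ys h = g h" by blast
  then show ?case using ex_terms_mult[of xs ys] by auto
qed

text \<open>Repeated exponents are merged by adding their coefficients; the resulting family is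
  finitely supported and independent of \<open>h\<close>.\<close>

lemma terms_has_sum:
  fixes zs :: "(real \<times> ('a::euclidean_space \<Rightarrow> nat)) list"
  assumes "snd ` set zs \<subseteq> multi_indices"
  shows "\<exists>a. \<forall>h. ((\<lambda>\<alpha>. monomial_at \<alpha> h * a \<alpha>) has_sum eval_terms zs h) multi_indices"
  using assms
proof (induction zs)
  case Nil show ?case by (rule exI[of _ "\<lambda>_. 0"]) auto
next
  case (Cons z zs)
  then obtain a where a: "\<And>h. ((\<lambda>\<alpha>. monomial_at \<alpha> h * a \<alpha>) has_sum eval_terms zs h) multi_indices" by auto
  have z: "snd z \<in> multi_indices" using Cons.prems by auto
  have "((\<lambda>\<alpha>. monomial_at \<alpha> h * (if \<alpha> = snd z then fst z else 0)) has_sum (fst z * monomial_at (snd z) h)) multi_indices" for h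
    by (rule has_sum_finite_neutralI[of "{snd z}"]) (use z in auto)
  then have "((\<lambda>\<alpha>. monomial_at \<alpha> h * ((if \<alpha> = snd z then fst z else 0) + a \<alpha>)) has_sum eval_terms (z # zs) h) multi_indices" for h
    using has_sum_add[OF _ a] by (simp add: distrib_left)
  then show ?case by (intro exI[of _ "\<lambda>\<alpha>. (if \<alpha> = snd z then fst z else 0) + a \<alpha>"]) blast
qed

lemma has_sum_sum_left:
  fixes f :: "'i \<Rightarrow> 'b \<Rightarrow> 'c::topological_comm_monoid_add"
  assumes "finite I" "\<And>i. i \<in> I \<Longrightarrow> (f i has_sum s i) A"
  shows "((\<lambda>x. \<Sum>i\<in>I. f i x) has_sum (\<Sum>i\<in>I. s i)) A"
  using assms by (induction rule: finite_induct) (auto intro: has_sum_add)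

lemma real_analytic_on_polynomial:
  fixes p :: "'a::euclidean_space \<Rightarrow> 'b::euclidean_space"
  assumes "polynomial_function p"
  shows "real_analytic_on p S"
  unfolding real_analytic_on_def
proof
  fix x assume "x \<in> S"
  have "\<exists>a. \<forall>h. ((\<lambda>\<alpha>. monomial_at \<alpha> h * a \<alpha>) has_sum (p (x + h) \<bullet> b)) multi_indices" for b
  proof -
    have "polynomial_function (p \<circ> (\<lambda>h. x + h))"
      using assms by (intro polynomial_function_compose) auto
    then have "real_polynomial_function (\<lambda>h. p (x + h) \<bullet> b)"
      using bounded_linear_inner_left[of b] unfolding polynomial_function_def by (auto simp: o_def)
    from ex_terms_polynomial[OF this]
    obtain zs where "snd ` set zs \<subseteq> multi_indices" "\<And>h. eval_terms zs h = p (x + h) \<bullet> b"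
      by blast
    then show ?thesis using terms_has_sum[of zs] by auto
  qed
  then obtain a where a: "\<And>b h. ((\<lambda>\<alpha>. monomial_at \<alpha> h * a b \<alpha>) has_sum (p (x + h) \<bullet> b)) multi_indices" by metis
  have "((\<lambda>\<alpha>. \<Sum>b\<in>Basis. (monomial_at \<alpha> h * a b \<alpha>) *\<^sub>R b) has_sum (\<Sum>b\<in>Basis. (p (x + h) \<bullet> b) *\<^sub>R b)) multi_indices" for h
    by (intro has_sum_sum_left has_sum_bounded_linear[OF bounded_linear_scaleR_left a]) simp
  then have "((\<lambda>\<alpha>. monomial_at \<alpha> h *\<^sub>R (\<Sum>b\<in>Basis. a b \<alpha> *\<^sub>R b)) has_sum p (x + h)) multi_indices" for h
    by (simp add: scaleR_sum_right euclidean_representation)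
  then show "\<exists>\<rho>>0. \<exists>a. \<forall>h\<in>ball 0 \<rho>. ((\<lambda>\<alpha>. (\<Prod>b\<in>Basis. (h \<bullet> b) ^ \<alpha> b) *\<^sub>R a \<alpha>) has_sum p (x + h)) multi_indices"
    unfolding monomial_at_def
    \<comment> \<open>The expansion is finite, so the radius is arbitrary.\<close>
    by (intro exI[of _ 1] conjI exI[of _ "\<lambda>\<alpha>. \<Sum>b\<in>Basis. a b \<alpha> *\<^sub>R b"] ballI) auto
qed

text \<open>Polynomials in the real coordinates, so that conjugation is allowed.\<close>

definition complex_poly :: "('a::real_normed_vector \<Rightarrow> complex) \<Rightarrow> bool" where
  "complex_poly f \<longleftrightarrow> real_polynomial_function (\<lambda>x. Re (f x)) \<and> real_polynomial_function (\<lambda>x. Im (f x))"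

lemma complex_poly_intros:
  "complex_poly (\<lambda>x. c)"
  "complex_poly f \<Longrightarrow> complex_poly g \<Longrightarrow> complex_poly (\<lambda>x. f x + g x)"
  "complex_poly f \<Longrightarrow> complex_poly g \<Longrightarrow> complex_poly (\<lambda>x. f x - g x)"
  "complex_poly f \<Longrightarrow> complex_poly g \<Longrightarrow> complex_poly (\<lambda>x. f x * g x)"
  "complex_poly f \<Longrightarrow> complex_poly (\<lambda>x. cnj (f x))"
  by (auto simp: complex_poly_def)

lemma complex_poly_nth: "complex_poly (\<lambda>x::complex^'n::finite. x $ k)"
proof -
  have "bounded_linear (\<lambda>x::complex^'n. Re (x $ k))" "bounded_linear (\<lambda>x::complex^'n. Im (x $ k))"
    using bounded_linear_compose[OF bounded_linear_Re bounded_linear_vec_nth]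
      bounded_linear_compose[OF bounded_linear_Im bounded_linear_vec_nth] by auto
  then show ?thesis by (auto simp: complex_poly_def)
qed

lemma polynomial_function_vecI:
  fixes f :: "'a::real_normed_vector \<Rightarrow> complex^'n::finite"
  assumes "\<And>k. complex_poly (\<lambda>x. f x $ k)"
  shows "polynomial_function f"
  unfolding polynomial_function_iff_Basis_inner
proof
  fix b :: "complex^'n" assume "b \<in> Basis"
  then obtain k c where b: "b = axis k c" "c \<in> Basis" by (auto simp: Basis_vec_def)
  then have "f x \<bullet> b = (if c = 1 then Re (f x $ k) else Im (f x $ k))" for x
    by (auto simp: inner_axis Basis_complex_def inner_complex_def)
  then show "real_polynomial_function (\<lambda>x. f x \<bullet> b)"
    using assms[of k] by (cases "c = 1") (auto simp: complex_poly_def)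
qed

section \<open>The torus bundle over the Riemann sphere\<close>

lemma has_derivative_vecI:
  fixes f :: "'a::real_normed_vector \<Rightarrow> complex^'n::finite"
  assumes "\<And>k. ((\<lambda>x. f x $ k) has_derivative (\<lambda>u. D u $ k)) (at x within S)"
  shows "(f has_derivative D) (at x within S)"
  unfolding has_derivative_componentwise_within[of f]
proof
  fix b :: "complex^'n" assume "b \<in> Basis"
  then obtain k e where b: "b = axis k e" by (auto simp: Basis_vec_def)
  show "((\<lambda>x. f x \<bullet> b) has_derivative (\<lambda>x. D x \<bullet> b)) (at x within S)"
    unfolding b inner_axis by (intro has_derivative_inner_left assms)
qed

section \<open>Gaussian integers and angular coordinates\<close>

definition gauss_int :: "complex set" where
  "gauss_int = {z. Re z \<in> \<int> \<and> Im z \<in> \<int>}"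

lemma gauss_int_add: "a \<in> gauss_int \<Longrightarrow> b \<in> gauss_int \<Longrightarrow> a + b \<in> gauss_int"
  and gauss_int_diff: "a \<in> gauss_int \<Longrightarrow> b \<in> gauss_int \<Longrightarrow> a - b \<in> gauss_int"
  and gauss_int_minus: "a \<in> gauss_int \<Longrightarrow> - a \<in> gauss_int"
  and gauss_int_0 [simp]: "0 \<in> gauss_int"
  and gauss_int_cnj: "a \<in> gauss_int \<Longrightarrow> cnj a \<in> gauss_int"
  and gauss_int_i: "a \<in> gauss_int \<Longrightarrow> \<i> * a \<in> gauss_int"
  by (auto simp: gauss_int_def)

lemma gauss_int_small: assumes "a \<in> gauss_int" "norm a < 1" shows "a = 0"
proof -
  have "\<bar>Re a\<bar> < 1" "\<bar>Im a\<bar> < 1"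
    using assms(2) abs_Re_le_cmod[of a] abs_Im_le_cmod[of a] by linarith+
  then have "Re a = 0" "Im a = 0"
    using assms(1) Ints_nonzero_abs_less1 by (auto simp: gauss_int_def)
  then show ?thesis by (simp add: complex_eq_iff)
qed

lemma ex_gauss_int: "\<exists>g\<in>gauss_int. 0 \<le> Re (a + g) \<and> Re (a + g) \<le> 1 \<and> 0 \<le> Im (a + g) \<and> Im (a + g) \<le> 1"
proof
  define g where "g = Complex (- of_int \<lfloor>Re a\<rfloor>) (- of_int \<lfloor>Im a\<rfloor>)"
  show "g \<in> gauss_int" by (simp add: g_def gauss_int_def)
  show "0 \<le> Re (a + g) \<and> Re (a + g) \<le> 1 \<and> 0 \<le> Im (a + g) \<and> Im (a + g) \<le> 1"
    by (simp add: g_def) linarith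
qed

lemma cis_2pi_eq_iff: "cis (2 * pi * a) = cis (2 * pi * b) \<longleftrightarrow> b - a \<in> \<int>"
proof -
  have "cis (2 * pi * a) = cis (2 * pi * b) \<longleftrightarrow> sin (2 * pi * b) = sin (2 * pi * a) \<and> cos (2 * pi * b) = cos (2 * pi * a)"
    by (auto simp: complex_eq_iff)
  also have "\<dots> \<longleftrightarrow> (\<exists>n::int. 2 * pi * b = 2 * pi * a + 2 * pi * n)"
    by (rule sin_cos_eq_iff)
  also have "\<dots> \<longleftrightarrow> (\<exists>n::int. b - a = n)"
  proof (intro ex_cong1)
    fix n :: int
    have "2 * pi * b = 2 * pi * a + 2 * pi * n \<longleftrightarrow> 2 * pi * (b - a) = 2 * pi * n" by (auto simp: algebra_simps)
    then show "2 * pi * b = 2 * pi * a + 2 * pi * n \<longleftrightarrow> b - a = n" by simp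
  qed
  also have "\<dots> \<longleftrightarrow> b - a \<in> \<int>" by (auto simp: Ints_def)
  finally show ?thesis .
qed

text \<open>The stereographic projections in the coordinates \<open>z\<close> (for \<open>False\<close>) and \<open>- 1 / z\<close> (for \<open>True\<close>).\<close>

definition sphere_point :: "bool \<Rightarrow> complex \<Rightarrow> complex \<times> real" where
  "sphere_point s z = (let N = 1 + (cmod z)^2 in
     if s then (- 2 * cnj z / of_real N, ((cmod z)^2 - 1) / N) else (2 * z / of_real N, (1 - (cmod z)^2) / N))"

lemma pos_norm [simp]: "1 + (cmod z)^2 > 0" "1 + (cmod z)^2 \<noteq> 0"
  by (smt (verit) zero_le_power2)+

lemma pos_norm_complex [simp]: "1 + (complex_of_real (cmod z))^2 \<noteq> 0" "1 + z * cnj z \<noteq> 0" "1 + cnj z * z \<noteq> 0"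
proof -
  have "1 + (complex_of_real (cmod z))^2 = complex_of_real (1 + (cmod z)^2)" by simp
  then show "1 + (complex_of_real (cmod z))^2 \<noteq> 0" using pos_norm(2)[of z] by (metis of_real_eq_0_iff)
  moreover have "z * cnj z = (complex_of_real (cmod z))^2" "cnj z * z = (complex_of_real (cmod z))^2"
    using complex_norm_square[of z] by (simp_all add: mult.commute)
  ultimately show "1 + z * cnj z \<noteq> 0" "1 + cnj z * z \<noteq> 0" by simp_all
qed

text \<open>The height determines \<open>|z|\<close>, because \<open>(1 - t) / (1 + t)\<close> is
  injective for \<open>t \<ge> 0\<close>, and then the first component determines \<open>z\<close>.
  The projection \<open>True\<close> is \<open>False\<close> followed by a half turn of the sphere,
  which acts as \<open>z \<mapsto> - 1 / z\<close>.\<close>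

lemma sphere_point_eq_iff:
  "sphere_point s z = sphere_point s' z' \<longleftrightarrow> (if s = s' then z' = z else z \<noteq> 0 \<and> z' = - 1 / z)"
proof -
  have inj: "a = b" if "(1 - a) / (1 + a) = (1 - b) / (1 + b)" "a \<ge> 0" "b \<ge> 0" for a b :: real
  proof -
    have "(1 - a) * (1 + b) = (1 - b) * (1 + a)" using that by (simp add: frac_eq_eq)
    then show ?thesis by (simp add: algebra_simps)
  qed
  have same: "z' = z" if "sphere_point False z = sphere_point False z'" for z z'
  proof -
    have "(cmod z)^2 = (cmod z')^2" using that inj[of "(cmod z)^2" "(cmod z')^2"] by (simp add: sphere_point_def Let_def)
    then show ?thesis using that by (simp add: sphere_point_def Let_def)
  qed
  have true: "sphere_point True z = (- cnj (fst (sphere_point False z)), - snd (sphere_point False z))" for z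
  proof -
    have "((cmod z)^2 - 1) / (1 + (cmod z)^2) = - ((1 - (cmod z)^2) / (1 + (cmod z)^2))"
      by (metis minus_diff_eq minus_divide_left)
    then show ?thesis by (simp add: sphere_point_def Let_def)
  qed
  have swap: "sphere_point True (-1 / z) = sphere_point False z" if "z \<noteq> 0" for z
  proof -
    have n: "cmod z ^ 2 > 0" using that by simp
    have 1: "(cmod (-1/z))^2 = 1 / (cmod z)^2" by (simp add: norm_divide power_divide)
    have 2: "((cmod (-1/z))^2 - 1) / (1 + (cmod (-1/z))^2) = (1 - (cmod z)^2) / (1 + (cmod z)^2)"
    proof -
      have "(1 / t - 1) / (1 + 1 / t) = (1 - t) / (1 + t)" if "t > 0" for t :: real
      proof -
        have "1 + 1 / t = (1 + t) / t" "1 / t - 1 = (1 - t) / t" using that by (simp_all add: field_simps)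
        then show ?thesis using that by simp
      qed
      then show ?thesis unfolding 1 using n by blast
    qed
    have "(cmod z)^2 * (1 + 1 / (cmod z)^2) = 1 + (cmod z)^2" using n by (simp add: field_simps)
    then have 3: "complex_of_real (1 + (cmod z)^2) = z * cnj z * complex_of_real (1 + 1 / (cmod z)^2)"
      by (metis complex_norm_square of_real_mult)
    have "- 2 * cnj (-1/z) / complex_of_real (1 + 1 / (cmod z)^2) = 2 * z / complex_of_real (1 + (cmod z)^2)"
    proof -
      have "- 2 * cnj (-1/z) / e = 2 * z / (z * cnj z * e)" for e using that by simp
      then show ?thesis unfolding 3 .
    qed
    then have "- 2 * cnj (-1/z) / complex_of_real (1 + (cmod (-1/z))^2) = 2 * z / complex_of_real (1 + (cmod z)^2)"
      unfolding 1 .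
    then show ?thesis unfolding sphere_point_def Let_def using 2 by (simp only: if_True if_False)
  qed
  have opp: "z \<noteq> 0 \<and> z' = - 1 / z" if "sphere_point False z = sphere_point True z'" for z z'
  proof -
    have "z \<noteq> 0"
    proof
      assume "z = 0"
      then have "((cmod z')^2 - 1) / (1 + (cmod z')^2) = 1" using that by (simp add: sphere_point_def Let_def)
      then have "(cmod z')^2 - 1 = 1 + (cmod z')^2" by (metis divide_eq_1_iff)
      then show False by simp
    qed
    moreover have "z' = -1 / z"
      using that swap[OF \<open>z \<noteq> 0\<close>] same[of z' "-1/z"] unfolding true by (metis complex_cnj_cnj fst_conv minus_minus snd_conv prod.collapse)
    ultimately show ?thesis by simp
  qed
  show ?thesis
  proof (cases s; cases s')
    assume "\<not> s" "\<not> s'" then show ?thesis using same by auto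
  next
    assume "s" "s'" then show ?thesis using same[of z z'] unfolding true
      by (auto simp: true) (metis complex_cnj_cnj minus_minus prod.collapse)
  next
    assume "\<not> s" "s'" then show ?thesis using opp[of z z'] swap by auto
  next
    assume "s" "\<not> s'"
    have "z' \<noteq> 0 \<and> z = -1 / z' \<longleftrightarrow> z \<noteq> 0 \<and> z' = - 1 / z" by (auto simp: field_simps)
    then show ?thesis using opp[of z' z] swap[of z'] \<open>s\<close> \<open>\<not> s'\<close> by auto
  qed
qed

lemma continuous_sphere_point: "continuous_on UNIV (\<lambda>z. sphere_point s z)"
  by (cases s; simp add: sphere_point_def Let_def; intro continuous_intros) 
    (auto simp: pos_norm_complex)

text \<open>The coordinate \<open>i0\<close> is that of the sphere; the coordinates \<open>k\<close> with \<open>eps k \<noteq> 0\<close> are \<open>a, b, a', b'\<close>,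
  where \<open>m\<close> swaps \<open>a\<close> with \<open>b\<close> and \<open>a'\<close> with \<open>b'\<close>, and \<open>c\<close> swaps \<open>a\<close> with \<open>a'\<close> and \<open>b\<close> with \<open>b'\<close>. The sign in
  \<open>a + z b\<^sup>*\<close> and \<open>b - z a\<^sup>*\<close> is \<open>eps k\<close>, and \<open>al k\<close> is the diagonal entry of the cat map. With
  \<open>eps k = 0\<close> elsewhere, the same formulas cover the remaining coordinates.\<close>

locale twistor_data =
  fixes i0 :: "'n::finite" and m c :: "'n \<Rightarrow> 'n" and eps al :: "'n \<Rightarrow> complex"
  assumes eps_i0 [simp]: "eps i0 = 0"
    and eps_cases: "eps k = 1 \<or> eps k = - 1 \<or> eps k = 0"
    and mm [simp]: "m (m k) = k" and cc [simp]: "c (c k) = k" and mc: "m (c k) = c (m k)"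
    and eps_m [simp]: "eps (m k) = - eps k" and eps_c [simp]: "eps (c k) = eps k"
    and al_m [simp]: "al (m k) = al k"
    and al_cases: "eps k \<noteq> 0 \<Longrightarrow> al k = 1 \<and> al (c k) = 2 \<or> al k = 2 \<and> al (c k) = 1"
    and al_0: "eps k = 0 \<Longrightarrow> al k = 1"
    and ex_eps: "\<exists>k. eps k \<noteq> 0"
begin

lemma cnj_eps [simp]: "cnj (eps k) = eps k"
  using eps_cases[of k] by auto

lemma eps_sq: "eps k * eps k = (if eps k = 0 then 0 else 1)"
  using eps_cases[of k] by auto

lemma m_neq_i0: "eps k \<noteq> 0 \<Longrightarrow> m k \<noteq> i0" "eps k \<noteq> 0 \<Longrightarrow> k \<noteq> i0" "eps k \<noteq> 0 \<Longrightarrow> c k \<noteq> i0"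
  by (metis eps_i0 eps_m neg_equal_0_iff_equal, metis eps_i0, metis eps_i0 eps_c)

text \<open>\<open>Psi\<close> maps the real coordinates to the holomorphic ones. Leaves, lattice and topology are simple
  in the former.\<close>

definition Psi :: "complex^'n \<Rightarrow> complex^'n" where
  "Psi y = (\<chi> k. y $ k + eps k * y $ i0 * cnj (y $ m k))"

text \<open>The determinant of the system that \<open>Psi\<close> defines on a pair of coordinates:
  \<open>1 + |z|^2\<close> where \<open>eps k \<noteq> 0\<close>, and 1 elsewhere.
  \<open>Psi_inv\<close> is then Cramer's rule.\<close>

definition den :: "complex \<Rightarrow> 'n \<Rightarrow> complex" where
  "den z k = 1 + eps k * eps k * (z * cnj z)"

definition Psi_inv :: "complex^'n \<Rightarrow> complex^'n" where
  "Psi_inv x = (\<chi> k. (x $ k - eps k * x $ i0 * cnj (x $ m k)) / den (x $ i0) k)"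

lemma den_nonzero [simp]: "den z k \<noteq> 0"
  by (auto simp: den_def eps_sq)

lemma Psi_nth: "Psi y $ k = y $ k + eps k * y $ i0 * cnj (y $ m k)"
  by (simp add: Psi_def)

lemma Psi_inv_nth: "Psi_inv x $ k = (x $ k - eps k * x $ i0 * cnj (x $ m k)) / den (x $ i0) k"
  by (simp add: Psi_inv_def)

lemma den_i0 [simp]: "den z i0 = 1" by (simp add: den_def)

lemma den_m [simp]: "den z (m k) = den z k" by (simp add: den_def)

lemma cnj_den [simp]: "cnj (den z k) = den z k" by (simp add: den_def mult.commute)

lemma Psi_i0 [simp]: "Psi y $ i0 = y $ i0" by (simp add: Psi_nth)

lemma Psi_inv_i0 [simp]: "Psi_inv y $ i0 = y $ i0" by (simp add: Psi_inv_nth)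

lemma Psi_inv_Psi [simp]: "Psi_inv (Psi y) = y"
proof -
  have "y $ k + eps k * y $ i0 * cnj (y $ m k) - eps k * y $ i0 * cnj (Psi y $ m k) = den (y $ i0) k * y $ k" for k
    by (simp add: Psi_nth den_def algebra_simps)
  then show ?thesis by (simp add: vec_eq_iff Psi_inv_nth Psi_nth)
qed

lemma Psi_Psi_inv [simp]: "Psi (Psi_inv x) = x"
proof -
  have "Psi (Psi_inv x) $ k = x $ k" for k
  proof -
    have "Psi (Psi_inv x) $ k = ((x $ k - eps k * x $ i0 * cnj (x $ m k)) +
       eps k * x $ i0 * cnj (x $ m k + eps k * x $ i0 * cnj (x $ k))) / den (x $ i0) k"
      by (simp add: Psi_nth Psi_inv_nth add_divide_distrib diff_divide_distrib ring_distribs)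
    also have "\<dots> = den (x $ i0) k * x $ k / den (x $ i0) k"
      by (rule arg_cong[of _ _ "\<lambda>t. t / _"]) (simp add: den_def algebra_simps)
    finally show ?thesis by simp
  qed
  then show ?thesis by (simp add: vec_eq_iff)
qed

lemma continuous_Psi: "continuous_on S Psi"
  unfolding Psi_def by (intro continuous_intros)

lemma continuous_Psi_inv: "continuous_on S Psi_inv"
  unfolding Psi_inv_def den_def
  by (intro continuous_intros) (use den_nonzero in \<open>auto simp: den_def\<close>)

text \<open>In the second chart of the sphere, with coordinate \<open>- 1 / z\<close>, the same formulas describe the complex
  structure if \<open>(a, b)\<close> is replaced by \<open>(\<i> b\<^sup>*, \<i> a\<^sup>*)\<close>; the factor \<open>\<i>\<close> makes this an involution.\<close>

definition R :: "bool \<Rightarrow> complex^'n \<Rightarrow> complex^'n" where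
  "R s y = (\<chi> k. if s \<and> eps k \<noteq> 0 then \<i> * cnj (y $ m k) else y $ k)"

lemma R_nth: "R s y $ k = (if s \<and> eps k \<noteq> 0 then \<i> * cnj (y $ m k) else y $ k)"
  by (simp add: R_def)

lemma R_R [simp]: "R s (R s y) = y"
  by (simp add: vec_eq_iff R_nth)

lemma R_i0 [simp]: "R s y $ i0 = y $ i0" by (simp add: R_nth)

lemma R_False [simp]: "R False y = y" by (simp add: vec_eq_iff R_nth)

lemma R_add: "R s (x + y) = R s x + R s y" and R_diff: "R s (x - y) = R s x - R s y"
  by (simp_all add: vec_eq_iff R_nth algebra_simps)

lemma continuous_R: "continuous_on S (R s)"
proof -
  have "continuous_on S (\<lambda>y. if s \<and> eps k \<noteq> 0 then \<i> * cnj (y $ m k) else y $ k)" for k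
    by (cases "s \<and> eps k \<noteq> 0") (auto intro!: continuous_intros)
  then show ?thesis unfolding R_def by (rule continuous_on_vec_lambda)
qed

definition lat :: "(complex^'n) set" where
  "lat = {\<gamma>. \<gamma> $ i0 = 0 \<and> (\<forall>k. \<gamma> $ k \<in> gauss_int)}"

lemma lat_iff: "\<gamma> \<in> lat \<longleftrightarrow> \<gamma> $ i0 = 0 \<and> (\<forall>k. k \<noteq> i0 \<longrightarrow> \<gamma> $ k \<in> gauss_int)"
  unfolding lat_def using gauss_int_0 by force

text \<open>Conjugation and the factor \<open>\<i>\<close> preserve the Gaussian integers, so both
  parametrizations have the same lattice.\<close>

lemma R_lat: "R s \<gamma> \<in> lat \<longleftrightarrow> \<gamma> \<in> lat"
proof -
  have *: "R s \<gamma> \<in> lat" if "\<gamma> \<in> lat" for \<gamma>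
    using that by (auto simp: lat_def R_nth intro!: gauss_int_i gauss_int_cnj)
  show ?thesis using *[of \<gamma>] *[of "R s \<gamma>"] by auto
qed

text \<open>\<open>H False\<close> and \<open>H True\<close> glue two copies of coordinate space to a compact subset of a Euclidean
  space, which defines the points of the manifold.\<close>

definition H :: "bool \<Rightarrow> complex^'n \<Rightarrow> (complex \<times> real) \<times> (complex^'n) \<times> (complex^'n)" where
  "H s y = (sphere_point s (y $ i0), (\<chi> k. if k = i0 then 1 else cis (2 * pi * Re (R s y $ k))),
      (\<chi> k. if k = i0 then 1 else cis (2 * pi * Im (R s y $ k))))"

text \<open>The change between the two real coordinate systems; the same formula serves both
  directions, up to the lattice.\<close>

definition S where "S y = (\<chi> k. if k = i0 then - 1 / y $ i0 else R True y $ k)"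

lemma S_nth: "S y $ k = (if k = i0 then - 1 / y $ i0 else R True y $ k)" by (simp add: S_def)

lemma H_eq_gauss: "H s y = H s' y' \<longleftrightarrow> (if s = s' then y' $ i0 = y $ i0 else y $ i0 \<noteq> 0 \<and> y' $ i0 = - 1 / y $ i0)
    \<and> (\<forall>k. k \<noteq> i0 \<longrightarrow> R s' y' $ k - R s y $ k \<in> gauss_int)"
proof -
  have "H s y = H s' y' \<longleftrightarrow> sphere_point s (y $ i0) = sphere_point s' (y' $ i0) \<and>
    (\<forall>k. k \<noteq> i0 \<longrightarrow> cis (2 * pi * Re (R s y $ k)) = cis (2 * pi * Re (R s' y' $ k))) \<and>
    (\<forall>k. k \<noteq> i0 \<longrightarrow> cis (2 * pi * Im (R s y $ k)) = cis (2 * pi * Im (R s' y' $ k)))"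
    unfolding H_def prod.inject vec_eq_iff vec_lambda_beta by auto
  then show ?thesis unfolding cis_2pi_eq_iff sphere_point_eq_iff
    by (auto simp: gauss_int_def)
qed

lemma H_eq_iff: "H s y = H s' y' \<longleftrightarrow> (if s = s' then y' - y \<in> lat else y $ i0 \<noteq> 0 \<and> y' - S y \<in> lat)"
proof (cases "s = s'")
  case True
  have "H s y = H s' y' \<longleftrightarrow> R s (y' - y) \<in> lat"
    unfolding H_eq_gauss R_diff lat_iff using True by auto
  then show ?thesis using True R_lat by simp
next
  case False
  have 1: "R True (S y) = (\<chi> k. if k = i0 then - 1 / y $ i0 else y $ k)"
  proof -
    have "R True (S y) $ k = (if k = i0 then - 1 / y $ i0 else y $ k)" for k
      using m_neq_i0[of k] by (auto simp: R_nth S_nth)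
    then show ?thesis by (simp add: vec_eq_iff)
  qed
  have "R s' (S y) $ k = R s y $ k" if "k \<noteq> i0" for k
    using False 1 that by (cases s'; cases s) (auto simp: S_nth)
  then have "H s y = H s' y' \<longleftrightarrow> y $ i0 \<noteq> 0 \<and> R s' (y' - S y) \<in> lat"
    unfolding H_eq_gauss R_diff using False
    by (auto simp: lat_iff S_nth add_eq_0_iff)
  then show ?thesis using False R_lat by simp
qed

lemma continuous_H: "continuous_on UNIV (H s)"
  unfolding H_def
proof (intro continuous_on_Pair)
  show "continuous_on UNIV (\<lambda>x::complex^'n. sphere_point s (x $ i0))"
    by (rule continuous_on_compose2[OF continuous_sphere_point]) (auto intro: continuous_intros)
  have r: "continuous_on UNIV (\<lambda>x. R s x $ k)" for k
    by (intro continuous_on_component continuous_R)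
  have "continuous_on UNIV (\<lambda>x. if k = i0 then 1 else cis (2 * pi * Re (R s x $ k)))"
    "continuous_on UNIV (\<lambda>x. if k = i0 then 1 else cis (2 * pi * Im (R s x $ k)))" for k
    by (cases "k = i0"; simp; intro continuous_intros r)+
  then show "continuous_on UNIV (\<lambda>x. \<chi> k. if k = i0 then 1 else cis (2 * pi * Re (R s x $ k)))"
    "continuous_on UNIV (\<lambda>x. \<chi> k. if k = i0 then 1 else cis (2 * pi * Im (R s x $ k)))"
    by (auto intro: continuous_on_vec_lambda)
qed

text \<open>A lattice translation seen in the holomorphic coordinates. The conjugation falls only on
  the constant \<open>\<gamma>\<close>, so the map is holomorphic in \<open>x\<close>.\<close>

definition shift :: "complex^'n \<Rightarrow> complex^'n \<Rightarrow> complex^'n" where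
  "shift \<gamma> x = (\<chi> k. x $ k + \<gamma> $ k + eps k * x $ i0 * cnj (\<gamma> $ m k))"

lemma shift_nth: "shift \<gamma> x $ k = x $ k + \<gamma> $ k + eps k * x $ i0 * cnj (\<gamma> $ m k)"
  by (simp add: shift_def)

lemma Psi_add_lat: "\<gamma> \<in> lat \<Longrightarrow> Psi (y + \<gamma>) = shift \<gamma> (Psi y)"
  by (simp add: vec_eq_iff shift_nth Psi_nth lat_def algebra_simps)

text \<open>\<open>S\<close> seen in the holomorphic coordinates: the transition function of
  \<open>O(1)\<close>, division by the base coordinate, up to constants of modulus 1.\<close>

definition tau :: "complex^'n \<Rightarrow> complex^'n" where
  "tau x = (\<chi> k. if k = i0 then - 1 / x $ i0 else if eps k = 0 then x $ k else \<i> * eps k * x $ k / x $ i0)"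

lemma tau_nth: "tau x $ k = (if k = i0 then - 1 / x $ i0 else if eps k = 0 then x $ k else \<i> * eps k * x $ k / x $ i0)"
  by (simp add: tau_def)

text \<open>With \<open>a = y $ k\<close>, \<open>b = y $ m k\<close>, \<open>z = y $ i0\<close> and
  \<open>eps k * eps k = 1\<close>, both sides equal
  \<open>\<i> * eps k * (a + eps k * z * cnj b) / z\<close>: the two conjugations of
  \<open>a\<close> cancel.\<close>

lemma Psi_S:
  assumes "y $ i0 \<noteq> 0" shows "Psi (S y) = tau (Psi y)"
proof -
  have "Psi (S y) $ k = tau (Psi y) $ k" for k
    using assms eps_cases[of k] m_neq_i0[of k]
    by (auto simp: Psi_nth[of _ k] S_nth R_nth tau_nth field_simps)
  then show ?thesis by (simp add: vec_eq_iff)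
qed

end

text \<open>Openness of the parametrizations holds because a coincidence of two points extends to
  neighbouring points through the continuous germ \<open>T\<close>.\<close>

lemma coordinate_coverI:
  fixes X :: "'a topology" and q :: "'s \<Rightarrow> complex^'n::finite \<Rightarrow> 'a"
  assumes openin_iff: "\<And>U. openin X U \<longleftrightarrow> U \<subseteq> (\<Union>s. range (q s)) \<and> (\<forall>s. open (q s -` U))"
    and trans: "\<And>s x s' x'. q s x = q s' x' \<Longrightarrow> \<exists>T. (T \<longlongrightarrow> x') (nhds x) \<and> (\<forall>\<^sub>F v in nhds x. q s' (T v) = q s v)"
  shows "coordinate_cover X q"
proof
  show "openin X U \<longleftrightarrow> U \<subseteq> (\<Union>s. range (q s)) \<and> (\<forall>s. open (q s -` U))" for U by (rule openin_iff)
  fix B :: "(complex^'n) set" and s assume B: "open B"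
  have "open (q s' -` q s ` B)" for s'
    unfolding open_subopen[of "q s' -` q s ` B"]
  proof
    fix x' assume "x' \<in> q s' -` q s ` B"
    then obtain x where x: "x \<in> B" "q s' x' = q s x" by auto
    from trans[OF x(2)] obtain T where T: "(T \<longlongrightarrow> x) (nhds x')" "\<forall>\<^sub>F v in nhds x'. q s (T v) = q s' v" by blast
    have "\<forall>\<^sub>F v in nhds x'. T v \<in> B"
      using T(1) eventually_nhds_in_open[OF B x(1)] by (auto simp: filterlim_iff)
    with T(2) have "\<forall>\<^sub>F v in nhds x'. v \<in> q s' -` q s ` B"
      by eventually_elim (metis imageI vimageI)
    then show "\<exists>O'. open O' \<and> x' \<in> O' \<and> O' \<subseteq> q s' -` q s ` B"
      unfolding eventually_nhds by blast
  qed
  then show "openin X (q s ` B)" unfolding openin_iff by blast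
qed

text \<open>\<open>p\<close> and, below, \<open>q\<close> are the parametrizations by the real and by the holomorphic coordinates.\<close>

locale twistor_manifold = twistor_data i0 m c eps al
  for i0 :: "'n::finite" and m c :: "'n \<Rightarrow> 'n" and eps al :: "'n \<Rightarrow> complex" +
  fixes X :: "'a topology" and p :: "bool \<Rightarrow> complex^'n \<Rightarrow> 'a"
  assumes p_eq_iff: "p s y = p s' y' \<longleftrightarrow> H s y = H s' y'"
    and openin_p: "openin X U \<longleftrightarrow> U \<subseteq> (\<Union>s. range (p s)) \<and> (\<forall>s. open (p s -` U))"
begin

lemma p_add_lat: "\<gamma> \<in> lat \<Longrightarrow> p s (y + \<gamma>) = p s y"
  using p_eq_iff[of s y s "y + \<gamma>"] H_eq_iff[of s y s "y + \<gamma>"] by simp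

lemma p_S: "y $ i0 \<noteq> 0 \<Longrightarrow> p (\<not> s) (S y) = p s y"
  using p_eq_iff[of s y "\<not> s" "S y"] H_eq_iff[of s y "\<not> s" "S y"] by (simp add: lat_def)

lemma p_cases:
  assumes "p s y = p s' y'"
  obtains \<gamma> where "s' = s" "\<gamma> \<in> lat" "y' = y + \<gamma>"
  | \<gamma> where "s' = (\<not> s)" "y $ i0 \<noteq> 0" "\<gamma> \<in> lat" "y' = S y + \<gamma>"
proof (cases "s = s'")
  case True
  then show ?thesis using assms that(1)[of "y' - y"] by (auto simp: p_eq_iff H_eq_iff)
next
  case False
  then show ?thesis using assms that(2)[of "y' - S y"] by (auto simp: p_eq_iff H_eq_iff)
qed

lemma eventually_i0:
  assumes "x $ i0 \<noteq> 0" shows "\<forall>\<^sub>F v::complex^'n in nhds x. v $ i0 \<noteq> 0"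
proof -
  have "open {v::complex^'n. v $ i0 \<noteq> 0}" by (intro open_Collect_neq continuous_intros)
  from eventually_nhds_in_open[OF this] show ?thesis using assms by simp
qed

lemma S_tendsto: assumes "y $ i0 \<noteq> 0" shows "(S \<longlongrightarrow> S y) (nhds y)"
proof (rule vec_tendstoI)
  fix k
  have "continuous (at y) (\<lambda>v. v $ k)" for k by (intro continuous_intros)
  then have n: "((\<lambda>v. v $ k) \<longlongrightarrow> y $ k) (nhds y)" for k
    using tendsto_at_iff_tendsto_nhds unfolding continuous_within by blast
  show "((\<lambda>x. S x $ k) \<longlongrightarrow> S y $ k) (nhds y)"
  proof (cases "k = i0")
    case True then show ?thesis using assms by (simp add: S_nth) (intro tendsto_intros n)
  next
    case False then show ?thesis by (cases "eps k \<noteq> 0") (auto simp: S_nth R_nth intro!: tendsto_intros n)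
  qed
qed

sublocale p: coordinate_cover X p
proof (rule coordinate_coverI[OF openin_p])
  fix s y s' y' assume "p s y = p s' y'"
  then show "\<exists>T. (T \<longlongrightarrow> y') (nhds y) \<and> (\<forall>\<^sub>F v in nhds y. p s' (T v) = p s v)"
  proof (cases rule: p_cases)
    case (1 \<gamma>)
    then show ?thesis
      by (intro exI[of _ "\<lambda>v. v + \<gamma>"]) (auto simp: p_add_lat intro!: tendsto_intros filterlim_ident)
  next
    case (2 \<gamma>)
    have "\<forall>\<^sub>F v in nhds y. p s' (S v + \<gamma>) = p s v"
      using eventually_i0[OF 2(2)] by eventually_elim (use 2 in \<open>simp add: p_add_lat p_S\<close>)
    then show ?thesis using 2
      by (intro exI[of _ "\<lambda>v. S v + \<gamma>"]) (auto intro!: tendsto_intros S_tendsto)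
  qed
qed

section \<open>Holomorphic coordinate changes and their derivatives\<close>

definition q where "q s x = p s (Psi_inv x)"

lemma q_Psi [simp]: "q s (Psi y) = p s y" by (simp add: q_def)

lemma range_q: "range (q s) = range (p s)"
proof (intro set_eqI iffI)
  fix P assume "P \<in> range (p s)"
  then obtain y where "P = q s (Psi y)" by auto
  then show "P \<in> range (q s)" by blast
qed (auto simp: q_def)

definition NN :: "complex^'n \<Rightarrow> real" where "NN x = 1 + (cmod (x $ i0))^2"

text \<open>Along a leaf \<open>du\<^sub>k = eps\<^sub>k b\<^sup>* dz\<close> with \<open>b\<close> the real coordinate \<open>m k\<close>, so \<open>dl x u k\<close> measures how far \<open>u\<close>
  is from being tangent to the leaf. It transforms by a scalar under the transition maps.\<close>

definition dl :: "complex^'n \<Rightarrow> complex^'n \<Rightarrow> 'n \<Rightarrow> complex" where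
  "dl x u k = u $ k - eps k * u $ i0 * cnj (Psi_inv x $ m k)"

definition Dshift where "Dshift \<gamma> u = (\<chi> k. u $ k + eps k * u $ i0 * cnj (\<gamma> $ m k))"

definition Dtau where "Dtau x u = (\<chi> k. if k = i0 then u $ i0 / (x $ i0)^2 else if eps k = 0 then u $ k
   else \<i> * eps k * (u $ k / x $ i0 - x $ k * u $ i0 / (x $ i0)^2))"

lemma Dshift_i0 [simp]: "Dshift \<gamma> u $ i0 = u $ i0" by (simp add: Dshift_def)

lemma Dtau_i0 [simp]: "Dtau x u $ i0 = u $ i0 / (x $ i0)^2" by (simp add: Dtau_def)

lemma shift_derivative: "(shift \<gamma> has_derivative Dshift \<gamma>) (at x)"
  by (rule has_derivative_vecI) (auto simp: shift_nth Dshift_def intro!: derivative_eq_intros bounded_linear_imp_has_derivative bounded_linear_vec_nth)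

lemma nth_derivative: "((\<lambda>v. v $ k) has_derivative (\<lambda>v. v $ k)) (at x within A)"
  by (intro bounded_linear_imp_has_derivative bounded_linear_vec_nth)

lemma tau_derivative:
  assumes "x $ i0 \<noteq> 0" shows "(tau has_derivative Dtau x) (at x)"
proof (rule has_derivative_vecI)
  fix k
  show "((\<lambda>x. tau x $ k) has_derivative (\<lambda>u. Dtau x u $ k)) (at x)"
  proof (cases "k = i0")
    case True
    have "((\<lambda>x. - 1 / x $ i0) has_derivative (\<lambda>u. u $ i0 / (x $ i0)^2)) (at x)"
      using assms by (auto intro!: derivative_eq_intros nth_derivative simp: field_simps power2_eq_square)
    then show ?thesis using True by (simp add: tau_nth Dtau_def)
  next
    case False
    have "((\<lambda>x. \<i> * eps k * x $ k / x $ i0) has_derivative (\<lambda>u. \<i> * eps k * (u $ k / x $ i0 - x $ k * u $ i0 / (x $ i0)^2))) (at x)"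
      using assms by (auto intro!: derivative_eq_intros nth_derivative simp: field_simps power2_eq_square)
    then show ?thesis using False by (cases "eps k = 0") (auto simp: tau_nth Dtau_def intro: nth_derivative)
  qed
qed

lemma Psi_inv_shift: "\<gamma> \<in> lat \<Longrightarrow> Psi_inv (shift \<gamma> x) = Psi_inv x + \<gamma>"
  using Psi_add_lat[of \<gamma> "Psi_inv x"] by (metis Psi_Psi_inv Psi_inv_Psi)

lemma Psi_inv_tau: "x $ i0 \<noteq> 0 \<Longrightarrow> Psi_inv (tau x) = S (Psi_inv x)"
  using Psi_S[of "Psi_inv x"] by (metis Psi_Psi_inv Psi_inv_Psi Psi_inv_i0)

lemma dl_shift: "\<gamma> \<in> lat \<Longrightarrow> dl (shift \<gamma> x) (Dshift \<gamma> u) k = dl x u k"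
  by (simp add: dl_def Psi_inv_shift Dshift_def algebra_simps)

lemma dl_tau:
  assumes "x $ i0 \<noteq> 0" "eps k \<noteq> 0"
  shows "dl (tau x) (Dtau x u) k = \<i> * eps k / x $ i0 * dl x u k"
proof -
  define y where "y = Psi_inv x"
  have x: "x $ k = y $ k + eps k * x $ i0 * cnj (y $ m k)"
    using Psi_nth[of y k] by (simp add: y_def)
  have "dl (tau x) (Dtau x u) k =
      \<i> * eps k * (u $ k / x $ i0 - x $ k * u $ i0 / (x $ i0)^2) + \<i> * eps k * (u $ i0 / (x $ i0)^2) * y $ k"
    using assms m_neq_i0[of k] by (simp add: dl_def Psi_inv_tau Dtau_def S_nth R_nth y_def algebra_simps)
  also have "\<dots> = \<i> * eps k / x $ i0 * (u $ k - eps k * u $ i0 * cnj (y $ m k))"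
    unfolding x using assms(1) by (simp add: field_simps power2_eq_square)
  finally show ?thesis by (simp add: dl_def y_def)
qed

text \<open>Collects what later invariance proofs need from a coordinate change. The scalar law for
  \<open>dl\<close> preserves the center field, \<open>\<theta> (c k) = \<theta> k\<close> makes the
  derivative commute with the cat map on torus directions, and the two norm identities make the
  metric well defined.\<close>

lemma q_transition:
  assumes "q s x = q s' x'"
  shows "\<exists>T D \<theta>0 \<theta>. (T has_derivative D) (at x) \<and> (\<forall>a v. D (a *s v) = a *s D v) \<and> T x = x' \<and>
    (\<forall>\<^sub>F v in nhds x. q s' (T v) = q s v) \<and>
    (\<forall>u. D u $ i0 = \<theta>0 * u $ i0) \<and> (\<forall>u k. k \<noteq> i0 \<longrightarrow> dl x' (D u) k = \<theta> k * dl x u k) \<and>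
    \<theta>0 \<noteq> 0 \<and> (\<forall>k. \<theta> k \<noteq> 0 \<and> \<theta> (c k) = \<theta> k \<and> (eps k = 0 \<longrightarrow> \<theta> k = 1) \<and>
      (eps k \<noteq> 0 \<longrightarrow> (cmod (\<theta> k))^2 / NN x' = 1 / NN x)) \<and> cmod \<theta>0 / NN x' = 1 / NN x"
proof -
  have eq: "p s (Psi_inv x) = p s' (Psi_inv x')" using assms by (simp add: q_def)
  have lin: "Dshift \<gamma> (a *s v) = a *s Dshift \<gamma> v" "Dtau x (a *s v) = a *s Dtau x v" for a v \<gamma>
    by (auto simp: Dshift_def Dtau_def vec_eq_iff algebra_simps)
  from eq show ?thesis
  proof (cases rule: p_cases)
    case (1 \<gamma>)
    have x': "x' = shift \<gamma> x" using 1 Psi_add_lat[of \<gamma> "Psi_inv x"] by (metis Psi_Psi_inv)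
    have \<gamma>0: "\<gamma> $ i0 = 0" using 1 by (simp add: lat_def)
    show ?thesis
      by (rule exI[of _ "shift \<gamma>"], rule exI[of _ "Dshift \<gamma>"], rule exI[of _ 1], rule exI[of _ "\<lambda>_. 1"])
        (use 1 \<gamma>0 in \<open>auto simp: x' shift_derivative lin dl_shift q_def Psi_inv_shift p_add_lat NN_def shift_nth\<close>)
  next
    case (2 \<gamma>)
    have z: "x $ i0 \<noteq> 0" using 2 by simp
    have x': "x' = shift \<gamma> (tau x)"
      using 2 Psi_add_lat[of \<gamma> "S (Psi_inv x)"] Psi_S[of "Psi_inv x"] by (metis Psi_Psi_inv Psi_inv_i0)
    have \<gamma>0: "\<gamma> $ i0 = 0" using 2 by (simp add: lat_def)
    have d: "((shift \<gamma> \<circ> tau) has_derivative (Dshift \<gamma> \<circ> Dtau x)) (at x)"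
      by (intro diff_chain_at tau_derivative z shift_derivative)
    have ev: "\<forall>\<^sub>F v in nhds x. q s' ((shift \<gamma> \<circ> tau) v) = q s v"
      using eventually_i0[OF z]
      by eventually_elim (use 2 in \<open>simp add: q_def Psi_inv_shift Psi_inv_tau p_add_lat p_S\<close>)
    define \<theta> where "\<theta> k = (if eps k = 0 then 1 else \<i> * eps k / x $ i0)" for k
    have dl': "dl x' ((Dshift \<gamma> \<circ> Dtau x) u) k = \<theta> k * dl x u k" if "k \<noteq> i0" for u k
      using that dl_tau[OF z, of k u] 2(3)
      by (auto simp: x' dl_shift \<theta>_def) (auto simp: dl_def Dtau_def)
    \<comment> \<open>The new base coordinate has modulus \<open>1 / |z|\<close>, so
      \<open>NN x'\<close> is \<open>NN x / |z|^2\<close>, while \<open>\<theta>0\<close> is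
      \<open>1 / z^2\<close> and \<open>\<theta> k\<close> has modulus
      \<open>1 / |z|\<close>.\<close>
    have NN: "(1 / (cmod (x $ i0))^2) / NN x' = 1 / NN x"
      using z by (simp add: x' NN_def shift_nth tau_nth \<gamma>0 norm_divide power_divide field_simps)
    have "cmod (eps k) = 1" if "eps k \<noteq> 0" for k using eps_cases[of k] that by auto
    then have n: "(cmod (\<theta> k))^2 = 1 / (cmod (x $ i0))^2" if "eps k \<noteq> 0" for k
      using that by (simp add: \<theta>_def norm_divide norm_mult power_divide)
    have t: "\<theta> k \<noteq> 0" "\<theta> (c k) = \<theta> k" "eps k = 0 \<Longrightarrow> \<theta> k = 1" for k
      using z by (auto simp: \<theta>_def)
    show ?thesis
      by (rule exI[of _ "shift \<gamma> \<circ> tau"], rule exI[of _ "Dshift \<gamma> \<circ> Dtau x"], rule exI[of _ "1 / (x $ i0)^2"], rule exI[of _ \<theta>], intro conjI)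
        (use d lin ev dl' z \<gamma>0 NN n t in \<open>auto simp: x' norm_divide norm_power\<close>)
  qed
qed

lemma q_transitionE:
  assumes "q s x = q s' x'"
  obtains T D \<theta>0 \<theta> where "(T has_derivative D) (at x)" "\<forall>a v. D (a *s v) = a *s D v" "T x = x'"
    "\<forall>\<^sub>F v in nhds x. q s' (T v) = q s v" "\<And>u. D u $ i0 = \<theta>0 * u $ i0"
    "\<And>u k. k \<noteq> i0 \<Longrightarrow> dl x' (D u) k = \<theta> k * dl x u k" "\<And>k. \<theta> (c k) = \<theta> k"
    "\<And>k. eps k = 0 \<Longrightarrow> \<theta> k = 1" "\<And>k. eps k \<noteq> 0 \<Longrightarrow> (cmod (\<theta> k))^2 / NN x' = 1 / NN x"
    "cmod \<theta>0 / NN x' = 1 / NN x"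
  using q_transition[OF assms] by blast

lemma openin_q: "openin X U \<longleftrightarrow> U \<subseteq> (\<Union>s. range (q s)) \<and> (\<forall>s. open (q s -` U))"
proof -
  have "q s -` U = Psi_inv -` (p s -` U)" "p s -` U = Psi -` (q s -` U)" for s
    by (auto simp: q_def)
  then have "open (q s -` U) \<longleftrightarrow> open (p s -` U)" for s
    using continuous_open_vimage[of _ Psi] continuous_open_vimage[of _ Psi_inv]
    by (metis continuous_Psi continuous_Psi_inv continuous_on_eq_continuous_within open_vimage)
  then show ?thesis unfolding openin_p range_q by simp
qed

text \<open>Two points of such a ball are less than 1 apart, and no nonzero lattice vector is that
  short.\<close>

lemma p_inj_ball: assumes "r \<le> 1/2" shows "inj_on (p s) (ball y r)"
proof (rule inj_onI)
  fix a b assume ab: "a \<in> ball y r" "b \<in> ball y r" "p s a = p s b"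
  then have l: "b - a \<in> lat" by (simp add: p_eq_iff H_eq_iff)
  have "norm (b - a) < 1"
    using ab(1,2) assms norm_triangle_ineq4[of "b - y" "a - y"] by (simp add: dist_norm norm_minus_commute)
  then have "(b - a) $ k = 0" for k
    using Finite_Cartesian_Product.norm_nth_le[of "b - a" k] l by (intro gauss_int_small) (auto simp: lat_def)
  then have "b - a = 0" unfolding vec_eq_iff by simp
  then show "a = b" by simp
qed

sublocale q: holomorphic_cover X q
proof -
  have "\<exists>T. (T \<longlongrightarrow> x') (nhds x) \<and> (\<forall>\<^sub>F v in nhds x. q s' (T v) = q s v)" if "q s x = q s' x'" for s x s' x'
  proof -
    from q_transition[OF that] obtain T D where T: "(T has_derivative D) (at x)" "T x = x'"
      "\<forall>\<^sub>F v in nhds x. q s' (T v) = q s v" by blast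
    then have "(T \<longlongrightarrow> x') (nhds x)"
      using has_derivative_continuous[of T D x UNIV] tendsto_at_iff_tendsto_nhds[of T x]
      by (auto simp: continuous_within)
    then show ?thesis using T by blast
  qed
  then interpret coordinate_cover X q by (rule coordinate_coverI[OF openin_q])
  show "holomorphic_cover X q"
  proof
    show "\<exists>T D. (T has_derivative D) (at x) \<and> (\<forall>a v. D (a *s v) = a *s D v) \<and> T x = x' \<and> (\<forall>\<^sub>F v in nhds x. q s' (T v) = q s v)"
      if "q s x = q s' x'" for s x s' x'
      using q_transition[OF that] by blast
    fix x s
    \<comment> \<open>Injectivity is taken from a ball in the real coordinates, where the lattice
      acts by translations.\<close>
    have "open (Psi_inv -` ball (Psi_inv x) (1/2))"
      by (rule open_vimage) (auto intro: continuous_Psi_inv)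
    moreover have "inj_on (q s) (Psi_inv -` ball (Psi_inv x) (1/2))"
    proof (rule inj_onI)
      fix a b assume "a \<in> Psi_inv -` ball (Psi_inv x) (1/2)" "b \<in> Psi_inv -` ball (Psi_inv x) (1/2)" "q s a = q s b"
      then have "Psi_inv a = Psi_inv b"
        using p_inj_ball[of "1/2" s "Psi_inv x"] by (auto simp: q_def dest: inj_onD)
      then show "a = b" by (metis Psi_Psi_inv)
    qed
    ultimately show "\<exists>B. open B \<and> x \<in> B \<and> inj_on (q s) B" by force
  qed
qed

end

section \<open>Topology of the quotient\<close>

lemma second_countable_euclidean: "second_countable (euclidean :: 'a::second_countable_topology topology)"
proof -
  obtain B :: "'a set set" where B: "countable B" "topological_basis B"
    using ex_countable_basis by blast
  show ?thesis unfolding second_countable_def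
  proof (intro exI[of _ B] conjI allI impI ballI)
    fix U :: "'a set" and x assume "openin euclidean U \<and> x \<in> U"
    then show "\<exists>V\<in>B. x \<in> V \<and> V \<subseteq> U"
      using topological_basisE[OF B(2), of U x] by (metis open_openin)
  qed (use B topological_basis_open in auto)
qed

context twistor_manifold begin

lemma topspaceE: assumes "P \<in> topspace X" obtains s y where "P = p s y"
  using assms p.topspaceE by blast

text \<open>The map induced by \<open>H\<close> is injective and continuous into a Euclidean space,
  which makes \<open>X\<close> Hausdorff. Once \<open>X\<close> is compact, it is a homeomorphism
  onto its image, whence second countability.\<close>

definition embed where "embed P = (THE h. \<exists>s y. P = p s y \<and> h = H s y)"

lemma embed_p [simp]: "embed (p s y) = H s y"
  unfolding embed_def by (rule the_equality) (auto simp: p_eq_iff)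

lemma inj_embed: "inj_on embed (topspace X)"
proof (rule inj_onI)
  fix P Q assume *: "P \<in> topspace X" "Q \<in> topspace X" "embed P = embed Q"
  obtain s y where P: "P = p s y" using *(1) topspaceE by blast
  obtain s' y' where Q: "Q = p s' y'" using *(2) topspaceE by blast
  show "P = Q" using *(3) by (simp add: P Q p_eq_iff)
qed

lemma continuous_embed: "continuous_map X euclidean embed"
proof -
  have "embed \<circ> p s = H s" for s by auto
  then show ?thesis unfolding p.continuous_map_iff using continuous_H by simp
qed

lemma Hausdorff_X: "Hausdorff_space X"
  by (rule Hausdorff_space_injective_preimage[OF Hausdorff_space_euclidean continuous_embed inj_embed])

text \<open>Two images of this box cover \<open>X\<close>. The bound 2 comes from
  \<open>|Re| + |Im|\<close> on the unit square; for the base coordinate any bound from 1 on would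
  do, since \<open>- 1 / z\<close> exchanges large and small values.\<close>

definition box2 :: "(complex^'n) set" where "box2 = {y. \<forall>k. cmod (y $ k) \<le> 2}"

lemma compact_box2: "compact box2"
  unfolding compact_eq_bounded_closed
proof
  show "closed box2" unfolding box2_def
    by (intro closed_Collect_all closed_Collect_le continuous_intros)
  show "bounded box2" unfolding bounded_iff
  proof (intro exI ballI)
    fix y assume "y \<in> box2"
    then have "(\<Sum>k\<in>UNIV. norm (y $ k)) \<le> (\<Sum>k\<in>(UNIV::'n set). 2)"
      by (intro sum_mono) (auto simp: box2_def)
    then show "norm y \<le> (\<Sum>k\<in>(UNIV::'n set). 2)"
      unfolding norm_vec_def using L2_set_le_sum[of UNIV "\<lambda>k. norm (y $ k)"] by simp
  qed
qed

lemma ex_lat_box: assumes "cmod (y $ i0) \<le> 2" shows "\<exists>\<gamma>\<in>lat. y + \<gamma> \<in> box2"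
proof -
  have "\<exists>g. g \<in> gauss_int \<and> (if k = i0 then g = 0 else cmod (y $ k + g) \<le> 2)" for k
  proof (cases "k = i0")
    case False
    obtain g where g: "g \<in> gauss_int" "0 \<le> Re (y $ k + g)" "Re (y $ k + g) \<le> 1" "0 \<le> Im (y $ k + g)" "Im (y $ k + g) \<le> 1"
      using ex_gauss_int by blast
    have "cmod (y $ k + g) \<le> \<bar>Re (y $ k + g)\<bar> + \<bar>Im (y $ k + g)\<bar>" by (rule cmod_le)
    then show ?thesis using g False by (intro exI[of _ g]) simp
  qed (auto intro: exI[of _ 0])
  then obtain g where g: "\<And>k. g k \<in> gauss_int" "\<And>k. if k = i0 then g k = 0 else cmod (y $ k + g k) \<le> 2"
    by metis
  have "g i0 = 0" "\<And>k. k \<noteq> i0 \<Longrightarrow> cmod (y $ k + g k) \<le> 2" using g(2) by (metis, metis)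
  then have "cmod (y $ k + g k) \<le> 2" for k using assms by (cases "k = i0") auto
  then show ?thesis using g(1) \<open>g i0 = 0\<close>
    by (intro bexI[of _ "\<chi> k. g k"]) (auto simp: lat_def box2_def)
qed

lemma p_box:
  obtains s' y' where "p s y = p s' y'" "y' \<in> box2"
proof -
  have *: "\<exists>y'\<in>box2. p s y = p s y'" if "cmod (y $ i0) \<le> 2" for s y
    using ex_lat_box[OF that] p_add_lat by metis
  show ?thesis
  proof (cases "cmod (y $ i0) \<le> 2")
    case True then show ?thesis using * that by blast
  next
    case False
    then have "y $ i0 \<noteq> 0" by auto
    moreover have "cmod (S y $ i0) \<le> 2" using False
      by (simp add: S_nth norm_divide divide_simps)
    ultimately show ?thesis using *[of "S y" "\<not> s"] p_S[of y s] that by metis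
  qed
qed

lemma compact_X: "compact_space X"
proof -
  have "topspace X \<subseteq> p False ` box2 \<union> p True ` box2"
  proof
    fix P assume "P \<in> topspace X"
    then obtain s y where "P = p s y" by (rule topspaceE)
    then obtain s' y' where "P = p s' y'" "y' \<in> box2" using p_box[of s y] by metis
    then show "P \<in> p False ` box2 \<union> p True ` box2" by (cases s') auto
  qed
  then have "topspace X = p False ` box2 \<union> p True ` box2" by auto
  moreover have "compactin X (p s ` box2)" for s
    using image_compactin[OF _ p.continuous_param] compact_box2 by (simp add: compactin_euclidean_iff)
  ultimately show ?thesis by (simp add: compact_space_def compactin_Un)
qed

lemma second_countable_X: "second_countable X"
proof -
  have "homeomorphic_map X (top_of_set (embed ` topspace X)) embed"
    by (rule continuous_imp_homeomorphic_map)
      (auto simp: continuous_map_in_subtopology continuous_embed compact_X inj_embed Hausdorff_space_subtopology)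
  then show ?thesis
    using homeomorphic_space_second_countability homeomorphic_map_imp_homeomorphic_space
      second_countable_subtopology second_countable_euclidean by blast
qed

lemma complex_manifold_X: "complex_manifold X q.atlas"
  by (rule q.complex_manifold_atlas[OF Hausdorff_X second_countable_X])

section \<open>The cat map and its invariant splitting\<close>

definition cat :: "('n \<Rightarrow> complex) \<Rightarrow> ('n \<Rightarrow> complex) \<Rightarrow> complex^'n \<Rightarrow> complex^'n" where
  "cat a b x = (\<chi> k. a k * x $ k + b k * x $ c k)"

lemma cat_nth: "cat a b x $ k = a k * x $ k + b k * x $ c k" by (simp add: cat_def)

text \<open>The conditions under which \<open>cat a b\<close> descends to \<open>X\<close>. Real
  coefficients symmetric under \<open>m\<close> let it commute with \<open>Psi\<close> and
  \<open>S\<close>, integrality preserves the lattice, and coordinates with \<open>eps k = 0\<close>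
  are fixed. The listed values cover the cat map and its inverse.\<close>

definition cat_ok where
  "cat_ok a b \<longleftrightarrow> (\<forall>k. a (m k) = a k \<and> b (m k) = b k \<and> cnj (a k) = a k \<and> cnj (b k) = b k \<and>
     a k \<in> {-1, 0, 1, 2} \<and> b k \<in> {-1, 0, 1, 2} \<and> (eps k = 0 \<longrightarrow> a k = 1 \<and> b k = 0))"

lemma cat_i0: "cat_ok a b \<Longrightarrow> cat a b x $ i0 = x $ i0"
  by (simp add: cat_ok_def cat_nth)

lemma cat_add: "cat a b (u + v) = cat a b u + cat a b v"
  by (simp add: cat_def vec_eq_iff algebra_simps)

lemma cat_linear: "bounded_linear (cat a b)"
proof -
  have "linear (cat a b)" by (rule linearI) (auto simp: cat_def vec_eq_iff algebra_simps)
  then show ?thesis by (simp add: linear_conv_bounded_linear)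
qed

lemma cat_cscale: "cat a b (t *s v) = t *s cat a b v"
  by (simp add: cat_def vec_eq_iff algebra_simps)

lemma cat_Psi: assumes "cat_ok a b" shows "cat a b (Psi y) = Psi (cat a b y)"
proof -
  have "cat a b (Psi y) $ k = Psi (cat a b y) $ k" for k
    using assms mc[of k] unfolding cat_ok_def by (simp add: cat_nth Psi_nth cat_i0[OF assms] algebra_simps)
  then show ?thesis by (simp add: vec_eq_iff)
qed

lemma cat_Psi_inv: "cat_ok a b \<Longrightarrow> Psi_inv (cat a b x) = cat a b (Psi_inv x)"
  using cat_Psi[of a b "Psi_inv x"] by (metis Psi_Psi_inv Psi_inv_Psi)

lemma gauss_int_mult: "a \<in> {-1, 0, 1, 2} \<Longrightarrow> g \<in> gauss_int \<Longrightarrow> a * g \<in> gauss_int"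
  by (auto simp: gauss_int_def)

lemma cat_lat: "cat_ok a b \<Longrightarrow> \<gamma> \<in> lat \<Longrightarrow> cat a b \<gamma> \<in> lat"
  unfolding lat_def using cat_i0[of a b \<gamma>]
  by (auto simp: cat_nth cat_ok_def intro!: gauss_int_add gauss_int_mult)

lemma cat_S: assumes "cat_ok a b" shows "cat a b (S y) = S (cat a b y)"
proof -
  have "cat a b (S y) $ k = S (cat a b y) $ k" for k
  proof (cases "eps k = 0")
    case True
    then show ?thesis using assms cat_i0[OF assms, of y] unfolding cat_ok_def
      by (auto simp: cat_nth S_nth R_nth)
  next
    case False
    then show ?thesis using assms m_neq_i0[of k] mc[of k] unfolding cat_ok_def
      by (auto simp: cat_nth S_nth R_nth algebra_simps)
  qed
  then show ?thesis by (simp add: vec_eq_iff)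
qed

lemma cat_p: assumes "cat_ok a b" "p s y = p s' y'" shows "p s (cat a b y) = p s' (cat a b y')"
  using assms(2)
proof (cases rule: p_cases)
  case (1 \<gamma>)
  then show ?thesis by (simp add: cat_add p_add_lat cat_lat[OF assms(1)])
next
  case (2 \<gamma>)
  then show ?thesis
    by (simp add: cat_add p_add_lat cat_lat[OF assms(1)] cat_S[OF assms(1)] p_S cat_i0[OF assms(1)])
qed

definition be where "be k = (if eps k = 0 then 0 else 1 :: complex)"

definition F where "F = cat al be"
text \<open>The inverse of a matrix of determinant 1: the diagonal entries \<open>al k\<close> and
  \<open>al (c k)\<close> are exchanged and the others change sign.\<close>

definition Finv where "Finv = cat (\<lambda>k. al (c k)) (\<lambda>k. - be k)"

lemma al_mem: "al k = 1 \<or> al k = 2" using al_cases[of k] al_0[of k] by auto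

lemma cat_ok_F: "cat_ok al be" and cat_ok_Finv: "cat_ok (\<lambda>k. al (c k)) (\<lambda>k. - be k)"
proof -
  have "al (c (m k)) = al (c k)" for k by (metis al_m mc)
  moreover have "cnj (al k) = al k" for k using al_mem[of k] by auto
  ultimately show "cat_ok al be" "cat_ok (\<lambda>k. al (c k)) (\<lambda>k. - be k)"
    using al_mem al_0 by (auto simp: cat_ok_def be_def)
qed

lemma be_c [simp]: "be (c k) = be k" by (simp add: be_def)

lemma Finv_F [simp]: "Finv (F x) = x" and F_Finv [simp]: "F (Finv x) = x"
proof -
  have "Finv (F x) $ k = x $ k" "F (Finv x) $ k = x $ k" for k
    using al_cases[of k] al_0[of k] al_0[of "c k"]
    by (cases "eps k = 0"; auto simp: F_def Finv_def cat_nth be_def algebra_simps)+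
  then show "Finv (F x) = x" "F (Finv x) = x" by (simp_all add: vec_eq_iff)
qed

definition f where "f P = (THE Q. \<exists>s y. P = p s y \<and> Q = p s (F y))"

lemma f_p [simp]: "f (p s y) = p s (F y)"
  unfolding f_def
proof (rule the_equality)
  fix Q assume "\<exists>s' y'. p s y = p s' y' \<and> Q = p s' (F y')"
  then obtain s' y' where "p s y = p s' y'" "Q = p s' (F y')" by blast
  then show "Q = p s (F y)" using cat_p[OF cat_ok_F, of s y s' y'] by (simp add: F_def)
qed blast

lemma f_q: "f (q s x) = q s (F x)"
  by (simp add: q_def) (simp add: F_def cat_Psi_inv cat_ok_F)

lemma bij_f: "bij_betw f (topspace X) (topspace X)"
  unfolding bij_betw_def
proof
  show "inj_on f (topspace X)"
  proof (rule inj_onI)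
    fix P Q assume *: "P \<in> topspace X" "Q \<in> topspace X" "f P = f Q"
    obtain s y where P: "P = p s y" using *(1) topspaceE by blast
    obtain s' y' where Q: "Q = p s' y'" using *(2) topspaceE by blast
    have "p s (Finv (F y)) = p s' (Finv (F y'))"
      using *(3) unfolding Finv_def by (intro cat_p[OF cat_ok_Finv]) (simp add: P Q)
    then show "P = Q" by (simp add: P Q)
  qed
  show "f ` topspace X = topspace X"
  proof (intro set_eqI iffI)
    fix P assume "P \<in> topspace X"
    then obtain s y where "P = p s y" by (rule topspaceE)
    then have "P = f (p s (Finv y))" by simp
    then show "P \<in> f ` topspace X" by (rule image_eqI) simp
  qed (auto elim!: topspaceE)
qed

lemma F_linear: "bounded_linear F" "F (t *s v) = t *s F v"
  by (simp_all add: F_def cat_linear cat_cscale)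

lemma biholomorphism_f: "biholomorphism X q.atlas f"
  unfolding biholomorphism_def
proof (intro conjI bij_f)
  show "holomorphic_self_map X q.atlas f"
    by (rule q.holomorphic_self_mapI[OF f_q F_linear])
  have "inv_into (topspace X) f (q s x) = q s (Finv x)" for s x
    using inv_into_f_f[OF bij_betw_imp_inj_on[OF bij_f], of "q s (Finv x)"] by (simp add: f_q)
  then show "holomorphic_self_map X q.atlas (inv_into (topspace X) f)"
    by (rule q.holomorphic_self_mapI) (simp_all add: Finv_def cat_linear cat_cscale)
qed

lemma tangent_map_f: "tangent_map q.atlas f (q s x) (q.tv s x u) = q.tv s (F x) (F u)"
  by (rule q.tangent_map_eq[OF f_q F_linear])

text \<open>The eigenvalues \<open>(3 \<plusminus> sqrt 5) / 2\<close> of the cat map.\<close>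

definition lam :: "bool \<Rightarrow> real" where "lam b = (3 + (if b then 1 else -1) * sqrt 5) / 2"

lemma lam_mult: "lam b * lam (\<not> b) = 1" and lam_sum: "lam b + lam (\<not> b) = 3"
  by (auto simp: lam_def field_simps real_sqrt_mult_self)

lemma lam_bounds: "0 < lam False" "lam False < 1" "1 < lam True" "lam b > 0"
proof -
  obtain t :: real where t: "t = sqrt 5" by simp
  have 3: "t < 3" and 1: "1 < t" unfolding t by (auto intro: real_less_lsqrt real_less_rsqrt)
  have F: "lam False = (3 - t) / 2" and T: "lam True = (3 + t) / 2" by (simp_all add: lam_def t)
  show "0 < lam False" unfolding F using 3 by simp
  show "lam False < 1" unfolding F using 1 by simp
  show "1 < lam True" unfolding T using 1 by simp
  show "lam b > 0" using \<open>0 < lam False\<close> \<open>1 < lam True\<close> by (cases b) auto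
qed

definition Vh :: "bool \<Rightarrow> complex^'n \<Rightarrow> (complex^'n) set" where
  "Vh b x = {u. (\<forall>k. eps k = 0 \<longrightarrow> u $ k = 0) \<and> F u = lam b *\<^sub>R u}"

text \<open>Coordinates with \<open>eps k = 0\<close> are unconstrained: they are the base direction
  and the directions of the extra factors.\<close>

definition Vc :: "complex^'n \<Rightarrow> (complex^'n) set" where
  "Vc x = {u. \<forall>k. eps k \<noteq> 0 \<longrightarrow> dl x u k = 0}"

lemma dl_off: "u $ i0 = 0 \<Longrightarrow> dl x u k = u $ k" by (simp add: dl_def)

lemma dl_eps0: "eps k = 0 \<Longrightarrow> dl x u k = u $ k" by (simp add: dl_def)

lemma invariant_Vc: "q.invariant_field Vc"
  unfolding q.invariant_field_def
proof (intro allI impI)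
  fix s x s' x' assume "q s x = q s' x'"
  then obtain T D \<theta>0 \<theta> where T: "(T has_derivative D) (at x)" "\<forall>a v. D (a *s v) = a *s D v"
      "T x = x'" "\<forall>\<^sub>F v in nhds x. q s' (T v) = q s v"
    and D: "\<And>u k. k \<noteq> i0 \<Longrightarrow> dl x' (D u) k = \<theta> k * dl x u k" by (rule q_transitionE) blast
  have "D ` Vc x \<subseteq> Vc x'" using D m_neq_i0 by (auto simp: Vc_def)
  then show "\<exists>T D. q.is_trans s x s' x' T D \<and> D ` Vc x \<subseteq> Vc x'"
    using T unfolding q.is_trans_def by blast
qed

lemma F_nth: "F u $ k = al k * u $ k + be k * u $ c k" by (simp add: F_def cat_nth)

text \<open>On vectors without base component a coordinate change is diagonal with equal factors at
  \<open>k\<close> and \<open>c k\<close>, the two coordinates that \<open>F\<close> mixes. Hence it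
  commutes with \<open>F\<close> there and preserves its eigenspaces.\<close>

lemma invariant_Vh: "q.invariant_field (Vh b)"
  unfolding q.invariant_field_def
proof (intro allI impI)
  fix s x s' x' assume "q s x = q s' x'"
  then obtain T D \<theta>0 \<theta> where T: "(T has_derivative D) (at x)" "\<forall>a v. D (a *s v) = a *s D v"
      "T x = x'" "\<forall>\<^sub>F v in nhds x. q s' (T v) = q s v"
    and D: "\<And>u. D u $ i0 = \<theta>0 * u $ i0" "\<And>u k. k \<noteq> i0 \<Longrightarrow> dl x' (D u) k = \<theta> k * dl x u k"
    and \<theta>: "\<And>k. \<theta> (c k) = \<theta> k" by (rule q_transitionE) blast
  have "D u \<in> Vh b x'" if u: "u \<in> Vh b x" for u
  proof -
    have u0: "u $ i0 = 0" and uk: "\<And>k. eps k = 0 \<Longrightarrow> u $ k = 0" and Fu: "F u = lam b *\<^sub>R u" using u by (auto simp: Vh_def)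
    have Du: "D u $ k = \<theta> k * u $ k" for k
      using D(1)[of u] D(2)[of k u] u0 by (cases "k = i0") (auto simp: dl_off)
    have "F (D u) $ k = (lam b *\<^sub>R D u) $ k" for k
      using arg_cong[OF Fu, of "\<lambda>v. \<theta> k * v $ k"] by (simp add: F_nth Du \<theta> scaleR_conv_of_real algebra_simps)
    then show ?thesis by (simp add: Vh_def Du uk vec_eq_iff)
  qed
  then show "\<exists>T D. q.is_trans s x s' x' T D \<and> D ` Vh b x \<subseteq> Vh b x'"
    using T unfolding q.is_trans_def by blast
qed

lemma F_i0 [simp]: "F u $ i0 = u $ i0" by (simp add: F_def cat_i0 cat_ok_F)

lemma dl_cat: 
  assumes "cat_ok a b" shows "dl (cat a b x) (cat a b u) k = a k * dl x u k + b k * dl x u (c k)"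
  using assms mc[of k] unfolding cat_ok_def
  by (simp add: dl_def cat_Psi_inv[OF assms] cat_i0[OF assms] cat_nth[of a b _ "m k"] cat_nth[of a b _ k] algebra_simps)

lemma dl_F: "dl (F x) (F u) k = al k * dl x u k + be k * dl x u (c k)"
  unfolding F_def by (rule dl_cat[OF cat_ok_F])

lemma F_Vc: "F ` Vc x = Vc (F x)"
proof (intro set_eqI iffI)
  fix u assume "u \<in> Vc (F x)"
  then have "Finv u \<in> Vc (Finv (F x))"
    unfolding Vc_def Finv_def using dl_cat[OF cat_ok_Finv, of "F x" u] by simp
  then show "u \<in> F ` Vc x" by (metis F_Finv Finv_F imageI)
qed (auto simp: Vc_def dl_F)

lemma F_scaleR: "F (r *\<^sub>R u) = r *\<^sub>R F u" and F_add: "F (u + v) = F u + F v" and F_diff: "F (u - v) = F u - F v"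
  using F_linear(1) by (simp_all add: linear_simps)

lemma F_Vh: "F ` Vh b x = Vh b (F x)"
proof (intro set_eqI iffI)
  fix u assume "u \<in> F ` Vh b x"
  then show "u \<in> Vh b (F x)" by (auto simp: Vh_def F_scaleR)
next
  fix u assume u: "u \<in> Vh b (F x)"
  have "F ((1 / lam b) *\<^sub>R u) = u" "(1 / lam b) *\<^sub>R u \<in> Vh b x"
    using u lam_bounds(4)[of b] by (auto simp: Vh_def F_scaleR)
  then show "u \<in> F ` Vh b x" by force
qed

text \<open>Cayley-Hamilton for the matrix \<open>(2 1; 1 1)\<close>, with trace 3 and determinant
  1.\<close>

lemma F_F:
  assumes "\<And>k. eps k = 0 \<Longrightarrow> u $ k = 0"
  shows "F (F u) = 3 *\<^sub>R F u - u"
proof -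
  have "F (F u) $ k = (3 *\<^sub>R F u - u) $ k" for k
    using al_cases[of k] assms[of k] assms[of "c k"]
    by (cases "eps k = 0") (auto simp: F_nth be_def scaleR_conv_of_real algebra_simps)
  then show ?thesis by (simp add: vec_eq_iff)
qed

lemma splitting_ex:
  "\<exists>a b w. a \<in> Vh False x \<and> b \<in> Vc x \<and> w \<in> Vh True x \<and> u = a + b + w"
proof -
  \<comment> \<open>The center vector with the same coordinates as \<open>u\<close> wherever
    \<open>eps k = 0\<close>; the remainder \<open>r\<close> points along the torus
    directions.\<close>
  define b where "b = (\<chi> k. if eps k = 0 then u $ k else eps k * u $ i0 * cnj (Psi_inv x $ m k))"
  define r where "r = u - b"
  have b: "b \<in> Vc x" by (auto simp: Vc_def dl_def b_def)
  have r: "eps k = 0 \<Longrightarrow> r $ k = 0" for k by (simp add: r_def b_def)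
  \<comment> \<open>The spectral projections of \<open>r\<close>.\<close>
  define h where "h \<beta> = (1 / (lam \<beta> - lam (\<not> \<beta>))) *\<^sub>R (F r - lam (\<not> \<beta>) *\<^sub>R r)" for \<beta>
  have "h \<beta> \<in> Vh \<beta> x" for \<beta>
  proof -
    have "F (F r - lam (\<not> \<beta>) *\<^sub>R r) = lam \<beta> *\<^sub>R (F r - lam (\<not> \<beta>) *\<^sub>R r)"
    proof -
      have "lam \<beta> = 3 - lam (\<not> \<beta>)" using lam_sum[of \<beta>] by simp
      moreover have "(lam \<beta> * lam (\<not> \<beta>)) *\<^sub>R r = r" by (simp add: lam_mult)
      ultimately show ?thesis
        by (simp add: F_diff F_scaleR F_F[OF r] scaleR_diff_right scaleR_diff_left)
    qed
    moreover have "F r $ k = 0" if "eps k = 0" for k using that r by (simp add: F_nth be_def)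
    ultimately show ?thesis using r by (simp add: Vh_def h_def F_scaleR)
  qed
  moreover have "h False + h True = r"
  proof -
    define d where "d = 1 / (lam True - lam False)"
    have d: "d * (lam True - lam False) = 1" using lam_bounds by (simp add: d_def)
    have "1 / (lam False - lam True) = - d" unfolding d_def by (metis minus_diff_eq minus_divide_right)
    then have "h False + h True = (d * (lam True - lam False)) *\<^sub>R r"
      by (simp add: h_def d_def[symmetric] algebra_simps)
    then show ?thesis using d by simp
  qed
  ultimately show ?thesis using b
    by - (rule exI[of _ "h False"], rule exI[of _ b], rule exI[of _ "h True"], auto simp: r_def algebra_simps)
qed

lemma Vc_diff: "u \<in> Vc x \<Longrightarrow> v \<in> Vc x \<Longrightarrow> u - v \<in> Vc x"
  by (auto simp: Vc_def dl_def algebra_simps)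

lemma Vh_diff: "u \<in> Vh b x \<Longrightarrow> v \<in> Vh b x \<Longrightarrow> u - v \<in> Vh b x"
  by (auto simp: Vh_def F_diff algebra_simps)

text \<open>Where \<open>eps k = 0\<close>, only \<open>b\<close> contributes, so its base component
  vanishes, and then \<open>b = 0\<close>. What remains are eigenvectors for different
  eigenvalues.\<close>

lemma splitting_zero:
  assumes "a \<in> Vh False x" "b \<in> Vc x" "w \<in> Vh True x" "a + b + w = 0"
  shows "a = 0 \<and> b = 0 \<and> w = 0"
proof -
  have bk: "b $ k = 0" if "eps k = 0" for k
  proof -
    have "(a + b + w) $ k = 0" using assms(4) by simp
    then show ?thesis using assms(1,3) that by (simp add: Vh_def)
  qed
  then have "b $ i0 = 0" by simp
  then have "b $ k = 0" for k using bk assms(2) dl_off[of b x k] by (cases "eps k = 0") (auto simp: Vc_def)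
  then have b: "b = 0" by (simp add: vec_eq_iff)
  then have w: "w = - a" using assms(4) by (simp add: eq_neg_iff_add_eq_0 add.commute)
  have "lam True *\<^sub>R a = lam False *\<^sub>R a"
    using assms(1,3) F_scaleR[of "-1" a] unfolding w Vh_def by simp
  then have "a = 0" using lam_bounds by simp
  then show ?thesis using b w by simp
qed

section \<open>The three invariant bundles\<close>

definition "Es = q.distribution (Vh False)"
definition "Ec = q.distribution Vc"
definition "Eu = q.distribution (Vh True)"

lemma Ec_eq: "Ec (q s x) = q.tv s x ` Vc x" and Es_eq: "Es (q s x) = q.tv s x ` Vh False x"
  and Eu_eq: "Eu (q s x) = q.tv s x ` Vh True x"
  by (simp_all add: Ec_def Es_def Eu_def q.distribution_eq invariant_Vc invariant_Vh)

lemma splitting: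
  assumes "P \<in> topspace X" "v \<in> tangent_space q.atlas P"
  shows "\<exists>!(vs, vc, vu). vs \<in> Es P \<and> vc \<in> Ec P \<and> vu \<in> Eu P \<and> v = (\<lambda>c. vs c + vc c + vu c)"
proof -
  obtain s x where P: "P = q s x" using assms(1) q.topspaceE by blast
  then obtain u where u: "v = q.tv s x u" using assms(2) q.tangent_space_eq by auto
  have sum: "(\<lambda>c'. q.tv s x a c' + q.tv s x b c' + q.tv s x w c') = q.tv s x (a + b + w)" for a b w
    by (simp add: q.tv_add)
  obtain a b w where abw: "a \<in> Vh False x" "b \<in> Vc x" "w \<in> Vh True x" "u = a + b + w" using splitting_ex by metis
  show ?thesis
  proof (rule ex1I[of _ "(q.tv s x a, q.tv s x b, q.tv s x w)"])
    show "case (q.tv s x a, q.tv s x b, q.tv s x w) of (vs, vc, vu) \<Rightarrow>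
        vs \<in> Es P \<and> vc \<in> Ec P \<and> vu \<in> Eu P \<and> v = (\<lambda>c. vs c + vc c + vu c)"
      using abw by (auto simp: P Ec_eq Es_eq Eu_eq u sum)
    fix t assume t: "case t of (vs, vc, vu) \<Rightarrow>
        vs \<in> Es P \<and> vc \<in> Ec P \<and> vu \<in> Eu P \<and> v = (\<lambda>c. vs c + vc c + vu c)"
    obtain vs vc vu where t3: "t = (vs, vc, vu)" by (cases t) auto
    have t': "vs \<in> Es P" "vc \<in> Ec P" "vu \<in> Eu P" "v = (\<lambda>c. vs c + vc c + vu c)" using t unfolding t3 by simp_all
    obtain a' where a': "vs = q.tv s x a'" "a' \<in> Vh False x" using t'(1) by (auto simp: P Es_eq)
    obtain b' where b': "vc = q.tv s x b'" "b' \<in> Vc x" using t'(2) by (auto simp: P Ec_eq)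
    obtain w' where w': "vu = q.tv s x w'" "w' \<in> Vh True x" using t'(3) by (auto simp: P Eu_eq)
    have "q.tv s x u = q.tv s x (a' + b' + w')" using t'(4) unfolding u a'(1) b'(1) w'(1) sum .
    then have "u = a' + b' + w'" by (rule q.tv_inj)
    then have "(a - a') + (b - b') + (w - w') = 0" using abw(4) by (simp add: algebra_simps)
    from splitting_zero[OF Vh_diff[OF abw(1) a'(2)] Vc_diff[OF abw(2) b'(2)] Vh_diff[OF abw(3) w'(2)] this]
    show "t = (q.tv s x a, q.tv s x b, q.tv s x w)" unfolding t3 a'(1) b'(1) w'(1) by simp
  qed
qed

end

section \<open>The metric and partial hyperbolicity\<close>

text \<open>When all vectors are stretched by the same factor, the supremum runs over a singleton;
  the unit vector \<open>v0\<close> guarantees that it is not empty.\<close>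

lemma operator_norm_eqI:
  assumes "v0 \<in> V" "g p v0 v0 = 1" "\<And>v. v \<in> V \<Longrightarrow> g q (L v) (L v) = r^2 * g p v v" "r \<ge> 0"
  shows "operator_norm g p q V L = r"
proof -
  have "(\<lambda>v. sqrt (g q (L v) (L v))) ` {v \<in> V. sqrt (g p v v) = 1} = {r}"
    using assms by (force simp: real_sqrt_mult)
  then show ?thesis by (simp add: operator_norm_def)
qed

lemma scale_quotient: "t / n' = 1 / n \<Longrightarrow> t * r / n' = r / n" for t n n' r :: real
  using times_divide_eq_left[of t n' r] by simp

lemma ex_real_frame:
  fixes V :: "(complex^'n::finite) set"
  assumes "subspace V"
  shows "\<exists>e. real_frame e (dim V) V"
proof -
  obtain B where B: "B \<subseteq> V" "independent B" "V \<subseteq> span B" "card B = dim V"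
    using basis_exists by blast
  then have "finite B" by (simp add: independent_bound_general)
  then obtain h where "bij_betw h {0..<card B} B" using ex_bij_betw_nat_finite by blast
  then have h: "bij_betw h {..<dim V} B" by (simp add: B(4) atLeast0LessThan)
  have "span B = V" using B assms by (simp add: span_eq_iff span_minimal subset_antisym)
  then show ?thesis using h B by (intro exI[of _ h]) (auto simp: real_frame_def bij_betw_def)
qed

lemma real_frame_linear_image:
  assumes "real_frame e r K" "linear L" "inj_on L K"
  shows "real_frame (\<lambda>i. L (e i)) r (L ` K)"
proof -
  have e: "inj_on e {..<r}" "independent (e ` {..<r})" "span (e ` {..<r}) = K"
    using assms(1) by (auto simp: real_frame_def)
  have "e ` {..<r} \<subseteq> K" using e(3) span_superset by metis
  then have "inj_on (L \<circ> e) {..<r}" using e(1) assms(3) by (meson comp_inj_on inj_on_subset)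
  moreover have "independent (L ` e ` {..<r})"
    by (rule linear_independent_injective_image) (use assms e in auto)
  moreover have "span (L ` e ` {..<r}) = L ` K"
    using linear_span_image[OF assms(2)] e(3) by metis
  ultimately show ?thesis by (simp add: real_frame_def image_image o_def)
qed

context twistor_manifold begin

lemma NN_pos [simp]: "NN x > 0" "NN x \<noteq> 0"
  unfolding NN_def by (rule pos_norm)+

lemma NN_complex [simp]: "complex_of_real (NN x) \<noteq> 0"
  by (metis NN_pos(2) of_real_eq_0_iff)

definition nk where "nk x k = (if eps k = 0 then 1 else NN x)"

lemma nk_pos [simp]: "nk x k > 0" by (simp add: nk_def)

text \<open>The Fubini-Study metric on the sphere plus the flat metric \<open>|da|\<^sup>2 + |db|\<^sup>2 = |dl|\<^sup>2 / NN\<close> of the torus.\<close>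

definition gG :: "complex^'n \<Rightarrow> complex^'n \<Rightarrow> complex^'n \<Rightarrow> real" where
  "gG x u w = Re (u $ i0 * cnj (w $ i0)) / (NN x)^2
     + (\<Sum>k\<in>UNIV-{i0}. Re (dl x u k * cnj (dl x w k)) / nk x k)"

lemma Re_mult_cnj: "Re (t * a * cnj (t * b)) = (cmod t)^2 * Re (a * cnj b)"
proof -
  have "t * a * cnj (t * b) = complex_of_real ((cmod t)^2) * (a * cnj b)"
    unfolding complex_norm_square by (simp add: algebra_simps)
  then show ?thesis by (metis Re_complex_of_real Im_complex_of_real mult_zero_left diff_zero times_complex.simps(1))
qed

definition gm where
  "gm P v w = (THE r. \<exists>s x u u'. P = q s x \<and> v = q.tv s x u \<and> w = q.tv s x u' \<and> r = gG x u u')"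

text \<open>Independence of the parametrization: the factors \<open>\<theta>0\<close> and
  \<open>\<theta> k\<close> of a coordinate change are cancelled by the change of the weights
  \<open>NN\<close> and \<open>nk\<close>.\<close>

lemma gm_eq: "gm (q s x) (q.tv s x u) (q.tv s x u') = gG x u u'"
  unfolding gm_def
proof (rule the_equality)
  fix r assume "\<exists>s' x' v v'. q s x = q s' x' \<and> q.tv s x u = q.tv s' x' v \<and> q.tv s x u' = q.tv s' x' v' \<and> r = gG x' v v'"
  then obtain s' x' v v' where *: "q s x = q s' x'" "q.tv s x u = q.tv s' x' v" "q.tv s x u' = q.tv s' x' v'" "r = gG x' v v'"
    by blast
  from *(1) obtain T D \<theta>0 \<theta> where T: "(T has_derivative D) (at x)" "\<forall>a v. D (a *s v) = a *s D v"
      "T x = x'" "\<forall>\<^sub>F v in nhds x. q s' (T v) = q s v"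
    and D: "\<And>u. D u $ i0 = \<theta>0 * u $ i0" "\<And>u k. k \<noteq> i0 \<Longrightarrow> dl x' (D u) k = \<theta> k * dl x u k"
    and \<theta>: "\<And>k. eps k = 0 \<Longrightarrow> \<theta> k = 1" "\<And>k. eps k \<noteq> 0 \<Longrightarrow> (cmod (\<theta> k))^2 / NN x' = 1 / NN x"
      "cmod \<theta>0 / NN x' = 1 / NN x" by (rule q_transitionE) blast
  have t: "q.is_trans s x s' x' T D" using T by (simp add: q.is_trans_def)
  have v: "v = D u" "v' = D u'" using *(2,3) q.tv_change[OF t] q.tv_inj by metis+
  have 1: "Re (\<theta>0 * a * cnj (\<theta>0 * b)) / (NN x')^2 = Re (a * cnj b) / (NN x)^2" for a b
  proof -
    have "(cmod \<theta>0)^2 / (NN x')^2 = 1 / (NN x)^2"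
      using arg_cong[OF \<theta>(3), of "\<lambda>t. t^2"] by (simp add: power_divide)
    then show ?thesis unfolding Re_mult_cnj by (rule scale_quotient)
  qed
  have 2: "Re (\<theta> k * a * cnj (\<theta> k * b)) / nk x' k = Re (a * cnj b) / nk x k" for a b k
  proof (cases "eps k = 0")
    case True then show ?thesis by (simp add: nk_def \<theta>)
  next
    case False
    show ?thesis using scale_quotient[OF \<theta>(2)[OF False]] False unfolding Re_mult_cnj nk_def by simp
  qed
  show "r = gG x u u'"
    unfolding *(4) v gG_def using D 1 2 by simp
qed blast

lemma dl_linear: "linear (\<lambda>u. dl x u k)"
  by (rule linearI) (simp_all add: dl_def algebra_simps)

lemma gG_sym: "gG x u w = gG x w u"
proof -
  have "Re (a * cnj b) = Re (b * cnj a)" for a b by (simp add: mult.commute)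
  then show ?thesis unfolding gG_def
    by (intro arg_cong2[of _ _ _ _ "(+)"] arg_cong2[of _ _ _ _ "(/)"] sum.cong refl)
qed

lemma gG_linear: "linear (\<lambda>u. gG x u w)"
proof -
  have 1: "linear (\<lambda>u. Re (L u * b) / r)" if "linear L" for L :: "complex^'n \<Rightarrow> complex" and b r
    using that by (intro linearI) (simp_all add: linear_add linear_scale algebra_simps add_divide_distrib diff_divide_distrib)
  have "linear (\<lambda>u::complex^'n. u $ i0)" by (rule linearI) auto
  then show ?thesis unfolding gG_def
    by (intro linear_compose_add linear_compose_sum ballI 1 dl_linear)
qed

lemma gG_pos: assumes "u \<noteq> 0" shows "gG x u u > 0"
proof -
  have nn: "Re (a * cnj a) = (cmod a)^2" for a
    by (metis Re_complex_of_real complex_norm_square)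
  have s0: "0 \<le> (\<Sum>k\<in>UNIV-{i0}. Re (dl x u k * cnj (dl x u k)) / nk x k)"
    by (intro sum_nonneg) (simp only: nn, simp add: less_imp_le)
  show ?thesis
  proof (cases "u $ i0 = 0")
    case False
    then have "Re (u $ i0 * cnj (u $ i0)) / (NN x)^2 > 0" unfolding nn by simp
    then show ?thesis using s0 unfolding gG_def by simp
  next
    case True
    then obtain k where k: "k \<noteq> i0" "u $ k \<noteq> 0" using assms by (metis vec_eq_iff zero_index)
    have "0 < Re (dl x u k * cnj (dl x u k)) / nk x k" unfolding nn using k True by (simp add: dl_off)
    then have "0 < (\<Sum>k\<in>UNIV-{i0}. Re (dl x u k * cnj (dl x u k)) / nk x k)"
      by (intro sum_pos2[of _ k]) (use k in \<open>auto simp only: nn, auto simp: less_imp_le\<close>)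
    then show ?thesis unfolding gG_def using True by simp
  qed
qed

text \<open>The numerator of the conjugate real coordinate \<open>m k\<close> over the denominator
  \<open>NN x\<close>.\<close>

definition cc1 where "cc1 x k = cnj (x $ m k) + eps k * cnj (x $ i0) * x $ k"

lemma NN_cnj_Psi_inv:
  assumes "eps k \<noteq> 0" shows "of_real (NN x) * cnj (Psi_inv x $ m k) = cc1 x k"
proof -
  have d: "den (x $ i0) k = of_real (NN x)"
    using assms complex_norm_square[of "x $ i0"] by (simp add: den_def eps_sq NN_def)
  show ?thesis by (simp add: Psi_inv_nth d cc1_def)
qed

definition pol where "pol x u k = of_real (NN x) * u $ k - eps k * u $ i0 * cc1 x k"

lemma pol_eq: "eps k \<noteq> 0 \<Longrightarrow> of_real (NN x) * dl x u k = pol x u k"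
  using NN_cnj_Psi_inv[of k x] by (simp add: dl_def pol_def algebra_simps)

lemma complex_poly_NN: "complex_poly (\<lambda>x. of_real (NN x))"
proof -
  have "(\<lambda>x. of_real (NN x)) = (\<lambda>x. 1 + x $ i0 * cnj (x $ i0))"
    by (simp add: NN_def fun_eq_iff complex_norm_square[symmetric])
  then show ?thesis by (auto intro!: complex_poly_intros complex_poly_nth)
qed

lemma complex_poly_cc1: "complex_poly (\<lambda>x. cc1 x k)"
  unfolding cc1_def by (intro complex_poly_intros complex_poly_nth)

lemma smooth_gG:
  assumes "open W" shows "smooth_on (\<lambda>x. gG x u w) W"
proof -
  have N: "smooth_on (\<lambda>x. inverse (NN x)) W"
    using complex_poly_NN by (intro smooth_on_inverse smooth_on_polynomial assms) (auto simp: complex_poly_def)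
  have C: "smooth_on (\<lambda>x. r) W" for r by (intro smooth_on_polynomial assms real_polynomial_function.intros)
  have 1: "smooth_on (\<lambda>x. Re (u $ i0 * cnj (w $ i0)) / (NN x)^2) W"
  proof -
    have "smooth_on (\<lambda>x. Re (u $ i0 * cnj (w $ i0)) * (inverse (NN x) * inverse (NN x))) W"
      by (intro smooth_on_mult assms N C)
    then show ?thesis by (simp add: field_simps power2_eq_square)
  qed
  have 2: "smooth_on (\<lambda>x. Re (dl x u k * cnj (dl x w k)) / nk x k) W" for k
  proof (cases "eps k = 0")
    case True then show ?thesis by (simp add: dl_eps0 nk_def C)
  next
    case False
    have "complex_poly (\<lambda>x. pol x u k * cnj (pol x w k))"
      unfolding pol_def by (intro complex_poly_intros complex_poly_cc1 complex_poly_NN)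
    then have "smooth_on (\<lambda>x. Re (pol x u k * cnj (pol x w k))) W"
      by (intro smooth_on_polynomial assms) (simp add: complex_poly_def)
    \<comment> \<open>Two of the three factors undo the multiplication of both vectors by
      \<open>NN\<close>; the third is the weight \<open>nk\<close>.\<close>
    then have s: "smooth_on (\<lambda>x. Re (pol x u k * cnj (pol x w k)) * (inverse (NN x) * (inverse (NN x) * inverse (NN x)))) W"
      by (intro smooth_on_mult assms N)
    have "Re (pol x u k * cnj (pol x w k)) = (NN x)^2 * Re (dl x u k * cnj (dl x w k))" for x
      unfolding pol_eq[OF False, symmetric] Re_mult_cnj by simp
    then have "Re (pol x u k * cnj (pol x w k)) * (inverse (NN x) * (inverse (NN x) * inverse (NN x)))
        = Re (dl x u k * cnj (dl x w k)) / nk x k" for x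
      using False NN_pos(2)[of x] by (simp add: nk_def field_simps power2_eq_square)
    then show ?thesis using s by simp
  qed
  show ?thesis unfolding gG_def by (intro smooth_on_add smooth_on_sum assms 1 2)
qed

lemma riemannian_gm: "riemannian_metric q.atlas gm"
  unfolding riemannian_metric_def Let_def
proof
  fix ch assume "ch \<in> q.atlas"
  then obtain s B where B: "ch = chart_of q s B" "open B" "inj_on (q s) B" unfolding q.atlas_def by blast
  let ?G = "\<lambda>P u w. gm P (tangent_of_coords q.atlas P ch u) (tangent_of_coords q.atlas P ch w)"
  have G: "?G (q s x) u w = gG x u w" if "x \<in> B" for x u w
    unfolding B(1) q.tangent_of_coords_eq[OF B(2,3) that] by (rule gm_eq)
  show "(\<forall>P\<in>fst ch. bilinear (?G P) \<and> (\<forall>u w. ?G P u w = ?G P w u) \<and> (\<forall>u. u \<noteq> 0 \<longrightarrow> ?G P u u > 0)) \<and>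
    (\<forall>u w. smooth_on (\<lambda>x. ?G (chart_inv ch x) u w) (snd ch ` fst ch))"
  proof (intro conjI ballI allI impI)
    fix P assume "P \<in> fst ch"
    then obtain x where x: "x \<in> B" "P = q s x" using B by auto
    have "linear (\<lambda>w. gG x u w)" for u using gG_linear[of x u] unfolding gG_sym[of x u] .
    then show "bilinear (?G P)" unfolding x(2) G[OF x(1)] bilinear_def using gG_linear by blast
    show "?G P u w = ?G P w u" for u w unfolding x(2) G[OF x(1)] by (rule gG_sym)
    show "?G P u u > 0" if "u \<noteq> 0" for u unfolding x(2) G[OF x(1)] using that by (rule gG_pos)
  next
    fix u w
    have "snd ch ` fst ch = B" using B by simp
    moreover have "smooth_on (\<lambda>x. ?G (chart_inv ch x) u w) B"
      by (rule smooth_on_cong[OF B(2) smooth_gG[OF B(2), of u w]])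
        (use G B chart_inv_chart_of in metis)
    ultimately show "smooth_on (\<lambda>x. ?G (chart_inv ch x) u w) (snd ch ` fst ch)" by simp
  qed
qed

text \<open>\<open>F\<close> is conformal on the field with one factor \<open>r\<close>, so the
  inverse has factor \<open>1 / r\<close>. It is applied with \<open>r\<close> equal to
  \<open>lam b\<close> on the hyperbolic fields and 1 on the center.\<close>

lemma norms_on_field:
  assumes V: "q.invariant_field V" "\<And>x. F ` V x = V (F x)"
    and scale: "\<And>x u t. u \<in> V x \<Longrightarrow> t *\<^sub>R u \<in> V x"
    and nz: "\<And>x. \<exists>u\<in>V x. u \<noteq> 0"
    and r: "r > 0" "\<And>x u. u \<in> V x \<Longrightarrow> gG (F x) (F u) (F u) = r^2 * gG x u u"
  shows "operator_norm gm (q s x) (q s (F x)) (q.distribution V (q s x)) (tangent_map q.atlas f (q s x)) = r"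
    "operator_norm gm (q s (F x)) (q s x) (q.distribution V (q s (F x)))
       (inv_into (q.distribution V (q s x)) (tangent_map q.atlas f (q s x))) = 1 / r"
proof -
  let ?E = "\<lambda>x. q.distribution V (q s x)" and ?L = "tangent_map q.atlas f (q s x)"
  have unit: "\<exists>u\<in>V x. gG x u u = 1" for x
  proof -
    obtain u where u: "u \<in> V x" "u \<noteq> 0" using nz by blast
    define t where "t = 1 / sqrt (gG x u u)"
    have "gG x (t *\<^sub>R u) (t *\<^sub>R u) = t * t * gG x u u"
      using linear_cmul[OF gG_linear] gG_sym by (simp add: linear_cmul[OF gG_linear] gG_sym[of x _ "t *\<^sub>R u"])
    also have "\<dots> = 1" using gG_pos[OF u(2), of x] by (simp add: t_def)
    finally show ?thesis using scale u by blast
  qed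
  obtain u where u: "u \<in> V x" "gG x u u = 1" using unit by blast
  show "operator_norm gm (q s x) (q s (F x)) (?E x) (?L) = r"
    by (rule operator_norm_eqI[of "q.tv s x u"])
      (use u r in \<open>auto simp: q.distribution_eq V gm_eq tangent_map_f\<close>)
  obtain w where w: "w \<in> V (F x)" "gG (F x) w w = 1" using unit by blast
  have inv: "inv_into (?E x) ?L (q.tv s (F x) (F u)) = q.tv s x u"
    if "u \<in> V x" for u
  proof -
    have "inj_on (?L) (?E x)"
    proof (rule inj_onI)
      fix v v' assume "v \<in> ?E x" "v' \<in> ?E x"
        and e: "?L v = ?L v'"
      then obtain a b where ab: "v = q.tv s x a" "v' = q.tv s x b" by (auto simp: q.distribution_eq V)
      then have "F a = F b" using e q.tv_inj by (simp add: tangent_map_f)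
      then show "v = v'" using ab by (metis Finv_F)
    qed
    moreover have "q.tv s x u \<in> ?E x" using that by (simp add: q.distribution_eq V)
    ultimately show ?thesis using inv_into_f_f tangent_map_f by metis
  qed
  show "operator_norm gm (q s (F x)) (q s x) (?E (F x))
       (inv_into (?E x) ?L) = 1 / r"
  proof (rule operator_norm_eqI[of "q.tv s (F x) w"])
    fix v assume "v \<in> ?E (F x)"
    then obtain u where u: "u \<in> V x" "v = q.tv s (F x) (F u)"
      by (auto simp: q.distribution_eq V(1) V(2)[symmetric])
    show "gm (q s x) (inv_into (?E x) ?L v)
         (inv_into (?E x) ?L v) = (1 / r)^2 * gm (q s (F x)) v v"
      unfolding u(2) inv[OF u(1)] gm_eq r(2)[OF u(1)] using r(1) by (simp add: power_divide)
  qed (use w r in \<open>auto simp: q.distribution_eq V(1) gm_eq\<close>)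
qed

lemma NN_F [simp]: "NN (F x) = NN x" by (simp add: NN_def)

lemma nk_F [simp]: "nk (F x) k = nk x k" by (simp add: nk_def)

lemma gG_F_Vh: assumes "u \<in> Vh b x" shows "gG (F x) (F u) (F u) = (lam b)^2 * gG x u u"
proof -
  have u0: "u $ i0 = 0" and Fu: "F u = lam b *\<^sub>R u" using assms by (auto simp: Vh_def)
  have "dl (F x) (F u) k = of_real (lam b) * dl x u k" for k
    by (simp add: Fu u0 dl_off scaleR_conv_of_real[where 'a = complex])
  then have "Re (dl (F x) (F u) k * cnj (dl (F x) (F u) k)) = (lam b)^2 * Re (dl x u k * cnj (dl x u k))" for k
    by (simp only: Re_mult_cnj norm_of_real power2_abs)
  then show ?thesis unfolding gG_def by (simp add: u0 sum_distrib_left)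
qed

lemma gG_F_Vc: assumes "u \<in> Vc x" shows "gG (F x) (F u) (F u) = 1^2 * gG x u u"
proof -
  have "dl (F x) (F u) k = dl x u k" for k
    unfolding dl_F using assms al_0[of k] by (cases "eps k = 0") (auto simp: Vc_def be_def)
  then show ?thesis unfolding gG_def by simp
qed

text \<open>A tangent vector of the sphere factor. Its nonzero base component is what a holomorphic
  frame of the center distribution would be unable to produce.\<close>

lemma Vc_i0: "\<exists>u\<in>Vc x. u $ i0 = 1"
proof -
  define u :: "complex^'n" where "u = (\<chi> k. if k = i0 then 1 else eps k * cnj (Psi_inv x $ m k))"
  have "u \<in> Vc x" using m_neq_i0 by (auto simp: Vc_def dl_def u_def)
  moreover have "u $ i0 = 1" by (simp add: u_def)
  ultimately show ?thesis by blast
qed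

lemma Vc_nonzero: "\<exists>u\<in>Vc x. u \<noteq> 0"
  using Vc_i0[of x] by (metis zero_index zero_neq_one)

lemma Vh_nonzero: "\<exists>u\<in>Vh b x. u \<noteq> 0"
proof -
  obtain j where j: "eps j \<noteq> 0" using ex_eps by blast
  obtain j' where j': "eps j' \<noteq> 0" "al j' = 1" "al (c j') = 2"
    using al_cases[OF j] j cc eps_c by metis
  have ne: "c j' \<noteq> j'" using j' by auto
  \<comment> \<open>An eigenvector of \<open>(1 1; 1 2)\<close>: the first row gives
    \<open>1 + (lam b - 1) = lam b\<close>, the second is the characteristic equation.\<close>
  define u :: "complex^'n" where "u = (\<chi> k. if k = j' then 1 else if k = c j' then of_real (lam b - 1) else 0)"
  have l2: "lam b * lam b = 3 * lam b - 1"
    using lam_mult[of b] lam_sum[of b] by (metis add_diff_cancel_right' add_diff_eq left_diff_distrib mult.commute right_diff_distrib)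
  have "F u $ k = (lam b *\<^sub>R u) $ k" for k
  proof -
    consider "k = j'" | "k = c j'" | "k \<noteq> j'" "k \<noteq> c j'" by blast
    then show ?thesis
    proof cases
      case 1 then show ?thesis using j' ne by (simp add: F_nth u_def be_def scaleR_conv_of_real[where 'a = complex])
    next
      case 2
      have "2 * (lam b - 1) + 1 = lam b * (lam b - 1)" using l2 by (simp add: algebra_simps)
      then have "complex_of_real (2 * (lam b - 1) + 1) = complex_of_real (lam b * (lam b - 1))" by simp
      then show ?thesis using 2 j' ne by (simp add: F_nth u_def be_def scaleR_conv_of_real[where 'a = complex] algebra_simps)
    next
      case 3
      then have "c k \<noteq> j'" "c k \<noteq> c j'" by (metis cc)+
      then show ?thesis using 3 by (simp add: F_nth u_def)
    qed
  qed
  then have "F u = lam b *\<^sub>R u" by (simp add: vec_eq_iff)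
  moreover have "u $ k = 0" if "eps k = 0" for k using that j' by (auto simp: u_def)
  ultimately have "u \<in> Vh b x" by (simp add: Vh_def)
  moreover have "u $ j' \<noteq> 0" by (simp add: u_def)
  ultimately show ?thesis by (metis zero_index)
qed

lemma subspace_Vh: "subspace (Vh b x)"
proof -
  have "F 0 = 0" using F_scaleR[of 0 0] by simp
  then show ?thesis by (auto simp: subspace_def Vh_def F_add F_scaleR scaleR_add_right)
qed

text \<open>The leaf direction of the foliation: in the real coordinates every leaf is locally a
  translate of this subspace.\<close>

definition Kc :: "(complex^'n) set" where "Kc = {u. \<forall>k. eps k \<noteq> 0 \<longrightarrow> u $ k = 0}"

lemma subspace_Kc: "subspace Kc" by (auto simp: subspace_def Kc_def)

text \<open>Multiplying by \<open>NN\<close> clears the denominators of the frame, so that polynomials suffice for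
  analyticity.\<close>

definition Theta where "Theta x u = (\<chi> k. if eps k = 0 then of_real (NN x) * u $ k else eps k * u $ i0 * cc1 x k)"

lemma Theta_Kc: "Theta x ` Kc = Vc x"
proof -
  have N: "of_real (NN x) \<noteq> (0::complex)" by (rule NN_complex)
  have mem: "v \<in> Vc x \<longleftrightarrow> (\<forall>k. eps k \<noteq> 0 \<longrightarrow> of_real (NN x) * v $ k = eps k * v $ i0 * cc1 x k)" for v
  proof -
    have "dl x v k = 0 \<longleftrightarrow> of_real (NN x) * v $ k = eps k * v $ i0 * cc1 x k" if "eps k \<noteq> 0" for k
      using pol_eq[OF that, of x v] N by (auto simp: pol_def)
    then show ?thesis unfolding Vc_def by auto
  qed
  show ?thesis
  proof (intro set_eqI iffI)
    fix v assume "v \<in> Theta x ` Kc"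
    then show "v \<in> Vc x" unfolding mem by (auto simp: Theta_def)
  next
    fix v assume v: "v \<in> Vc x"
    define u where "u = (\<chi> k. if eps k = 0 then v $ k / of_real (NN x) else 0)"
    have "Theta x u $ k = v $ k" for k
    proof (cases "eps k = 0")
      case False
      then have "of_real (NN x) * v $ k = of_real (NN x) * (Theta x u $ k)"
        using v N unfolding mem by (simp add: Theta_def u_def)
      then show ?thesis using N by simp
    qed (use N in \<open>simp add: Theta_def u_def\<close>)
    then have "v = Theta x u" by (simp add: vec_eq_iff)
    moreover have "u \<in> Kc" by (simp add: Kc_def u_def)
    ultimately show "v \<in> Theta x ` Kc" by blast
  qed
qed

lemma Theta_linear: "linear (Theta x)"
  by (rule linearI) (auto simp: Theta_def vec_eq_iff algebra_simps)

lemma Theta_inj: "inj_on (Theta x) Kc"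
proof (rule inj_onI)
  fix u v assume uv: "u \<in> Kc" "v \<in> Kc" "Theta x u = Theta x v"
  have N: "of_real (NN x) \<noteq> (0::complex)" by (rule NN_complex)
  have "u $ k = v $ k" for k
    using arg_cong[OF uv(3), of "\<lambda>w. w $ k"] uv(1,2) N by (cases "eps k = 0") (auto simp: Theta_def Kc_def)
  then show "u = v" by (simp add: vec_eq_iff)
qed

lemma polynomial_Theta: "polynomial_function (\<lambda>x. Theta x u)"
proof (rule polynomial_function_vecI)
  show "complex_poly (\<lambda>x. Theta x u $ k)" for k
    by (cases "eps k = 0") (auto simp: Theta_def intro!: complex_poly_intros complex_poly_NN complex_poly_cc1)
qed

lemma Ec_frame: "\<exists>r e. (\<forall>x. real_frame (\<lambda>i. e i x) r (Vc x)) \<and> (\<forall>i. polynomial_function (e i))"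
proof -
  obtain e0 where e0: "real_frame e0 (dim Kc) Kc" using ex_real_frame[OF subspace_Kc] by blast
  show ?thesis
    by (intro exI[of _ "dim Kc"] exI[of _ "\<lambda>i x. Theta x (e0 i)"])
      (use real_frame_linear_image[OF e0 Theta_linear Theta_inj] polynomial_Theta in \<open>simp add: Theta_Kc\<close>)
qed

lemma real_analytic_Ec: "real_analytic_subbundle_on X q.atlas (topspace X) Ec"
proof -
  from Ec_frame obtain r e where "\<forall>x. real_frame (\<lambda>i. e i x) r (Vc x)" "\<forall>i. polynomial_function (e i)"
    by (elim exE conjE)
  note e = this[rule_format]
  show ?thesis unfolding Ec_def
    by (rule q.subbundle_distribution[OF invariant_Vc, of r _ e])
      (rule real_analytic_on_polynomial[OF e(2)], rule e(1))
qed

lemma continuous_Ec: "continuous_subbundle_on X q.atlas (topspace X) Ec"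
proof -
  from Ec_frame obtain r e where "\<forall>x. real_frame (\<lambda>i. e i x) r (Vc x)" "\<forall>i. polynomial_function (e i)"
    by (elim exE conjE)
  note e = this[rule_format]
  show ?thesis unfolding Ec_def
    by (rule q.subbundle_distribution[OF invariant_Vc, of r _ e])
      (rule continuous_on_polymonial_function[OF e(2)], rule e(1))
qed

lemma continuous_Vh: "continuous_subbundle_on X q.atlas (topspace X) (q.distribution (Vh b))"
proof -
  obtain e where e: "real_frame e (dim (Vh b 0)) (Vh b 0)" using ex_real_frame[OF subspace_Vh] by blast
  have "real_frame e (dim (Vh b 0)) (Vh b x)" for x using e unfolding Vh_def .
  then show ?thesis
    by (intro q.subbundle_distribution[OF invariant_Vh, of "dim (Vh b 0)" _ "\<lambda>i x. e i"]) auto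
qed

lemma partially_hyperbolic_f: "partially_hyperbolic X q.atlas f Es Ec Eu"
  unfolding partially_hyperbolic_def
proof (intro conjI)
  have field: "(\<forall>P\<in>topspace X. \<exists>v\<in>q.distribution V P. v \<noteq> (\<lambda>_. 0)) \<and>
        (\<forall>P\<in>topspace X. tangent_map q.atlas f P ` q.distribution V P = q.distribution V (f P))"
    if V: "q.invariant_field V" "\<And>x. F ` V x = V (F x)" and nz: "\<And>x. \<exists>u\<in>V x. u \<noteq> 0" for V
  proof (intro conjI ballI)
    fix P assume "P \<in> topspace X"
    then obtain s x where P: "P = q s x" by (rule q.topspaceE)
    obtain u where u: "u \<in> V x" "u \<noteq> 0" using nz by blast
    then have "q.tv s x u \<noteq> (\<lambda>_. 0)" using q.tv_inj[of s x u 0] q.tv_0 by auto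
    then show "\<exists>v\<in>q.distribution V P. v \<noteq> (\<lambda>_. 0)" using u by (auto simp: P q.distribution_eq V(1))
    show "tangent_map q.atlas f P ` q.distribution V P = q.distribution V (f P)"
      by (simp add: P q.distribution_eq V(1) f_q V(2)[symmetric] image_image tangent_map_f)
  qed
  show "\<forall>E\<in>{Es, Ec, Eu}. continuous_subbundle_on X q.atlas (topspace X) E \<and>
        (\<forall>x\<in>topspace X. \<exists>v\<in>E x. v \<noteq> (\<lambda>_. 0)) \<and>
        (\<forall>x\<in>topspace X. tangent_map q.atlas f x ` E x = E (f x))"
    using field[OF invariant_Vh[of False] F_Vh Vh_nonzero] field[OF invariant_Vh[of True] F_Vh Vh_nonzero]
      field[OF invariant_Vc F_Vc Vc_nonzero] continuous_Vh continuous_Ec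
    by (simp add: Es_def Eu_def Ec_def)
  show "\<forall>x\<in>topspace X. \<forall>v\<in>tangent_space q.atlas x.
        \<exists>!(vs, vc, vu). vs \<in> Es x \<and> vc \<in> Ec x \<and> vu \<in> Eu x \<and> v = (\<lambda>c. vs c + vc c + vu c)"
    using splitting by blast
  have sVc: "u \<in> Vc x \<Longrightarrow> t *\<^sub>R u \<in> Vc x" for x u t
    by (auto simp: Vc_def linear_cmul[OF dl_linear])
  have sVh: "u \<in> Vh b x \<Longrightarrow> t *\<^sub>R u \<in> Vh b x" for x u t b
    using subspace_Vh by (simp add: subspace_def)
  have nh: "operator_norm gm (q s x) (q s (F x)) (q.distribution (Vh b) (q s x)) (tangent_map q.atlas f (q s x)) = lam b"
    "operator_norm gm (q s (F x)) (q s x) (q.distribution (Vh b) (q s (F x)))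
       (inv_into (q.distribution (Vh b) (q s x)) (tangent_map q.atlas f (q s x))) = 1 / lam b" for s x b
    by (intro norms_on_field invariant_Vh F_Vh Vh_nonzero lam_bounds gG_F_Vh sVh; assumption)+
  have nc: "operator_norm gm (q s x) (q s (F x)) (q.distribution Vc (q s x)) (tangent_map q.atlas f (q s x)) = 1"
    "operator_norm gm (q s (F x)) (q s x) (q.distribution Vc (q s (F x)))
       (inv_into (q.distribution Vc (q s x)) (tangent_map q.atlas f (q s x))) = 1 / 1" for s x
    by (intro norms_on_field invariant_Vc F_Vc Vc_nonzero zero_less_one gG_F_Vc sVc; assumption)+
  have f1: "f ^^ 1 = f" by simp
  show "\<exists>g. riemannian_metric q.atlas g \<and> (\<exists>k\<ge>1. \<forall>x\<in>topspace X.
        let y = (f ^^ k) x;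
            F = tangent_map q.atlas (f ^^ k) x;
            norm_on = (\<lambda>E. operator_norm g x y (E x) F);
            inv_norm_on = (\<lambda>E. operator_norm g y x (E y) (inv_into (E x) F))
        in norm_on Es < 1 \<and> 1 < inverse (inv_norm_on Eu) \<and>
           norm_on Es < inverse (inv_norm_on Ec) \<and>
           norm_on Ec < inverse (inv_norm_on Eu))"
    \<comment> \<open>The metric is adapted: one iterate suffices, with factors
      \<open>lam False < 1 < lam True\<close>.\<close>
    by (rule exI[of _ gm], intro conjI riemannian_gm, rule exI[of _ 1])
      (use lam_bounds in \<open>auto simp: f1 Let_def f_q Es_def Ec_def Eu_def nh nc simp del: One_nat_def funpow.simps elim!: q.topspaceE\<close>)
qed


lemma R_gauss:
  assumes "p s y = p s' y'" "k \<noteq> i0" shows "R s' y' $ k - R s y $ k \<in> gauss_int"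
  using assms by (simp add: p_eq_iff H_eq_gauss)

lemma R_scaleR: "R s (r *\<^sub>R y) = r *\<^sub>R R s y"
  by (auto simp: vec_eq_iff R_nth scaleR_conv_of_real[where 'a=complex])

section \<open>The center fibration\<close>

text \<open>\<open>R s y\<close> expresses the torus coordinates of both parametrizations in the
  same terms. The label \<open>t\<close> counts modulo Gaussian integers, and only in the entries
  with \<open>eps k \<noteq> 0\<close>.\<close>

definition Leaf where
  "Leaf t = {p s y | s y. \<forall>k. eps k \<noteq> 0 \<longrightarrow> R s y $ k - t $ k \<in> gauss_int}"

lemma p_in_Leaf: "p s y \<in> Leaf t \<longleftrightarrow> (\<forall>k. eps k \<noteq> 0 \<longrightarrow> R s y $ k - t $ k \<in> gauss_int)"
proof
  assume "p s y \<in> Leaf t"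
  then obtain s' y' where *: "p s y = p s' y'" "\<And>k. eps k \<noteq> 0 \<Longrightarrow> R s' y' $ k - t $ k \<in> gauss_int"
    unfolding Leaf_def by blast
  show "\<forall>k. eps k \<noteq> 0 \<longrightarrow> R s y $ k - t $ k \<in> gauss_int"
  proof (intro allI impI)
    fix k assume k: "eps k \<noteq> 0"
    then have "R s y $ k - R s' y' $ k \<in> gauss_int" using R_gauss[OF *(1)[symmetric]] m_neq_i0 by blast
    from gauss_int_add[OF this *(2)[OF k]] show "R s y $ k - t $ k \<in> gauss_int" by simp
  qed
qed (auto simp: Leaf_def)

lemma Leaf_eq_iff: "Leaf t = Leaf t' \<longleftrightarrow> (\<forall>k. eps k \<noteq> 0 \<longrightarrow> t' $ k - t $ k \<in> gauss_int)"
proof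
  assume "Leaf t = Leaf t'"
  then have "p False t' \<in> Leaf t" using p_in_Leaf[of False t' t'] by simp
  then show "\<forall>k. eps k \<noteq> 0 \<longrightarrow> t' $ k - t $ k \<in> gauss_int" by (simp add: p_in_Leaf)
next
  assume *: "\<forall>k. eps k \<noteq> 0 \<longrightarrow> t' $ k - t $ k \<in> gauss_int"
  have "p s y \<in> Leaf t \<longleftrightarrow> p s y \<in> Leaf t'" for s y
  proof -
    have "R s y $ k - t $ k \<in> gauss_int \<longleftrightarrow> R s y $ k - t' $ k \<in> gauss_int" if "eps k \<noteq> 0" for k
      using gauss_int_add[of "R s y $ k - t' $ k" "t' $ k - t $ k"] gauss_int_diff[of "R s y $ k - t $ k" "t' $ k - t $ k"] * that
      by auto
    then show ?thesis unfolding p_in_Leaf by blast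
  qed
  then show "Leaf t = Leaf t'" unfolding Leaf_def by blast
qed

lemma p_in_Leaf_iff: "p s y \<in> Leaf t \<longleftrightarrow> Leaf (R s y) = Leaf t"
  using Leaf_eq_iff[of t "R s y"] p_in_Leaf[of s y t] by auto

definition leaves where "leaves = range Leaf"

lemma Leaf_subset: "Leaf t \<subseteq> topspace X" by (auto simp: Leaf_def)

lemma leaf_through_p: "leaf_through leaves (p s y) = Leaf (R s y)"
  unfolding leaf_through_def by (rule the_equality) (auto simp: leaves_def p_in_Leaf_iff)

lemma partition_leaves: "partition_on (topspace X) leaves"
proof (rule partition_onI)
  show "\<Union>leaves = topspace X"
  proof (intro set_eqI iffI)
    fix P assume "P \<in> topspace X"
    then obtain s y where "P = p s y" by (rule topspaceE)
    then have "P \<in> Leaf (R s y)" by (simp add: p_in_Leaf_iff)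
    then show "P \<in> \<Union>leaves" by (auto simp: leaves_def)
  qed (use Leaf_subset in \<open>auto simp: leaves_def\<close>)
  fix L L' assume LL: "L \<in> leaves" "L' \<in> leaves" "L \<noteq> L'"
  show "disjnt L L'"
  proof (rule ccontr)
    assume "\<not> disjnt L L'"
    then obtain P where P: "P \<in> L" "P \<in> L'" by (auto simp: disjnt_def)
    then obtain s y where "P = p s y" using LL(1) Leaf_subset topspaceE unfolding leaves_def by blast
    then show False using P LL by (auto simp: leaves_def p_in_Leaf_iff)
  qed
next
  have "p False t \<in> Leaf t" for t by (simp add: p_in_Leaf_iff)
  then show "{} \<notin> leaves" by (auto simp: leaves_def)
qed

definition slice where "slice s t = {y. \<forall>k. eps k \<noteq> 0 \<longrightarrow> R s y $ k = t $ k}"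

lemma convex_slice: "convex (slice s t)"
  unfolding convex_def slice_def
  by (auto simp: R_add R_scaleR scaleR_conv_of_real[where 'a=complex] distrib_right[symmetric] of_real_add[symmetric] simp del: of_real_add)

lemma slice_shift:
  assumes "p s y \<in> Leaf t" obtains y' where "p s y = p s y'" "y' \<in> slice s t"
proof -
  define g :: "complex^'n" where "g = (\<chi> k. if eps k = 0 then 0 else t $ k - R s y $ k)"
  have "g \<in> lat"
    using assms gauss_int_minus unfolding p_in_Leaf lat_def g_def by force
  then have "p s (y + R s g) = p s y" using R_lat p_add_lat by blast
  moreover have "y + R s g \<in> slice s t" by (simp add: slice_def R_add g_def)
  ultimately show ?thesis using that by metis
qed

text \<open>A lattice translation moves the torus coordinates of any point of the leaf exactly to
  \<open>t\<close>. So a leaf is the union of two images of affine subspaces, one for each chart of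
  the sphere.\<close>

lemma Leaf_eq_slices: "Leaf t = p False ` slice False t \<union> p True ` slice True t"
proof (intro set_eqI iffI)
  fix P assume P: "P \<in> Leaf t"
  then obtain s y where "P = p s y" by (auto simp: Leaf_def)
  with P slice_shift[of s y t] obtain y' where "P = p s y'" "y' \<in> slice s t" by metis
  then show "P \<in> p False ` slice False t \<union> p True ` slice True t" by (cases s) auto
next
  fix P assume "P \<in> p False ` slice False t \<union> p True ` slice True t"
  then show "P \<in> Leaf t" by (auto simp: slice_def p_in_Leaf)
qed

lemma path_connected_Leaf: "path_connectedin X (Leaf t)"
  unfolding Leaf_eq_slices
proof (rule path_connectedin_Un)
  have "path_connectedin X (p s ` slice s t)" for s
    using path_connectedin_continuous_map_image[OF p.continuous_param] convex_imp_path_connected[OF convex_slice]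
    by simp
  then show "path_connectedin X (p False ` slice False t)" "path_connectedin X (p True ` slice True t)" by auto
  \<comment> \<open>A point over \<open>z = 1\<close>, which lies in both charts of the
    sphere.\<close>
  define y :: "complex^'n" where "y = (\<chi> k. if k = i0 then 1 else t $ k)"
  have "y \<in> slice False t" using m_neq_i0 by (auto simp: slice_def y_def)
  moreover have "S y \<in> slice True t"
    using m_neq_i0 by (auto simp: slice_def R_nth[of True "S y"] S_nth R_nth y_def)
  moreover have "p True (S y) = p False y" using p_S[of y False] by (simp add: y_def)
  ultimately show "p False ` slice False t \<inter> p True ` slice True t \<noteq> {}" by (metis IntI empty_iff imageI)
qed

text \<open>Torus coordinates of two points of the ball in one leaf differ by Gaussian integers of
  norm less than 1, hence agree: a small ball meets each leaf in at most one plaque.\<close>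

lemma leaf_ball:
  assumes "r \<le> 1/4" "y1 \<in> ball y0 r" "p s y1 \<in> Leaf t"
  shows "p s ` ball y0 r \<inter> Leaf t = p s ` {y \<in> ball y0 r. y - y1 \<in> Kc}"
proof (intro set_eqI iffI)
  fix P assume "P \<in> p s ` ball y0 r \<inter> Leaf t"
  then obtain y where y: "P = p s y" "y \<in> ball y0 r" "p s y \<in> Leaf t" by auto
  have "norm (y - y1) < 1"
    using y(2) assms(1,2) norm_triangle_ineq4[of "y - y0" "y1 - y0"] by (simp add: dist_norm norm_minus_commute)
  then have n: "norm ((y - y1) $ k) < 1" for k
    using Finite_Cartesian_Product.norm_nth_le[of "y - y1" k] by linarith
  have z: "R s (y - y1) $ k = 0" if "eps k \<noteq> 0" for k
  proof (rule gauss_int_small)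
    have "Leaf (R s y1) = Leaf (R s y)" using y(3) assms(3) by (simp add: p_in_Leaf_iff)
    then show "R s (y - y1) $ k \<in> gauss_int" using that unfolding Leaf_eq_iff R_diff by simp
    show "norm (R s (y - y1) $ k) < 1" using n[of k] n[of "m k"] by (simp add: R_nth norm_mult del: vector_minus_component)
  qed
  have "(y - y1) $ k = 0" if "eps k \<noteq> 0" for k
  proof -
    have "R s (R s (y - y1)) $ k = 0" unfolding R_nth[of s "R s (y - y1)"] using z[of k] z[of "m k"] that by auto
    then show ?thesis by simp
  qed
  then show "P \<in> p s ` {y \<in> ball y0 r. y - y1 \<in> Kc}" using y by (auto simp: Kc_def)
next
  fix P assume "P \<in> p s ` {y \<in> ball y0 r. y - y1 \<in> Kc}"
  then obtain y where y: "P = p s y" "y \<in> ball y0 r" "y - y1 \<in> Kc" by auto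
  have "R s y $ k = R s y1 $ k" if "eps k \<noteq> 0" for k
    using y(3) that by (auto simp: R_nth Kc_def)
  then have "P \<in> Leaf t" using assms(3) unfolding y(1) p_in_Leaf by auto
  then show "P \<in> p s ` ball y0 r \<inter> Leaf t" using y by auto
qed

lemma plaque_ball:
  assumes "r \<le> 1/4" "y1 \<in> ball y0 r"
  shows "plaque Kc (chart_of p s (ball y0 r)) (p s y1) = p s ` {y \<in> ball y0 r. y - y1 \<in> Kc}"
proof -
  have i: "inj_on (p s) (ball y0 r)" using assms(1) by (intro p_inj_ball) simp
  show ?thesis using assms(2) unfolding plaque_def by (auto simp: inv_into_f_f[OF i])
qed

text \<open>As the leaf meets the ball in a single plaque, and this is the image of a convex set,
  the connected component is the whole intersection.\<close>

lemma foliation_chart_ball: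
  assumes "r \<le> 1/4"
  shows "foliation_chart X Kc leaves (chart_of p s (ball y0 r))"
  unfolding foliation_chart_def
proof (intro conjI ballI)
  have i: "inj_on (p s) (ball y0 r)" using assms(1) by (intro p_inj_ball) simp
  show "is_chart X (chart_of p s (ball y0 r))" using i by (intro p.is_chart_chart_of) auto
  show "convex (snd (chart_of p s (ball y0 r)) ` fst (chart_of p s (ball y0 r)))" using i by simp
  fix L P assume L: "L \<in> leaves" and "P \<in> fst (chart_of p s (ball y0 r)) \<inter> L"
  then obtain y1 where y1: "P = p s y1" "y1 \<in> ball y0 r" "P \<in> L" by auto
  obtain t where t: "L = Leaf t" using L by (auto simp: leaves_def)
  have e: "fst (chart_of p s (ball y0 r)) \<inter> L = plaque Kc (chart_of p s (ball y0 r)) P"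
    using leaf_ball[OF assms y1(2)] y1 t plaque_ball[OF assms y1(2)] by simp
  have "{y \<in> ball y0 r. y - y1 \<in> Kc} = ball y0 r \<inter> (\<lambda>u. y1 + u) ` Kc"
    by (auto simp: image_iff) (metis add.commute diff_add_cancel)
  moreover have "convex ((\<lambda>u. y1 + u) ` Kc)"
    using convex_translation subspace_imp_convex[OF subspace_Kc] by blast
  ultimately have "connected {y \<in> ball y0 r. y - y1 \<in> Kc}"
    by (simp add: convex_Int convex_connected)
  then have "connectedin X (plaque Kc (chart_of p s (ball y0 r)) P)"
    unfolding y1(1) plaque_ball[OF assms y1(2)]
    using connectedin_continuous_map_image[OF p.continuous_param] by simp
  then have c1: "connected_space (subtopology X (plaque Kc (chart_of p s (ball y0 r)) P))"
    by (simp add: connectedin_def)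
  have c2: "P \<in> topspace (subtopology X (plaque Kc (chart_of p s (ball y0 r)) P))"
    using y1 plaque_ball[OF assms y1(2)] by (auto simp: subspace_0[OF subspace_Kc])
  have "connected_component_of_set (subtopology X (plaque Kc (chart_of p s (ball y0 r)) P)) P
      = topspace (subtopology X (plaque Kc (chart_of p s (ball y0 r)) P))"
    by (rule bspec[OF iffD1[OF connected_space_connected_component_set c1] c2])
  also have "\<dots> = plaque Kc (chart_of p s (ball y0 r)) P"
    unfolding y1(1) plaque_ball[OF assms y1(2)] by auto
  finally show "connected_component_of_set (subtopology X (fst (chart_of p s (ball y0 r)) \<inter> L)) P = plaque Kc (chart_of p s (ball y0 r)) P"
    unfolding e .
qed

lemma foliation_leaves: "foliation X Kc leaves"
  unfolding foliation_def
proof (intro conjI subspace_Kc partition_leaves ballI)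
  show "path_connectedin X L" if "L \<in> leaves" for L
    using that path_connected_Leaf by (auto simp: leaves_def)
  fix P assume "P \<in> topspace X"
  then obtain s y where "P = p s y" by (rule topspaceE)
  then show "\<exists>c. foliation_chart X Kc leaves c \<and> P \<in> fst c"
    by (intro exI[of _ "chart_of p s (ball y (1/4))"]) (simp add: foliation_chart_ball)
qed

section \<open>Tangency of the leaves to the center distribution\<close>

definition DPsi where "DPsi y u = (\<chi> k. u $ k + eps k * (u $ i0 * cnj (y $ m k) + y $ i0 * cnj (u $ m k)))"

lemma cnj_nth_derivative: "((\<lambda>v. cnj (v $ k)) has_derivative (\<lambda>v. cnj (v $ k))) (at x within A)"
  by (intro bounded_linear_imp_has_derivative bounded_linear_compose[OF bounded_linear_cnj bounded_linear_vec_nth])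

lemma Psi_derivative: "(Psi has_derivative DPsi y) (at y within A)"
proof (rule has_derivative_vecI)
  fix k
  show "((\<lambda>y. Psi y $ k) has_derivative (\<lambda>u. DPsi y u $ k)) (at y within A)"
    unfolding Psi_nth by (auto intro!: derivative_eq_intros nth_derivative cnj_nth_derivative simp: DPsi_def algebra_simps)
qed

lemma DPsi_Kc_nth:
  "u \<in> Kc \<Longrightarrow> DPsi y u $ k = (if eps k = 0 then u $ k else eps k * u $ i0 * cnj (y $ m k))"
  by (simp add: DPsi_def Kc_def)

lemma DPsi_inj: "inj_on (DPsi y) Kc"
proof (rule inj_onI)
  fix u v assume uv: "u \<in> Kc" "v \<in> Kc" "DPsi y u = DPsi y v"
  have "u $ k = v $ k" for k
    using arg_cong[OF uv(3), of "\<lambda>w. w $ k"] uv(1,2) by (cases "eps k = 0") (auto simp: DPsi_Kc_nth Kc_def)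
  then show "u = v" by (simp add: vec_eq_iff)
qed

text \<open>Along \<open>Kc\<close> the torus coordinates are fixed, so the antilinear term of
  \<open>DPsi\<close> drops out and exactly the equations \<open>dl = 0\<close> remain.\<close>

lemma DPsi_Kc: "DPsi y ` Kc = Vc (Psi y)"
proof (intro set_eqI iffI)
  fix v assume "v \<in> DPsi y ` Kc"
  then show "v \<in> Vc (Psi y)" by (auto simp: Vc_def dl_def DPsi_Kc_nth)
next
  fix v assume v: "v \<in> Vc (Psi y)"
  define u :: "complex^'n" where "u = (\<chi> k. if eps k = 0 then v $ k else 0)"
  have u: "u \<in> Kc" by (simp add: Kc_def u_def)
  have "u $ i0 = v $ i0" "eps k = 0 \<Longrightarrow> u $ k = v $ k" for k by (simp_all add: u_def)
  then have "DPsi y u $ k = v $ k" for k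
    using v by (cases "eps k = 0") (auto simp: DPsi_Kc_nth[OF u] Vc_def dl_def)
  then have "v = DPsi y u" by (simp add: vec_eq_iff)
  then show "v \<in> DPsi y ` Kc" using u by blast
qed

text \<open>The plaque is parametrized by a straight ball in the real coordinates, and the
  holomorphic chart sees it through \<open>Psi\<close>. The chart \<open>d\<close> is fixed by
  \<open>s\<close>, whereas \<open>\<sigma>\<close> uses the parametrization \<open>s'\<close> of
  the given chart of the atlas.\<close>

lemma leaf_parametrization:
  assumes P: "P = p s y0"
  shows "\<exists>d. foliation_chart X Kc leaves d \<and> P \<in> fst d \<and>
        (\<forall>c\<in>q.atlas. P \<in> fst c \<longrightarrow>
          (\<exists>\<rho>>0. \<exists>\<sigma> D. let B = Kc \<inter> ball 0 \<rho> in
             \<sigma> 0 = P \<and> \<sigma> ` B \<subseteq> fst c \<and>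
             openin (subtopology X (plaque Kc d P)) (\<sigma> ` B) \<and>
             homeomorphic_map (top_of_set B) (subtopology X (\<sigma> ` B)) \<sigma> \<and>
             (\<forall>t\<in>B. ((snd c \<circ> \<sigma>) has_derivative D t) (at t within Kc) \<and>
                     inj_on (D t) Kc \<and> D t ` Kc = (\<lambda>v. v c) ` Ec (\<sigma> t)) \<and>
             (\<forall>u\<in>Kc. continuous_on B (\<lambda>t. D t u))))"
    (is "\<exists>d. _ \<and> _ \<and> (\<forall>c\<in>_. _ \<longrightarrow> ?Q c d)")
proof -
  define d where "d = chart_of p s (ball y0 (1/4))"
  have Pd: "P \<in> fst d" by (simp add: P d_def)
  have Pt: "P \<in> Leaf (R s y0)" by (simp add: P p_in_Leaf_iff)
  have plaque_eq: "plaque Kc d P = fst d \<inter> Leaf (R s y0)"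
    unfolding P d_def using leaf_ball[of "1/4" y0 y0 s "R s y0"] plaque_ball[of "1/4" y0 y0 s] by (simp add: p_in_Leaf_iff)
  show ?thesis
  proof (intro exI[of _ d] conjI ballI impI)
    show "foliation_chart X Kc leaves d" unfolding d_def by (rule foliation_chart_ball) simp
    show "P \<in> fst d" by (rule Pd)
    fix ch assume "ch \<in> q.atlas" "P \<in> fst ch"
    then obtain s' B x where ch: "ch = chart_of q s' B" "open B" "inj_on (q s') B" "x \<in> B" "P = q s' x"
      using q.atlasE by metis
    define y1 where "y1 = Psi_inv x"
    have P1: "P = p s' y1" using ch(5) by (simp add: q_def y1_def)
    have "open (Psi -` B)" using ch(2) continuous_Psi by (rule open_vimage)
    moreover have "open (p s' -` fst d)"
      using p.open_image[of "ball y0 (1/4)" s] openin_p unfolding d_def by simp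
    ultimately have o: "open (Psi -` B \<inter> p s' -` fst d)" by auto
    have "y1 \<in> Psi -` B \<inter> p s' -` fst d" using ch(4) Pd P1 by (simp add: y1_def)
    with o obtain r where r: "r > 0" "ball y1 r \<subseteq> Psi -` B \<inter> p s' -` fst d" by (meson openE)
    \<comment> \<open>The bound \<open>r\<close> keeps the ball in both chart domains;
      \<open>1/4\<close> is the radius for which a leaf leaves a single plaque.\<close>
    define \<rho> where "\<rho> = min r (1/4)"
    have \<rho>: "\<rho> > 0" "\<rho> \<le> 1/4" "ball y1 \<rho> \<subseteq> Psi -` B" "p s' ` ball y1 \<rho> \<subseteq> fst d"
      using r by (auto simp: \<rho>_def)
    define \<sigma> where "\<sigma> t = p s' (y1 + t)" for t
    define K1 where "K1 = Kc \<inter> ball 0 \<rho>"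
    have img: "(\<lambda>t. y1 + t) ` K1 = {y \<in> ball y1 \<rho>. y - y1 \<in> Kc}"
    proof (intro set_eqI iffI)
      fix y assume "y \<in> {y \<in> ball y1 \<rho>. y - y1 \<in> Kc}"
      then have "y = y1 + (y - y1)" "y - y1 \<in> K1" by (auto simp: K1_def dist_norm norm_minus_commute)
      then show "y \<in> (\<lambda>t. y1 + t) ` K1" by (metis imageI)
    qed (auto simp: K1_def dist_norm)
    have \<sigma>img: "\<sigma> ` K1 = p s' ` {y \<in> ball y1 \<rho>. y - y1 \<in> Kc}"
      unfolding img[symmetric] by (auto simp: \<sigma>_def)
    have inB: "Psi (y1 + t) \<in> B" if "t \<in> ball 0 \<rho>" for t
    proof -
      have "y1 + t \<in> ball y1 \<rho>" using that by (simp add: dist_norm)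
      then show ?thesis using \<rho>(3) by auto
    qed
    have leafeq: "Leaf (R s y0) = Leaf (R s' y1)" using Pt P1 by (simp add: p_in_Leaf_iff)
    have i: "inj_on (p s') (ball y1 \<rho>)" using \<rho>(2) by (intro p_inj_ball) simp
    show "?Q ch d"
      unfolding Let_def
    proof (rule exI[of _ \<rho>], intro conjI \<rho>(1), rule exI[of _ \<sigma>], rule exI[of _ "\<lambda>t. DPsi (y1 + t)"], fold K1_def, intro conjI ballI)
      show "\<sigma> 0 = P" by (simp add: \<sigma>_def P1)
      show "\<sigma> ` K1 \<subseteq> fst ch"
      proof
        fix Q assume "Q \<in> \<sigma> ` K1"
        then obtain t where t: "t \<in> ball 0 \<rho>" "Q = p s' (y1 + t)" by (auto simp: \<sigma>_def K1_def)
        then have "Q = q s' (Psi (y1 + t))" by simp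
        then show "Q \<in> fst ch" using imageI[OF inB[OF t(1)], of "q s'"] by (simp only: ch(1) fst_chart_of)
      qed
      have "\<sigma> ` K1 = p s' ` ball y1 \<rho> \<inter> Leaf (R s y0)"
        unfolding \<sigma>img leafeq by (rule leaf_ball[symmetric]) (use \<rho> in \<open>auto simp: p_in_Leaf_iff\<close>)
      also have "\<dots> = p s' ` ball y1 \<rho> \<inter> plaque Kc d P" unfolding plaque_eq using \<rho>(4) by auto
      finally show "openin (subtopology X (plaque Kc d P)) (\<sigma> ` K1)"
        using p.open_image[of "ball y1 \<rho>" s'] by (auto simp: openin_subtopology)
      have h1: "homeomorphic_map (top_of_set K1) (top_of_set ((\<lambda>t. y1 + t) ` K1)) (\<lambda>t. y1 + t)"
        unfolding homeomorphic_map_maps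
        by (rule exI[of _ "\<lambda>y. y - y1"]) (auto simp: homeomorphic_maps_def intro!: continuous_intros)
      have h2: "homeomorphic_map (subtopology (top_of_set (ball y1 \<rho>)) ((\<lambda>t. y1 + t) ` K1)) (subtopology (subtopology X (p s' ` ball y1 \<rho>)) (\<sigma> ` K1)) (p s')"
        by (rule homeomorphic_map_subtopologies[OF p.homeomorphic_param[OF open_ball i]])
          (auto simp: img \<sigma>img dest: inj_onD[OF i])
      have e1: "subtopology (top_of_set (ball y1 \<rho>)) ((\<lambda>t. y1 + t) ` K1) = top_of_set ((\<lambda>t. y1 + t) ` K1)"
        unfolding subtopology_subtopology by (rule arg_cong[of _ _ top_of_set]) (auto simp: img)
      have e2: "subtopology (subtopology X (p s' ` ball y1 \<rho>)) (\<sigma> ` K1) = subtopology X (\<sigma> ` K1)"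
        unfolding subtopology_subtopology by (rule arg_cong[of _ _ "subtopology X"]) (auto simp: \<sigma>img)
      show "homeomorphic_map (top_of_set K1) (subtopology X (\<sigma> ` K1)) \<sigma>"
        using homeomorphic_map_compose[OF h1 h2[unfolded e1 e2]] by (simp add: o_def \<sigma>_def[abs_def])
    next
      fix t assume t: "t \<in> K1"
      then have tb: "t \<in> ball 0 \<rho>" by (simp add: K1_def)
      have sndc: "(snd ch \<circ> \<sigma>) t' = Psi (y1 + t')" if "t' \<in> ball 0 \<rho>" for t'
      proof -
        have "\<sigma> t' = q s' (Psi (y1 + t'))" by (simp add: \<sigma>_def)
        then show ?thesis using inv_into_f_f[OF ch(3) inB[OF that]] by (simp add: ch(1))
      qed
      have "((Psi \<circ> (\<lambda>t. y1 + t)) has_derivative (DPsi (y1 + t) \<circ> (\<lambda>u. u))) (at t)"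
        by (rule diff_chain_at[OF _ Psi_derivative]) (auto intro!: derivative_eq_intros)
      then have "((\<lambda>t. Psi (y1 + t)) has_derivative DPsi (y1 + t)) (at t)" by (simp add: o_def)
      then have "((snd ch \<circ> \<sigma>) has_derivative DPsi (y1 + t)) (at t)"
        by (rule has_derivative_transform_within_open[OF _ open_ball tb]) (simp only: sndc)
      then show "((snd ch \<circ> \<sigma>) has_derivative DPsi (y1 + t)) (at t within Kc)"
        by (rule has_derivative_at_withinI)
      show "inj_on (DPsi (y1 + t)) Kc" by (rule DPsi_inj)
      have "\<sigma> t = q s' (Psi (y1 + t))" by (simp add: \<sigma>_def)
      then show "DPsi (y1 + t) ` Kc = (\<lambda>v. v ch) ` Ec (\<sigma> t)"
        using q.distribution_coords[OF invariant_Vc ch(2,3) inB[OF tb]] by (simp add: Ec_def ch(1) DPsi_Kc)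
    next
      fix u
      show "continuous_on K1 (\<lambda>t. DPsi (y1 + t) u)"
        unfolding DPsi_def by (intro continuous_intros)
    qed
  qed
qed

lemma tangent_to_Ec: "tangent_to X q.atlas Kc leaves Ec"
  unfolding tangent_to_def
  by (intro ballI) (elim topspaceE, rule leaf_parametrization)

lemma R_F: "R s (F y) = F (R s y)"
proof -
  have "cnj (al k) = al k" for k using al_mem[of k] by auto
  then have "R s (F y) $ k = F (R s y) $ k" for k
    by (cases "eps k = 0") (auto simp: R_nth[of s _ k] R_nth[of s _ "c k"] F_nth be_def mc algebra_simps)
  then show ?thesis by (simp add: vec_eq_iff)
qed

text \<open>\<open>f\<close> acts on labels by \<open>F\<close>, because \<open>R\<close> commutes
  with \<open>F\<close>; integrality of the cat map and of its inverse preserves equality of labels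
  in both directions.\<close>

lemma f_Leaf: "f ` Leaf t = Leaf (F t)"
proof -
  have Leaf_cong: "Leaf (cat a b u) = Leaf (cat a b v)" if "cat_ok a b" "Leaf u = Leaf v" for a b u v
  proof -
    have "cat a b v $ k - cat a b u $ k \<in> gauss_int" if "eps k \<noteq> 0" for k
    proof -
      have "a k * (v $ k - u $ k) + b k * (v $ c k - u $ c k) \<in> gauss_int"
        using \<open>cat_ok a b\<close> \<open>Leaf u = Leaf v\<close> that unfolding Leaf_eq_iff cat_ok_def
        by (intro gauss_int_add gauss_int_mult) auto
      then show ?thesis by (simp add: cat_nth algebra_simps)
    qed
    then show ?thesis unfolding Leaf_eq_iff by blast
  qed
  have iff: "p s (F y) \<in> Leaf (F t) \<longleftrightarrow> p s y \<in> Leaf t" for s y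
  proof -
    have "Leaf (F (R s y)) = Leaf (F t) \<longleftrightarrow> Leaf (R s y) = Leaf t"
      using Leaf_cong[OF cat_ok_F, of "R s y" t] Leaf_cong[OF cat_ok_Finv, of "F (R s y)" "F t"]
      unfolding F_def[symmetric] Finv_def[symmetric] by auto
    then show ?thesis by (simp add: p_in_Leaf_iff R_F)
  qed
  show ?thesis
  proof (intro set_eqI iffI)
    fix Q assume "Q \<in> f ` Leaf t"
    then obtain P where P: "P \<in> Leaf t" "Q = f P" by auto
    then obtain s y where "P = p s y" by (auto simp: Leaf_def)
    then show "Q \<in> Leaf (F t)" using P iff by simp
  next
    fix Q assume Q: "Q \<in> Leaf (F t)"
    then obtain s y where y: "Q = p s y" by (auto simp: Leaf_def)
    then have "Q = f (p s (Finv y))" "p s (Finv y) \<in> Leaf t" using Q iff[of s "Finv y"] by simp_all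
    then show "Q \<in> f ` Leaf t" by (rule image_eqI)
  qed
qed

text \<open>The angles of the torus coordinates: a complete invariant of the leaf that is continuous
  on \<open>X\<close> with Euclidean values. It makes the leaves closed and the leaf space
  Hausdorff.\<close>

definition bcoord :: "complex^'n \<Rightarrow> (complex^'n) \<times> (complex^'n)" where
  "bcoord t = ((\<chi> k. if eps k = 0 then 1 else cis (2 * pi * Re (t $ k))), (\<chi> k. if eps k = 0 then 1 else cis (2 * pi * Im (t $ k))))"

lemma bcoord_eq_iff: "bcoord t = bcoord t' \<longleftrightarrow> Leaf t = Leaf t'"
  unfolding Leaf_eq_iff bcoord_def prod.inject vec_eq_iff vec_lambda_beta gauss_int_def mem_Collect_eq
  using cis_2pi_eq_iff[of "Re (t $ _)" "Re (t' $ _)"] cis_2pi_eq_iff[of "Im (t $ _)" "Im (t' $ _)"]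
  by (auto simp: cis_2pi_eq_iff)

definition Bm where "Bm P = ((\<chi> k. if eps k = 0 then 1 else fst (snd (embed P)) $ k), (\<chi> k. if eps k = 0 then 1 else snd (snd (embed P)) $ k))"

lemma Bm_p [simp]: "Bm (p s y) = bcoord (R s y)"
  using m_neq_i0 by (auto simp: Bm_def bcoord_def H_def vec_eq_iff)

lemma continuous_Bm: "continuous_map X euclidean Bm"
proof -
  have 1: "continuous_on UNIV (\<lambda>h::(complex \<times> real) \<times> (complex^'n) \<times> (complex^'n). if eps k = 0 then 1 else fst (snd h) $ k)"
    "continuous_on UNIV (\<lambda>h::(complex \<times> real) \<times> (complex^'n) \<times> (complex^'n). if eps k = 0 then 1 else snd (snd h) $ k)" for k
    by (cases "eps k = 0"; simp; intro continuous_intros)+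
  have "continuous_on UNIV (\<lambda>h::(complex \<times> real) \<times> (complex^'n) \<times> (complex^'n).
     ((\<chi> k. if eps k = 0 then 1 else fst (snd h) $ k), (\<chi> k. if eps k = 0 then 1 else snd (snd h) $ k)))"
    by (intro continuous_on_Pair continuous_on_vec_lambda 1)
  from continuous_map_compose[OF continuous_embed, of euclidean, OF this[folded continuous_map_iff_continuous2]]
  show ?thesis by (simp add: o_def Bm_def[abs_def])
qed

lemma Leaf_eq_Bm: "Leaf t = {P \<in> topspace X. Bm P \<in> {bcoord t}}"
proof (intro set_eqI iffI)
  fix P assume P: "P \<in> Leaf t"
  then obtain s y where "P = p s y" by (auto simp: Leaf_def)
  then show "P \<in> {P \<in> topspace X. Bm P \<in> {bcoord t}}" using P by (simp add: bcoord_eq_iff p_in_Leaf_iff)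
next
  fix P assume P: "P \<in> {P \<in> topspace X. Bm P \<in> {bcoord t}}"
  then obtain s y where "P = p s y" using topspaceE by blast
  then show "P \<in> Leaf t" using P by (simp add: bcoord_eq_iff p_in_Leaf_iff)
qed

lemma compact_Leaf: "compactin X (Leaf t)"
  unfolding Leaf_eq_Bm
  by (intro closedin_compact_space compact_X closedin_continuous_map_preimage[OF continuous_Bm]) simp

section \<open>The leaf space and the fibration over it\<close>

abbreviation "lt \<equiv> leaf_through leaves"

definition Y where "Y = topology (\<lambda>V. V \<subseteq> leaves \<and> openin X {P \<in> topspace X. lt P \<in> V})"

lemma openin_Y: "openin Y V \<longleftrightarrow> V \<subseteq> leaves \<and> openin X {P \<in> topspace X. lt P \<in> V}"
proof -
  have "istopology (\<lambda>V. V \<subseteq> leaves \<and> openin X {P \<in> topspace X. lt P \<in> V})"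
    unfolding istopology_def
  proof (intro conjI allI impI)
    fix V W assume "V \<subseteq> leaves \<and> openin X {P \<in> topspace X. lt P \<in> V}" "W \<subseteq> leaves \<and> openin X {P \<in> topspace X. lt P \<in> W}"
    moreover have "{P \<in> topspace X. lt P \<in> V \<inter> W} = {P \<in> topspace X. lt P \<in> V} \<inter> {P \<in> topspace X. lt P \<in> W}" by auto
    ultimately show "V \<inter> W \<subseteq> leaves" "openin X {P \<in> topspace X. lt P \<in> V \<inter> W}" by (auto intro: openin_Int)
  next
    fix \<V> assume *: "\<forall>V\<in>\<V>. V \<subseteq> leaves \<and> openin X {P \<in> topspace X. lt P \<in> V}"
    have "{P \<in> topspace X. lt P \<in> \<Union>\<V>} = \<Union>((\<lambda>V. {P \<in> topspace X. lt P \<in> V}) ` \<V>)" by auto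
    moreover have "openin X (\<Union>((\<lambda>V. {P \<in> topspace X. lt P \<in> V}) ` \<V>))" using * by (intro openin_Union) auto
    ultimately show "\<Union>\<V> \<subseteq> leaves" "openin X {P \<in> topspace X. lt P \<in> \<Union>\<V>}" using * by auto
  qed
  then show ?thesis by (simp add: Y_def)
qed

lemma lt_image: "lt ` topspace X = leaves"
proof (intro set_eqI iffI)
  fix L assume "L \<in> leaves"
  then obtain t where "L = Leaf t" by (auto simp: leaves_def)
  then have "L = lt (p False t)" by (simp add: leaf_through_p)
  then show "L \<in> lt ` topspace X" by (rule image_eqI) simp
next
  fix L assume "L \<in> lt ` topspace X"
  then obtain s y where "L = lt (p s y)" using topspaceE by blast
  then show "L \<in> leaves" by (simp add: leaf_through_p) (simp add: leaves_def)
qed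

lemma topspace_Y: "topspace Y = leaves"
proof -
  have "{P \<in> topspace X. lt P \<in> leaves} = topspace X" using lt_image by auto
  then have "openin Y leaves" by (simp add: openin_Y)
  then show ?thesis using openin_Y openin_topspace openin_subset by (metis subset_antisym)
qed

lemma quotient_lt: "quotient_map X Y lt"
  unfolding quotient_map_def by (auto simp: topspace_Y lt_image openin_Y)

definition Ym where "Ym L = (THE b. \<exists>t. L = Leaf t \<and> b = bcoord t)"

lemma Ym_Leaf [simp]: "Ym (Leaf t) = bcoord t"
  unfolding Ym_def by (rule the_equality) (auto simp: bcoord_eq_iff)

lemma Hausdorff_Y: "Hausdorff_space Y"
proof (rule Hausdorff_space_injective_preimage[OF Hausdorff_space_euclidean])
  have "continuous_map X euclidean (Ym \<circ> lt)"
    by (rule continuous_map_eq[OF continuous_Bm]) (auto elim!: topspaceE simp: leaf_through_p)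
  then show "continuous_map Y euclidean Ym"
    using continuous_compose_quotient_map_eq[OF quotient_lt] by blast
  show "inj_on Ym (topspace Y)"
    by (rule inj_onI) (auto simp: topspace_Y leaves_def bcoord_eq_iff)
qed

lemma continuous_Leaf: "continuous_map euclidean Y Leaf"
proof -
  have "Leaf = lt \<circ> p False" by (auto simp: leaf_through_p)
  then show ?thesis
    using continuous_map_compose[OF p.continuous_param quotient_imp_continuous_map[OF quotient_lt]] by metis
qed

text \<open>The saturation of \<open>W\<close> is the union of its translates by vectors that are
  integral in the torus entries and arbitrary in the others.\<close>

lemma open_Leaf: assumes "open W" shows "openin Y (Leaf ` W)"
  unfolding openin_Y
proof
  have "open (p s -` {P \<in> topspace X. lt P \<in> Leaf ` W})" for s
  proof -
    define G :: "(complex^'n) set" where "G = {g. \<forall>k. eps k \<noteq> 0 \<longrightarrow> g $ k \<in> gauss_int}"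
    have "p s -` {P \<in> topspace X. lt P \<in> Leaf ` W} = (\<Union>g\<in>G. R s -` ((\<lambda>t. t + g) -` W))"
    proof (intro set_eqI iffI)
      fix y assume "y \<in> p s -` {P \<in> topspace X. lt P \<in> Leaf ` W}"
      then obtain t where t: "t \<in> W" "Leaf (R s y) = Leaf t" by (auto simp: leaf_through_p)
      then have "t - R s y \<in> G" by (auto simp: G_def Leaf_eq_iff)
      then show "y \<in> (\<Union>g\<in>G. R s -` ((\<lambda>t. t + g) -` W))" using t by force
    next
      fix y assume "y \<in> (\<Union>g\<in>G. R s -` ((\<lambda>t. t + g) -` W))"
      then obtain g where g: "g \<in> G" "R s y + g \<in> W" by auto
      then have "Leaf (R s y) = Leaf (R s y + g)" by (simp add: Leaf_eq_iff G_def)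
      then show "y \<in> p s -` {P \<in> topspace X. lt P \<in> Leaf ` W}" using g by (simp add: leaf_through_p)
    qed
    moreover have "open (\<Union>g\<in>G. R s -` ((\<lambda>t. t + g) -` W))"
      by (intro open_UN ballI open_vimage continuous_R continuous_intros assms)
    ultimately show ?thesis by simp
  qed
  then show "openin X {P \<in> topspace X. lt P \<in> Leaf ` W}"
    unfolding openin_p p.topspace_eq[symmetric] by blast
qed (auto simp: leaves_def)

lemma second_countable_Y: "second_countable Y"
  by (rule second_countable_open_map_image[OF continuous_Leaf _ _ second_countable_euclidean])
    (auto simp: open_map_def open_Leaf topspace_Y leaves_def)

text \<open>\<open>ret t\<close> projects onto the leaf of \<open>t\<close> along the torus directions; with the projection to the leaf
  space it trivializes the fibration globally.\<close>

definition ret where "ret t P = (THE Q. \<exists>s y. P = p s y \<and> Q = p s (\<chi> k. if eps k = 0 then y $ k else R s t $ k))"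

definition comb where "comb s t y = (\<chi> k. if eps k = 0 then y $ k else R s t $ k)"

lemma R_comb: "R s (comb s t y) $ k = (if eps k = 0 then y $ k else t $ k)"
proof (cases "eps k = 0")
  case False
  then have "R s (comb s t y) $ k = R s (R s t) $ k" by (simp add: R_nth[of s _ k] comb_def del: R_R)
  then show ?thesis using False by simp
qed (simp add: R_nth comb_def)

lemma comb_i0 [simp]: "comb s t y $ i0 = y $ i0" by (simp add: comb_def)

lemma ret_p [simp]: "ret t (p s y) = p s (comb s t y)"
  unfolding ret_def comb_def[symmetric]
proof (rule the_equality)
  fix Q assume "\<exists>s' y'. p s y = p s' y' \<and> Q = p s' (comb s' t y')"
  then obtain s' y' where *: "p s y = p s' y'" "Q = p s' (comb s' t y')" by blast
  have "p s (comb s t y) = p s' (comb s' t y')"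
    using *(1) unfolding p_eq_iff H_eq_gauss R_comb comb_i0 by (auto simp: R_nth)
  then show "Q = p s (comb s t y)" using *(2) by simp
qed blast

lemma continuous_ret: "continuous_map X X (ret t)"
proof -
  have "continuous_on UNIV (\<lambda>y::complex^'n. if eps k = 0 then y $ k else R s t $ k)" for k s
    by (cases "eps k = 0"; simp; intro continuous_intros)
  then have "continuous_on UNIV (comb s t)" for s
    unfolding comb_def[abs_def] by (rule continuous_on_vec_lambda)
  then have "continuous_map euclidean X (p s \<circ> comb s t)" for s
    by (intro continuous_map_compose[OF _ p.continuous_param]) auto
  moreover have "ret t \<circ> p s = p s \<circ> comb s t" for s by auto
  ultimately show ?thesis unfolding p.continuous_map_iff by simp
qed

text \<open>The trivialization is a continuous bijection from a compact space onto a Hausdorff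
  space, so its inverse is automatically continuous.\<close>

lemma fibration_lt: "topological_fibration X Y lt"
  unfolding topological_fibration_def
proof (intro conjI ballI)
  show "continuous_map X Y lt" by (rule quotient_imp_continuous_map[OF quotient_lt])
  show "lt ` topspace X = topspace Y" by (simp add: lt_image topspace_Y)
  fix L assume "L \<in> topspace Y"
  then obtain t0 where t0: "L = Leaf t0" by (auto simp: topspace_Y leaves_def)
  have all: "{P \<in> topspace X. lt P \<in> topspace Y} = topspace X" using lt_image topspace_Y by auto
  have fib: "{P \<in> topspace X. lt P = L} = Leaf t0"
  proof (intro set_eqI iffI)
    fix P assume "P \<in> {P \<in> topspace X. lt P = L}"
    then have "P \<in> topspace X" "lt P = Leaf t0" by (simp_all add: t0)
    moreover obtain s y where "P = p s y" using \<open>P \<in> topspace X\<close> by (rule topspaceE)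
    ultimately show "P \<in> Leaf t0" by (simp add: leaf_through_p p_in_Leaf_iff)
  next
    fix P assume "P \<in> Leaf t0"
    moreover obtain s y where "P = p s y" using \<open>P \<in> Leaf t0\<close> by (auto simp: Leaf_def)
    ultimately show "P \<in> {P \<in> topspace X. lt P = L}" by (simp add: leaf_through_p t0 p_in_Leaf_iff)
  qed
  have ret_fib: "ret t0 P \<in> Leaf t0" if "P \<in> topspace X" for P
  proof -
    from that obtain s y where "P = p s y" by (rule topspaceE)
    then show ?thesis by (simp add: p_in_Leaf R_comb)
  qed
  have "homeomorphic_map X (prod_topology Y (subtopology X (Leaf t0))) (\<lambda>P. (lt P, ret t0 P))"
  proof (rule continuous_imp_homeomorphic_map)
    show "continuous_map X (prod_topology Y (subtopology X (Leaf t0))) (\<lambda>P. (lt P, ret t0 P))"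
      using ret_fib by (intro continuous_map_pairedI)
        (auto simp: continuous_map_in_subtopology continuous_ret quotient_imp_continuous_map[OF quotient_lt])
    show "Hausdorff_space (prod_topology Y (subtopology X (Leaf t0)))"
      by (simp add: Hausdorff_space_prod_topology Hausdorff_Y Hausdorff_space_subtopology Hausdorff_X)
    show "inj_on (\<lambda>P. (lt P, ret t0 P)) (topspace X)"
    proof (rule inj_onI)
      fix P Q assume "P \<in> topspace X" "Q \<in> topspace X" and e: "(lt P, ret t0 P) = (lt Q, ret t0 Q)"
      obtain s y where P: "P = p s y" using \<open>P \<in> topspace X\<close> by (rule topspaceE)
      obtain s' y' where Q: "Q = p s' y'" using \<open>Q \<in> topspace X\<close> by (rule topspaceE)
      have 1: "Leaf (R s y) = Leaf (R s' y')" and 2: "p s (comb s t0 y) = p s' (comb s' t0 y')"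
        using e by (simp_all add: P Q leaf_through_p)
      have "R s' y' $ k - R s y $ k \<in> gauss_int" if "k \<noteq> i0" for k
      proof (cases "eps k = 0")
        case True
        then have "R s' y' $ k = R s' (comb s' t0 y') $ k" "R s y $ k = R s (comb s t0 y) $ k"
          by (simp_all add: R_comb) (simp_all add: R_nth)
        then show ?thesis using R_gauss[OF 2 that] by simp
      next
        case False
        then show ?thesis using 1 by (simp add: Leaf_eq_iff)
      qed
      then show "P = Q" using 2 unfolding P Q p_eq_iff H_eq_gauss comb_i0 by simp
    qed
    show "(\<lambda>P. (lt P, ret t0 P)) ` topspace X = topspace (prod_topology Y (subtopology X (Leaf t0)))"
    proof (intro set_eqI iffI)
      fix z assume "z \<in> topspace (prod_topology Y (subtopology X (Leaf t0)))"
      then obtain L' P where z: "z = (L', P)" "L' \<in> leaves" "P \<in> Leaf t0" by (auto simp: topspace_Y)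
      obtain t where t: "L' = Leaf t" using z(2) by (auto simp: leaves_def)
      obtain s y where P: "P = p s y" using z(3) by (auto simp: Leaf_def)
      \<comment> \<open>The preimage of \<open>(L', P)\<close>: move the torus coordinates of
        \<open>P\<close> to \<open>t\<close>. Moving them back to \<open>t0\<close> recovers
        \<open>P\<close>, because \<open>P\<close> lies in the leaf of \<open>t0\<close>.\<close>
      have "lt (p s (comb s t y)) = L'"
        by (simp add: leaf_through_p t Leaf_eq_iff R_comb)
      moreover have "p s (comb s t0 (comb s t y)) = P"
        using z(3) unfolding P p_eq_iff H_eq_gauss p_in_Leaf R_comb by (auto simp: R_comb comb_def R_nth)
      ultimately show "z \<in> (\<lambda>P. (lt P, ret t0 P)) ` topspace X"
        using z(1) by (intro image_eqI[of _ _ "p s (comb s t y)"]) auto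
    next
      fix z assume "z \<in> (\<lambda>P. (lt P, ret t0 P)) ` topspace X"
      then obtain P where P: "P \<in> topspace X" "z = (lt P, ret t0 P)" by auto
      have "lt P \<in> leaves" using P(1) lt_image by blast
      moreover have "ret t0 P \<in> topspace X" using ret_fib[OF P(1)] Leaf_subset by blast
      ultimately show "z \<in> topspace (prod_topology Y (subtopology X (Leaf t0)))"
        using ret_fib[OF P(1)] by (simp add: P(2) topspace_Y)
    qed
  qed (rule compact_X)
  then show "\<exists>V \<Phi>. openin Y V \<and> L \<in> V \<and>
        homeomorphic_map (subtopology X {x \<in> topspace X. lt x \<in> V})
          (prod_topology (subtopology Y V) (subtopology X {x \<in> topspace X. lt x = L})) \<Phi> \<and>
        (\<forall>x\<in>topspace X. lt x \<in> V \<longrightarrow> fst (\<Phi> x) = lt x)"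
    using \<open>L \<in> topspace Y\<close>
    by (intro exI[of _ "topspace Y"] exI[of _ "\<lambda>P. (lt P, ret t0 P)"]) (simp add: all fib)
qed

section \<open>Manifold charts of the leaf space\<close>

lemma Euclidean_space_eq: "Euclidean_space d = top_of_set {x. \<forall>i\<ge>d. x i = 0}"
  unfolding Euclidean_space_def euclidean_product_topology ..

lemma manifold_Y: "\<exists>d. topological_manifold d Y"
proof -
  define J where "J = {k. eps k \<noteq> 0}"
  define N where "N = card J"
  have "finite J" by simp
  then obtain h where "bij_betw h {0..<card J} J" using ex_bij_betw_nat_finite by blast
  then have h: "bij_betw h {..<N} J" by (simp add: N_def atLeast0LessThan)
  define j where "j = inv_into {..<N} h"
  have jh: "j (h i) = i" "eps (h i) \<noteq> 0" if "i < N" for i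
    using h that by (auto simp: j_def bij_betw_def J_def)
  have hj: "h (j k) = k" "j k < N" if "eps k \<noteq> 0" for k
  proof -
    have "k \<in> h ` {..<N}" using h that by (auto simp: bij_betw_def J_def)
    then show "h (j k) = k" "j k < N" unfolding j_def using f_inv_into_f inv_into_into by (metis, metis lessThan_iff)
  qed
  define tvec :: "(nat \<Rightarrow> real) \<Rightarrow> complex^'n" where
    "tvec r = (\<chi> k. if eps k = 0 then 0 else Complex (r (2 * j k)) (r (2 * j k + 1)))" for r
  \<comment> \<open>Even positions carry real parts, odd ones imaginary parts; from
    \<open>2 * N\<close> on the sequence is 0, as \<open>Euclidean_space\<close> demands.\<close>
  define co :: "complex^'n \<Rightarrow> nat \<Rightarrow> real" where
    "co t i = (if i < 2 * N then if even i then Re (t $ h (i div 2)) else Im (t $ h (i div 2)) else 0)" for t i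
  define E where "E = {r :: nat \<Rightarrow> real. \<forall>i\<ge>2 * N. r i = 0}"
  have coE: "co t \<in> E" for t by (simp add: E_def co_def)
  have co_tvec: "co (tvec r) = r" if "r \<in> E" for r
  proof
    fix i
    show "co (tvec r) i = r i"
    proof (cases "i < 2 * N")
      case True
      then have "i div 2 < N" by simp
      then show ?thesis using True jh[of "i div 2"] by (simp add: co_def tvec_def)
    qed (use that in \<open>simp add: co_def E_def\<close>)
  qed
  have tvec_co: "tvec (co t) $ k = t $ k" if "eps k \<noteq> 0" for t k
    using hj[OF that] that by (simp add: tvec_def co_def)
  have Leaf_tvec_co: "Leaf (tvec (co t)) = Leaf t" for t
    unfolding Leaf_eq_iff using tvec_co by simp
  have "continuous_on UNIV (\<lambda>r. if eps k = 0 then 0 else Complex (r (2 * j k)) (r (2 * j k + 1)))" for k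
    unfolding Complex_eq by (cases "eps k = 0"; simp; intro continuous_intros continuous_on_product_coordinates)
  then have cont_tvec: "continuous_on UNIV tvec"
    unfolding tvec_def by (rule continuous_on_vec_lambda)
  have cont_co: "continuous_on UNIV co"
  proof (rule continuous_on_coordinatewise_then_product)
    fix i show "continuous_on UNIV (\<lambda>t. co t i)"
      unfolding co_def by (cases "i < 2 * N"; cases "even i"; simp; intro continuous_intros)
  qed
  show ?thesis
  proof (intro exI[of _ "2 * N"], unfold topological_manifold_def, intro conjI ballI Hausdorff_Y second_countable_Y)
    fix L assume "L \<in> topspace Y"
    then obtain t0 where t0: "L = Leaf t0" by (auto simp: topspace_Y leaves_def)
    \<comment> \<open>The label of the same leaf in the range of \<open>tvec\<close>, with zeros
      where \<open>eps k = 0\<close>.\<close>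
    define t1 where "t1 = tvec (co t0)"
    define Z where "Z = E \<inter> tvec -` ball t1 (1/4)"
    define V where "V = Leaf ` tvec ` Z"
    \<comment> \<open>Since \<open>tvec (co t)\<close> and \<open>t\<close> label the same leaf,
      images of relatively open sets of \<open>E\<close> are images of open sets of labels, to which
      \<open>open_Leaf\<close> applies.\<close>
    have img: "Leaf ` tvec ` (E \<inter> W) = Leaf ` (co -` W)" for W
    proof (intro set_eqI iffI)
      fix L assume "L \<in> Leaf ` tvec ` (E \<inter> W)"
      then obtain r where r: "r \<in> E" "r \<in> W" "L = Leaf (tvec r)" by auto
      then have "tvec r \<in> co -` W" by (simp add: co_tvec)
      then show "L \<in> Leaf ` (co -` W)" using r by blast
    next
      fix L assume "L \<in> Leaf ` (co -` W)"
      then obtain t where "co t \<in> W" "L = Leaf (tvec (co t))" by (auto simp: Leaf_tvec_co)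
      then show "L \<in> Leaf ` tvec ` (E \<inter> W)" using coE by blast
    qed
    have open_img: "openin Y (Leaf ` tvec ` (E \<inter> W))" if "open W" for W
      unfolding img by (intro open_Leaf open_vimage that cont_co)
    have oW: "open (tvec -` ball t1 (1/4))" by (intro open_vimage cont_tvec open_ball)
    have oV: "openin Y V" unfolding V_def Z_def by (rule open_img[OF oW])
    have LV: "L \<in> V"
    proof -
      have "co t0 \<in> Z" by (simp add: Z_def coE t1_def)
      then have "Leaf (tvec (co t0)) \<in> V" unfolding V_def by blast
      then show ?thesis by (simp add: t0 Leaf_tvec_co)
    qed
    have oZ: "openin (Euclidean_space (2 * N)) Z"
      unfolding Euclidean_space_eq E_def[symmetric] openin_open Z_def using oW by blast
    have hom: "homeomorphic_map (subtopology (Euclidean_space (2 * N)) Z) (subtopology Y V) (Leaf \<circ> tvec)"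
    proof -
      have e: "subtopology (Euclidean_space (2 * N)) Z = top_of_set Z"
        unfolding Euclidean_space_eq E_def[symmetric] subtopology_subtopology
        by (rule arg_cong[of _ _ top_of_set]) (auto simp: Z_def)
      show ?thesis unfolding e
      proof (rule bijective_open_imp_homeomorphic_map)
        have "continuous_map (top_of_set Z) Y (Leaf \<circ> tvec)"
          by (rule continuous_map_compose[OF _ continuous_Leaf]) (use cont_tvec continuous_on_subset in auto)
        then show "continuous_map (top_of_set Z) (subtopology Y V) (Leaf \<circ> tvec)"
          by (auto simp: continuous_map_in_subtopology V_def)
        show "open_map (top_of_set Z) (subtopology Y V) (Leaf \<circ> tvec)"
          unfolding open_map_def
        proof (intro allI impI)
          fix U assume "openin (top_of_set Z) U"
          then obtain W where W: "open W" "U = Z \<inter> W" by (auto simp: openin_open)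
          then have "U = E \<inter> (tvec -` ball t1 (1/4) \<inter> W)" by (auto simp: Z_def)
          then have "openin Y (Leaf ` tvec ` U)" using open_img[of "tvec -` ball t1 (1/4) \<inter> W"] oW W(1) by auto
          moreover have "Leaf ` tvec ` U \<subseteq> V" using W(2) by (auto simp: V_def)
          ultimately show "openin (subtopology Y V) ((Leaf \<circ> tvec) ` U)"
            unfolding image_comp[symmetric] openin_subtopology by blast
        qed
        show "(Leaf \<circ> tvec) ` topspace (top_of_set Z) = topspace (subtopology Y V)"
          using openin_subset[OF \<open>openin Y V\<close>] by (auto simp: V_def image_comp[symmetric])
        show "inj_on (Leaf \<circ> tvec) (topspace (top_of_set Z))"
        proof (rule inj_onI)
          fix r r' assume r: "r \<in> topspace (top_of_set Z)" "r' \<in> topspace (top_of_set Z)" "(Leaf \<circ> tvec) r = (Leaf \<circ> tvec) r'"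
          then have rE: "r \<in> E" "r' \<in> E" "tvec r \<in> ball t1 (1/4)" "tvec r' \<in> ball t1 (1/4)" by (auto simp: Z_def)
          have "norm (tvec r' - tvec r) < 1"
            using rE(3,4) norm_triangle_ineq4[of "tvec r' - t1" "tvec r - t1"] by (simp add: dist_norm norm_minus_commute)
          then have n: "norm ((tvec r' - tvec r) $ k) < 1" for k
            using Finite_Cartesian_Product.norm_nth_le[of "tvec r' - tvec r" k] by linarith
          have "(tvec r' - tvec r) $ k = 0" for k
          proof (cases "eps k = 0")
            case True then show ?thesis by (simp add: tvec_def)
          next
            case False
            then show ?thesis using r(3) n[of k] by (intro gauss_int_small) (auto simp: Leaf_eq_iff)
          qed
          then have "tvec r' = tvec r" by (simp add: vec_eq_iff)
          then show "r = r'" using co_tvec rE(1,2) by metis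
        qed
      qed
    qed
    have "subtopology Y V homeomorphic_space subtopology (Euclidean_space (2 * N)) Z"
      by (rule homeomorphic_space_sym[THEN iffD1, OF homeomorphic_map_imp_homeomorphic_space[OF hom]])
    with oV LV oZ show "\<exists>V V'. openin Y V \<and> L \<in> V \<and> openin (Euclidean_space (2 * N)) V' \<and>
        subtopology Y V homeomorphic_space subtopology (Euclidean_space (2 * N)) V'"
      by blast
  qed
qed

lemma fibered_f: "fibered X q.atlas f Ec leaves"
  unfolding fibered_def
proof (intro conjI ballI)
  show "\<exists>K. foliation X K leaves \<and> tangent_to X q.atlas K leaves Ec"
    using foliation_leaves tangent_to_Ec by blast
  show "\<exists>Y d. quotient_map X Y lt \<and> topological_manifold d Y \<and> topological_fibration X Y lt"
    using quotient_lt manifold_Y fibration_lt by blast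
qed (auto simp: leaves_def f_Leaf compact_Leaf)

end

section \<open>Failure of holomorphy\<close>

lemma vec_subspace_imp_subspace:
  fixes K :: "(complex^'n::finite) set"
  assumes "vec.subspace K" shows "subspace K"
proof -
  have "r *\<^sub>R x = complex_of_real r *s x" for r and x :: "complex^'n"
    by (simp add: vec_eq_iff scaleR_conv_of_real[where 'a=complex])
  then show ?thesis
    using assms unfolding subspace_def vec.subspace_def by metis
qed

lemma norm_axis: "norm (axis j t :: 'a::real_inner^'n::finite) = norm t"
  by (simp add: norm_eq_sqrt_inner inner_axis_axis)

text \<open>The double orthogonal complement turns membership in \<open>K\<close> into scalar equations, which can be
  differentiated.\<close>

lemma derivative_in_subspace:
  fixes g :: "'a::real_normed_vector \<Rightarrow> 'b::euclidean_space"
  assumes K: "subspace K" and D: "(g has_derivative D) (at x)" and ev: "\<forall>\<^sub>F v in nhds x. g v \<in> K"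
  shows "D h \<in> K"
proof -
  have "z \<bullet> D h = 0" if "z \<in> orthogonal_comp K" for z
  proof -
    have "((\<lambda>v. z \<bullet> g v) has_derivative (\<lambda>h. z \<bullet> D h)) (at x)"
      by (intro has_derivative_inner_right D)
    moreover have "\<forall>\<^sub>F v in nhds x. z \<bullet> g v = 0"
      using ev by eventually_elim (use that in \<open>auto simp: orthogonal_comp_def orthogonal_def inner_commute\<close>)
    ultimately have "((\<lambda>v. 0) has_derivative (\<lambda>h. z \<bullet> D h)) (at x)"
      by (rule has_derivative_cong_nhds)
    then have "(\<lambda>h. z \<bullet> D h) = (\<lambda>h. 0)"
      using has_derivative_unique[OF _ has_derivative_const] by blast
    then show ?thesis by metis
  qed
  then have "D h \<in> orthogonal_comp (orthogonal_comp K)"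
    by (auto simp: orthogonal_comp_def[of "orthogonal_comp K"] orthogonal_def)
  then show ?thesis using orthogonal_comp_self[OF K] by simp
qed

context twistor_manifold begin

text \<open>On the complex line through \<open>x\<close> in the direction of coordinate
  \<open>m j\<close>, the weight \<open>NN\<close> is constant and \<open>cc1\<close> is
  \<open>C + cnj t\<close>. Differentiating the equation of \<open>Vc\<close> there gives the
  antilinear term \<open>eps j * e x $ i0 * cnj t\<close> beside complex linear ones, so its
  coefficient vanishes.\<close>

lemma no_holomorphic_section:
  assumes W: "open W" "x \<in> W" and e: "holomorphic_vec_on e W" and mem: "\<And>x. x \<in> W \<Longrightarrow> e x \<in> Vc x"
  shows "e x $ i0 = 0"
proof -
  obtain j where j: "eps j \<noteq> 0" using ex_eps by blast
  have jm: "m j \<noteq> i0" "m j \<noteq> j"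
  proof -
    show "m j \<noteq> i0" by (rule m_neq_i0(1)[OF j])
    show "m j \<noteq> j"
    proof
      assume "m j = j"
      then have "eps j = - eps j" using eps_m[of j] by metis
      then show False using j eps_cases[of j] by auto
    qed
  qed
  obtain D where D: "(e has_derivative D) (at x)" "\<And>a v. D (a *s v) = a *s D v"
    using e W(2) unfolding holomorphic_vec_on_def by blast
  define a :: "complex^'n" where "a = axis (m j) 1"
  define C where "C = cc1 x j"
  have lin: "bounded_linear (\<lambda>t::complex. t *s a)"
    by (rule linear_conv_bounded_linear[THEN iffD1], rule linearI)
      (auto simp: vec_eq_iff algebra_simps scaleR_conv_of_real[where 'a=complex])
  have line: "((\<lambda>t. x + t *s a) has_derivative (\<lambda>t. t *s a)) (at 0)"
    using has_derivative_add[OF has_derivative_const bounded_linear_imp_has_derivative[OF lin]] by simp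
  have "((e \<circ> (\<lambda>t. x + t *s a)) has_derivative (D \<circ> (\<lambda>t. t *s a))) (at 0)"
    by (rule diff_chain_at[OF line]) (simp add: D)
  then have G: "((\<lambda>t. e (x + t *s a) $ k) has_derivative (\<lambda>t. t * D a $ k)) (at 0)" for k
    using bounded_linear.has_derivative[OF bounded_linear_vec_nth, of "\<lambda>t. e (x + t *s a)" "\<lambda>t. D (t *s a)" _ k]
    by (simp add: o_def D(2))
  have zero: "complex_of_real (NN x) * (e (x + t *s a) $ j) - eps j * (e (x + t *s a) $ i0 * (C + cnj t)) = 0"
    if "x + t *s a \<in> W" for t
  proof -
    have N: "NN (x + t *s a) = NN x" using jm by (simp add: NN_def a_def axis_def)
    have c: "cc1 (x + t *s a) j = C + cnj t" using jm by (simp add: cc1_def C_def a_def axis_def)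
    have "pol (x + t *s a) (e (x + t *s a)) j = 0"
      using mem[OF that] j pol_eq[OF j, of "x + t *s a" "e (x + t *s a)"] by (simp add: Vc_def)
    then show ?thesis unfolding pol_def N c by (simp add: algebra_simps)
  qed
  have ev: "\<forall>\<^sub>F t in nhds 0. complex_of_real (NN x) * (e (x + t *s a) $ j) - eps j * (e (x + t *s a) $ i0 * (C + cnj t)) = 0"
  proof -
    have "continuous_on UNIV (\<lambda>t. x + t *s a)"
      using lin linear_continuous_on by (intro continuous_intros) blast
    then have "open ((\<lambda>t. x + t *s a) -` W)" using W(1) by (intro open_vimage)
    moreover have "0 \<in> (\<lambda>t. x + t *s a) -` W" using W(2) by simp
    ultimately have "\<forall>\<^sub>F t in nhds 0. t \<in> (\<lambda>t. x + t *s a) -` W" by (rule eventually_nhds_in_open)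
    then show ?thesis by eventually_elim (use zero in simp)
  qed
  have cn: "((\<lambda>t. C + cnj t) has_derivative cnj) (at 0)"
    using has_derivative_add[OF has_derivative_const bounded_linear_imp_has_derivative[OF bounded_linear_cnj]] by simp
  have "((\<lambda>t. complex_of_real (NN x) * (e (x + t *s a) $ j) - eps j * (e (x + t *s a) $ i0 * (C + cnj t)))
    has_derivative (\<lambda>t. complex_of_real (NN x) * (t * D a $ j) - eps j * (e (x + 0 *s a) $ i0 * cnj t + t * D a $ i0 * (C + cnj 0)))) (at 0)"
    by (intro has_derivative_diff has_derivative_mult_right has_derivative_mult G cn)
  from has_derivative_cong_nhds[OF this ev]
  have "(\<lambda>t. complex_of_real (NN x) * (t * D a $ j) - eps j * (e (x + 0 *s a) $ i0 * cnj t + t * D a $ i0 * (C + cnj 0))) = (\<lambda>t. 0)"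
    using has_derivative_unique[OF _ has_derivative_const] by blast
  then have all: "complex_of_real (NN x) * (t * D a $ j) - eps j * (e x $ i0 * cnj t + t * D a $ i0 * C) = 0" for t
    by (simp add: fun_eq_iff)
  \<comment> \<open>The values \<open>t = 1\<close> and \<open>t = \<i>\<close> separate the complex
    linear from the antilinear part.\<close>
  define Q where "Q = complex_of_real (NN x) * D a $ j - eps j * D a $ i0 * C"
  have "Q = eps j * e x $ i0" using all[of 1] by (simp add: Q_def algebra_simps)
  moreover have "\<i> * Q = - (\<i> * (eps j * e x $ i0))" using all[of \<i>] by (simp add: Q_def algebra_simps)
  ultimately have "\<i> * (eps j * e x $ i0) + \<i> * (eps j * e x $ i0) = 0" by simp
  then have "2 * (\<i> * (eps j * e x $ i0)) = 0" by (simp only: mult_2)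
  then show ?thesis using j by simp
qed

text \<open>All members of a local holomorphic frame have base component 0, hence so does their
  span, contrary to \<open>Vc_i0\<close>.\<close>

lemma not_holomorphic_Ec:
  assumes "openin X U" "U \<noteq> {}"
  shows "\<not> holomorphic_subbundle_on X q.atlas U Ec"
proof
  assume hol: "holomorphic_subbundle_on X q.atlas U Ec"
  obtain P where P: "P \<in> U" using assms by blast
  then have "P \<in> topspace X" using assms(1) openin_subset by blast
  then obtain s x where x: "P = q s x" by (rule q.topspaceE)
  obtain B where B: "open B" "x \<in> B" "inj_on (q s) B" using q.ex_injective by blast
  define ch where "ch = chart_of q s B"
  have ch: "ch \<in> q.atlas" "P \<in> fst ch" using q.atlasI[OF B(1,3)] B x by (auto simp: ch_def)
  from hol obtain r where "\<forall>p\<in>U. \<forall>c\<in>q.atlas. p \<in> fst c \<longrightarrow>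
        (\<exists>V e. openin X V \<and> p \<in> V \<and> V \<subseteq> U \<inter> fst c \<and>
           (\<forall>i<r. holomorphic_vec_on (e i) (snd c ` V)) \<and>
           (\<forall>q\<in>V. complex_frame (\<lambda>i. e i (snd c q)) r ((\<lambda>v. v c) ` Ec q)))"
    unfolding subbundle_on_def by blast
  from this[rule_format, OF P ch] obtain V e where V: "openin X V" "P \<in> V" "V \<subseteq> U \<inter> fst ch"
    and e: "\<And>i. i < r \<Longrightarrow> holomorphic_vec_on (e i) (snd ch ` V)"
    and fr: "\<And>Q. Q \<in> V \<Longrightarrow> complex_frame (\<lambda>i. e i (snd ch Q)) r ((\<lambda>v. v ch) ` Ec Q)" by blast
  define W where "W = B \<inter> q s -` V"
  have img: "snd ch ` V = W"
  proof -
    have "V = q s ` B \<inter> V" using V(3) by (auto simp: ch_def)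
    then have "snd ch ` V = snd ch ` (q s ` B \<inter> V)" by simp
    also have "\<dots> = {x \<in> B. q s x \<in> V}" unfolding ch_def snd_chart_of by (rule q.snd_chart_fst_Int[OF B(3)])
    finally show ?thesis by (auto simp: W_def)
  qed
  have oW: "open W" unfolding W_def using B(1) V(1) openin_q by blast
  have xW: "x \<in> W" using B(2) V(2) x by (simp add: W_def)
  have frW: "complex_frame (\<lambda>i. e i x') r (Vc x')" if "x' \<in> W" for x'
  proof -
    have "x' \<in> B" "q s x' \<in> V" using that by (auto simp: W_def)
    then have "complex_frame (\<lambda>i. e i (snd ch (q s x'))) r ((\<lambda>v. v ch) ` Ec (q s x'))" by (intro fr)
    moreover have "snd ch (q s x') = x'" using B(3) \<open>x' \<in> B\<close> by (simp add: ch_def)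
    moreover have "(\<lambda>v. v ch) ` Ec (q s x') = Vc x'"
      unfolding Ec_def ch_def by (rule q.distribution_coords[OF invariant_Vc B(1,3) \<open>x' \<in> B\<close>])
    ultimately show ?thesis by simp
  qed
  have "e i x $ i0 = 0" if "i < r" for i
  proof (rule no_holomorphic_section[OF oW xW])
    show "holomorphic_vec_on (e i) W" using e[OF that] img by simp
    fix x' assume "x' \<in> W"
    then have "vec.span ((\<lambda>i. e i x') ` {..<r}) = Vc x'" using frW by (simp add: complex_frame_def)
    moreover have "e i x' \<in> vec.span ((\<lambda>i. e i x') ` {..<r})" using that by (intro vec.span_base) auto
    ultimately show "e i x' \<in> Vc x'" by simp
  qed
  then have "(\<lambda>i. e i x) ` {..<r} \<subseteq> {v. v $ i0 = 0}" by auto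
  moreover have "vec.subspace {v::complex^'n. v $ i0 = 0}" by (auto simp: vec.subspace_def)
  ultimately have "vec.span ((\<lambda>i. e i x) ` {..<r}) \<subseteq> {v. v $ i0 = 0}" by (rule vec.span_minimal)
  then have "Vc x \<subseteq> {v. v $ i0 = 0}" using frW[OF xW] by (simp add: complex_frame_def)
  then show False using Vc_i0[of x] by auto
qed

text \<open>For an arbitrary foliation chart \<open>d\<close>: a segment in a direction of
  \<open>Kc\<close> is a connected subset of one leaf, so within the domain of \<open>d\<close> it
  stays in one plaque.\<close>

lemma leaf_segment:
  assumes d: "foliation_chart X K leaves d" and w: "w \<in> Kc"
    and seg: "\<And>\<tau>. 0 \<le> \<tau> \<Longrightarrow> \<tau> \<le> 1 \<Longrightarrow> p s (y + \<tau> *\<^sub>R w) \<in> fst d"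
  shows "snd d (p s (y + w)) - snd d (p s y) \<in> K"
proof -
  define L where "L = Leaf (R s y)"
  define C where "C = (\<lambda>\<tau>. p s (y + \<tau> *\<^sub>R w)) ` {0..1}"
  have inL: "p s (y + \<tau> *\<^sub>R w) \<in> L" for \<tau>
  proof -
    have "R s (y + \<tau> *\<^sub>R w) $ k = R s y $ k" if "eps k \<noteq> 0" for k
      using w that by (auto simp: R_nth Kc_def)
    then show ?thesis unfolding L_def p_in_Leaf by simp
  qed
  have "continuous_map euclidean X (p s \<circ> (\<lambda>\<tau>. y + \<tau> *\<^sub>R w))"
    by (rule continuous_map_compose[OF _ p.continuous_param]) (auto intro!: continuous_intros)
  then have "connectedin X ((p s \<circ> (\<lambda>\<tau>. y + \<tau> *\<^sub>R w)) ` {0..1})"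
    by (rule connectedin_continuous_map_image) simp
  then have "connectedin X C" by (simp add: C_def o_def)
  then have "connectedin (subtopology X (fst d \<inter> L)) C"
    unfolding connectedin_subtopology using seg inL by (auto simp: C_def)
  moreover have y: "p s y \<in> C" "p s (y + w) \<in> C"
  proof -
    show "p s y \<in> C" unfolding C_def by (rule image_eqI[of _ _ 0]) auto
    show "p s (y + w) \<in> C" unfolding C_def by (rule image_eqI[of _ _ 1]) auto
  qed
  ultimately have "C \<subseteq> connected_component_of_set (subtopology X (fst d \<inter> L)) (p s y)"
    by (intro connected_component_of_maximal)
  also have "\<dots> = plaque K d (p s y)"
  proof -
    have "L \<in> leaves" by (auto simp: leaves_def L_def)
    moreover have "p s y \<in> fst d \<inter> L" using seg[of 0] inL[of 0] by simp
    ultimately show ?thesis using d unfolding foliation_chart_def by blast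
  qed
  finally show ?thesis using y by (auto simp: plaque_def)
qed

lemma not_holomorphic_leaves: "\<not> holomorphic_foliation X q.atlas leaves"
proof
  assume "holomorphic_foliation X q.atlas leaves"
  then obtain K where K: "vec.subspace K"
    and charts: "\<forall>P\<in>topspace X. \<exists>d. foliation_chart X K leaves d \<and> P \<in> fst d \<and>
        (\<forall>c\<in>q.atlas. holomorphically_compatible c d)" unfolding holomorphic_foliation_def by blast
  have Kr: "subspace K" using K by (rule vec_subspace_imp_subspace)
  define P where "P = p False 0"
  have Psi0: "Psi 0 = 0" by (simp add: Psi_nth vec_eq_iff)
  have P_q: "P = q False 0" using q_Psi[of False 0] by (simp add: P_def Psi0)
  obtain d where d: "foliation_chart X K leaves d" "P \<in> fst d" "\<And>c. c \<in> q.atlas \<Longrightarrow> holomorphically_compatible c d"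
    using charts p.in_topspace unfolding P_def by blast
  obtain B where B: "open B" "0 \<in> B" "inj_on (q False) B" using q.ex_injective by blast
  define ch where "ch = chart_of q False B"
  have dch: "is_chart X d" using d(1) by (simp add: foliation_chart_def)
  have od: "openin X (fst d)" using dch by (simp add: is_chart_def)
  define W where "W = B \<inter> q False -` fst d"
  have oW: "open W" unfolding W_def using B(1) od openin_q by blast
  have W0: "0 \<in> W" using B(2) d(2) P_q by (simp add: W_def)
  define \<psi> where "\<psi> x = snd d (q False x)" for x
  define \<phi> where "\<phi> = transition d ch"
  have comp: "holomorphically_compatible ch d" using d(3) q.atlasI[OF B(1,3)] by (simp add: ch_def)
  have imgW: "snd ch ` (fst ch \<inter> fst d) = W"
    unfolding ch_def snd_chart_of fst_chart_of q.snd_chart_fst_Int[OF B(3)] by (auto simp: W_def)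
  have \<psi>_eq: "\<psi> x = transition ch d x" if "x \<in> W" for x
    using that B(3) by (simp add: \<psi>_def transition_def ch_def chart_inv_chart_of W_def)
  have \<psi>D: "\<exists>D. (\<psi> has_derivative D) (at x) \<and> (\<forall>a v. D (a *s v) = a *s D v)" if "x \<in> W" for x
  proof -
    have "holomorphic_vec_on (transition ch d) W" using comp imgW by (simp add: holomorphically_compatible_def)
    from this[unfolded holomorphic_vec_on_def, rule_format, OF that]
    obtain D where D: "(transition ch d has_derivative D) (at x)" "\<forall>a v. D (a *s v) = a *s D v"
      by (elim exE conjE)
    have "(\<psi> has_derivative D) (at x)"
      by (rule has_derivative_transform_within_open[OF D(1) oW that]) (simp add: \<psi>_eq)
    then show ?thesis using D(2) by blast
  qed
  have injd: "inj_on (snd d) (fst d)"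
  proof -
    have "homeomorphic_map (subtopology X (fst d)) (top_of_set (snd d ` fst d)) (snd d)" using dch by (simp add: is_chart_def)
    then have "inj_on (snd d) (topspace (subtopology X (fst d)))" by (simp add: homeomorphic_map_def)
    then show ?thesis using openin_subset[OF od] by (simp add: Int_absorb1)
  qed
  have \<phi>\<psi>: "\<phi> (\<psi> x) = x" if "x \<in> W" for x
  proof -
    have "chart_inv d (\<psi> x) = q False x"
      using that inv_into_f_f[OF injd] by (simp add: chart_inv_def \<psi>_def W_def)
    then show ?thesis using that B(3) by (simp add: \<phi>_def transition_def ch_def W_def)
  qed
  \<comment> \<open>Surjectivity, from the differentiable inverse \<open>\<phi>\<close>, later turns
    \<open>A u \<in> K\<close> for all \<open>u\<close> into \<open>K = UNIV\<close>.\<close>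
  have surj: "surj D" if "x \<in> W" "(\<psi> has_derivative D) (at x)" for x D
  proof -
    have "\<psi> x \<in> snd d ` (fst ch \<inter> fst d)" using that(1) by (auto simp: \<psi>_def ch_def W_def)
    moreover have "holomorphic_vec_on \<phi> (snd d ` (fst ch \<inter> fst d))"
      using comp by (simp add: holomorphically_compatible_def \<phi>_def)
    ultimately obtain D' where D': "(\<phi> has_derivative D') (at (\<psi> x))" unfolding holomorphic_vec_on_def by blast
    have "((\<phi> \<circ> \<psi>) has_derivative (D' \<circ> D)) (at x)" by (rule diff_chain_at[OF that(2) D'])
    then have "((\<lambda>x. x) has_derivative (D' \<circ> D)) (at x)"
      by (rule has_derivative_transform_within_open[OF _ oW that(1)]) (simp add: \<phi>\<psi>)
    then have DD: "D' \<circ> D = (\<lambda>x. x)" using has_derivative_unique has_derivative_ident by blast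
    have i: "inj D"
    proof (rule injI)
      fix u v assume "D u = D v"
      then have "(D' \<circ> D) u = (D' \<circ> D) v" by simp
      then show "u = v" unfolding DD .
    qed
    show ?thesis by (rule linear_injective_imp_surjective[OF has_derivative_linear[OF that(2)] i]) (rule refl)
  qed
  have "open (Psi -` W)" using oW continuous_Psi by (intro open_vimage)
  moreover have "0 \<in> Psi -` W" using W0 Psi0 by simp
  ultimately obtain r where r: "r > 0" "ball 0 r \<subseteq> Psi -` W" by (meson openE)
  have along: "\<psi> (Psi (y + w)) - \<psi> (Psi y) \<in> K" if "y \<in> ball 0 r" "y + w \<in> ball 0 r" "w \<in> Kc" for y w
  proof -
    have "p False (y + \<tau> *\<^sub>R w) \<in> fst d" if "0 \<le> \<tau>" "\<tau> \<le> 1" for \<tau>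
    proof -
      have "y + \<tau> *\<^sub>R w = (1 - \<tau>) *\<^sub>R y + \<tau> *\<^sub>R (y + w)" by (simp add: algebra_simps)
      moreover have "\<dots> \<in> ball 0 r"
        by (rule convexD[OF convex_ball]) (use \<open>y \<in> ball 0 r\<close> \<open>y + w \<in> ball 0 r\<close> that in auto)
      ultimately have "Psi (y + \<tau> *\<^sub>R w) \<in> W" using r(2) by auto
      then show ?thesis by (simp add: W_def)
    qed
    from leaf_segment[OF d(1) \<open>w \<in> Kc\<close> this] show ?thesis by (simp add: \<psi>_def)
  qed
  \<comment> \<open>\<open>a\<close> is a step along the sphere through the origin; its length
    \<open>r / 2\<close> keeps \<open>y\<close> and \<open>y + a\<close> in the ball for all small
    \<open>y\<close>.\<close>
  define t where "t = complex_of_real (r / 2)"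
  define a :: "complex^'n" where "a = axis i0 t"
  have t0: "t \<noteq> 0" and na: "norm a = r / 2" using r(1) by (simp_all add: t_def a_def norm_axis)
  have aK: "a \<in> Kc" using m_neq_i0 by (auto simp: Kc_def a_def axis_def)
  have aball: "a \<in> ball 0 r" using na r(1) by simp
  have am: "eps k \<noteq> 0 \<Longrightarrow> a $ m k = 0" for k using m_neq_i0[of k] by (auto simp: a_def axis_def)
  have W_a: "Psi a \<in> W" using r(2) aball by auto
  obtain A where A: "(\<psi> has_derivative A) (at (Psi a))" "\<And>c v. A (c *s v) = c *s A v" using \<psi>D[OF W_a] by blast
  obtain A0 where A0: "(\<psi> has_derivative A0) (at (Psi 0))" "\<And>c v. A0 (c *s v) = c *s A0 v" using \<psi>D W0 Psi0 by metis
  have linA: "linear A" "linear A0" using has_derivative_linear A(1) A0(1) by blast+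
  \<comment> \<open>The antilinear part of the derivative of \<open>Psi\<close> at \<open>a\<close>,
    up to the factor \<open>t\<close>; on the torus directions its square is
    \<open>- 1\<close>.\<close>
  define M where "M h = (\<chi> k. eps k * cnj (h $ m k))" for h :: "complex^'n"
  have DP0: "DPsi 0 h = h" for h by (simp add: DPsi_def vec_eq_iff)
  have DPa: "DPsi a h = h + t *s M h" if "h $ i0 = 0" for h
    using that am by (auto simp: DPsi_def M_def vec_eq_iff a_def)
  \<comment> \<open>The increment of \<open>\<psi>\<close> along the leaf step \<open>a\<close> lies
    in \<open>K\<close> for every starting point \<open>y\<close>; this is its derivative in
    \<open>y\<close> at 0.\<close>
  have 1: "A (DPsi a h) - A0 h \<in> K" for h
  proof (rule derivative_in_subspace[OF Kr, where D = "\<lambda>h. A (DPsi a h) - A0 h" and x = "0 :: complex^'n"])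
    have "((\<lambda>y. y + a) has_derivative (\<lambda>h. h)) (at 0)" by (auto intro!: derivative_eq_intros)
    then have "((Psi \<circ> (\<lambda>y. y + a)) has_derivative (DPsi a \<circ> (\<lambda>h. h))) (at 0)"
      by (rule diff_chain_at) (simp add: Psi_derivative)
    then have "((\<psi> \<circ> (Psi \<circ> (\<lambda>y. y + a))) has_derivative (A \<circ> (DPsi a \<circ> (\<lambda>h. h)))) (at 0)"
      by (rule diff_chain_at) (simp add: A)
    moreover have "((\<psi> \<circ> Psi) has_derivative (A0 \<circ> DPsi 0)) (at 0)"
      by (rule diff_chain_at[OF Psi_derivative A0(1)])
    ultimately have "((\<lambda>y. (\<psi> \<circ> (Psi \<circ> (\<lambda>y. y + a))) y - (\<psi> \<circ> Psi) y) has_derivative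
        (\<lambda>h. (A \<circ> (DPsi a \<circ> (\<lambda>h. h))) h - (A0 \<circ> DPsi 0) h)) (at 0)"
      by (rule has_derivative_diff)
    then show "((\<lambda>y. \<psi> (Psi (y + a)) - \<psi> (Psi y)) has_derivative (\<lambda>h. A (DPsi a h) - A0 h)) (at 0)"
      by (simp add: o_def DP0)
    have "\<forall>\<^sub>F y in nhds 0. y \<in> ball 0 (r / 2)" using r(1) by (intro eventually_nhds_in_open) auto
    then show "\<forall>\<^sub>F y in nhds 0. \<psi> (Psi (y + a)) - \<psi> (Psi y) \<in> K"
    proof eventually_elim
      case (elim y)
      then have "y \<in> ball 0 r" "y + a \<in> ball 0 r" using na r(1) norm_triangle_ineq[of y a] by auto
      then show ?case using along aK by blast
    qed
  qed
  have Kops: "u \<in> K \<Longrightarrow> v \<in> K \<Longrightarrow> u - v \<in> K" "u \<in> K \<Longrightarrow> c *s u \<in> K" "u \<in> K \<Longrightarrow> v \<in> K \<Longrightarrow> u + v \<in> K" for u v c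
    using K by (auto simp: vec.subspace_diff vec.subspace_scale vec.subspace_add)
  have AM: "A (M h) \<in> K" if h: "h $ i0 = 0" for h
  proof -
    have e1: "A h + t *s A (M h) - A0 h \<in> K"
      using 1[of h] by (simp add: DPa[OF h] linear_add[OF linA(1)] A(2))
    \<comment> \<open>\<open>A\<close> and \<open>A0\<close> are complex linear and \<open>M\<close>
      is antilinear, so passing from \<open>h\<close> to \<open>\<i> *s h\<close> reverses the
      relative sign of the term with \<open>M\<close>. Subtraction isolates it.\<close>
    have Mi: "M (\<i> *s h) = - \<i> *s M h" by (simp add: M_def vec_eq_iff)
    have "\<i> *s A h + t *s (- \<i> *s A (M h)) - \<i> *s A0 h \<in> K"
      using 1[of "\<i> *s h"] DPa[of "\<i> *s h"] h unfolding Mi by (simp add: linear_diff[OF linA(1)] A(2) A0(2))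
    from Kops(2)[OF this, of "- \<i>"] have e2: "A h - t *s A (M h) - A0 h \<in> K"
      by (rule back_subst[of "\<lambda>v. v \<in> K"]) (simp add: vec_eq_iff algebra_simps)
    have "(A h + t *s A (M h) - A0 h) - (A h - t *s A (M h) - A0 h) \<in> K" by (rule Kops(1)[OF e1 e2])
    then have "(1 / (2 * t)) *s ((A h + t *s A (M h) - A0 h) - (A h - t *s A (M h) - A0 h)) \<in> K" by (rule Kops(2))
    moreover have "(1 / (2 * t)) *s ((A h + t *s A (M h) - A0 h) - (A h - t *s A (M h) - A0 h)) = A (M h)"
      using t0 by (simp add: vec_eq_iff field_simps)
    ultimately show ?thesis by simp
  qed
  \<comment> \<open>Every torus direction is in the range of \<open>M\<close>, since
    \<open>M (- M h) = h\<close> there.\<close>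
  have AJ: "A h \<in> K" if h: "\<And>k. eps k = 0 \<Longrightarrow> h $ k = 0" for h
  proof -
    have "M (- M h) = h"
      using h eps_sq by (auto simp: M_def vec_eq_iff mult.assoc[symmetric])
    moreover have "(- M h) $ i0 = 0" by (simp add: M_def)
    ultimately show ?thesis using AM[of "- M h"] by simp
  qed
  \<comment> \<open>Leaf directions go to \<open>K\<close> by differentiating the increments along
    the leaf itself; at \<open>a\<close> the map \<open>DPsi a\<close> fixes them.\<close>
  have AK: "A w \<in> K" if w: "w \<in> Kc" for w
  proof -
    have "DPsi a w $ k = w $ k" for k
      using am[of k] w by (simp add: DPsi_Kc_nth[OF w]) (auto simp: Kc_def)
    then have Dw: "DPsi a w = w" by (simp add: vec_eq_iff)
    have l: "((\<lambda>\<tau>. a + \<tau> *\<^sub>R w) has_derivative (\<lambda>\<tau>. \<tau> *\<^sub>R w)) (at 0)" by (auto intro!: derivative_eq_intros)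
    then have "((Psi \<circ> (\<lambda>\<tau>. a + \<tau> *\<^sub>R w)) has_derivative (DPsi a \<circ> (\<lambda>\<tau>. \<tau> *\<^sub>R w))) (at 0)"
      by (rule diff_chain_at) (simp add: Psi_derivative)
    then have "((\<psi> \<circ> (Psi \<circ> (\<lambda>\<tau>. a + \<tau> *\<^sub>R w))) has_derivative (A \<circ> (DPsi a \<circ> (\<lambda>\<tau>. \<tau> *\<^sub>R w)))) (at 0)"
      by (rule diff_chain_at) (simp add: A)
    from has_derivative_diff[OF this has_derivative_const[of "\<psi> (Psi a)"]]
    have D: "((\<lambda>\<tau>. \<psi> (Psi (a + \<tau> *\<^sub>R w)) - \<psi> (Psi a)) has_derivative (\<lambda>\<tau>. A (DPsi a (\<tau> *\<^sub>R w)))) (at 0)"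
      by (simp add: o_def)
    have "continuous_on UNIV (\<lambda>\<tau>. a + \<tau> *\<^sub>R w)" by (intro continuous_intros)
    then have "open ((\<lambda>\<tau>. a + \<tau> *\<^sub>R w) -` ball 0 r)" by (intro open_vimage) auto
    moreover have "0 \<in> (\<lambda>\<tau>. a + \<tau> *\<^sub>R w) -` ball 0 r" using aball by simp
    ultimately have "\<forall>\<^sub>F \<tau> in nhds 0. \<tau> \<in> (\<lambda>\<tau>. a + \<tau> *\<^sub>R w) -` ball 0 r" by (rule eventually_nhds_in_open)
    then have "\<forall>\<^sub>F \<tau> in nhds 0. \<psi> (Psi (a + \<tau> *\<^sub>R w)) - \<psi> (Psi a) \<in> K"
    proof eventually_elim
      case (elim \<tau>)
      have "\<tau> *\<^sub>R w \<in> Kc" using w subspace_Kc by (simp add: subspace_scale)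
      then show ?case using along[OF aball] elim by simp
    qed
    from derivative_in_subspace[OF Kr D this, of 1] show ?thesis by (simp add: Dw)
  qed
  have "A u \<in> K" for u
  proof -
    define w h :: "complex^'n" where "w = (\<chi> k. if eps k = 0 then u $ k else 0)" and "h = (\<chi> k. if eps k = 0 then 0 else u $ k)"
    have "A w \<in> K" by (rule AK) (simp add: w_def Kc_def)
    moreover have "A h \<in> K" by (rule AJ) (simp add: h_def)
    moreover have "u = w + h" by (simp add: w_def h_def vec_eq_iff)
    ultimately show ?thesis using Kops(3) linear_add[OF linA(1)] by metis
  qed
  then have KU: "K = UNIV" using surj[OF W_a A(1)] by (metis UNIV_eq_I surjD)
  have PL: "P \<in> fst d \<inter> Leaf 0" using d(2) by (simp add: P_def p_in_Leaf)
  have "Leaf 0 \<in> leaves" by (simp add: leaves_def)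
  then have "connected_component_of_set (subtopology X (fst d \<inter> Leaf 0)) P = plaque K d P"
    using d(1) PL unfolding foliation_chart_def by blast
  \<comment> \<open>With \<open>K = UNIV\<close> a plaque is the whole chart domain, which would put
    an open set into a single leaf; the point \<open>v\<close> below, displaced by less than 1 in a
    torus coordinate, is not in that leaf.\<close>
  then have "fst d \<subseteq> connected_component_of_set (subtopology X (fst d \<inter> Leaf 0)) P"
    by (simp add: plaque_def KU)
  also have "\<dots> \<subseteq> topspace (subtopology X (fst d \<inter> Leaf 0))"
    by (rule connected_component_of_subset_topspace)
  finally have sub: "fst d \<subseteq> Leaf 0" by auto
  obtain j where j: "eps j \<noteq> 0" using ex_eps by blast
  define \<delta> where "\<delta> = min (r / 2) (1 / 2)"
  have \<delta>: "0 < \<delta>" "\<delta> < r" "\<delta> < 1" using r(1) by (auto simp: \<delta>_def)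
  define v :: "complex^'n" where "v = axis j (complex_of_real \<delta>)"
  have "norm v < r" using \<delta> by (simp add: v_def norm_axis)
  then have "Psi v \<in> W" using r(2) by auto
  then have "p False v \<in> fst d" by (simp add: W_def)
  then have "p False v \<in> Leaf 0" using sub by blast
  then have "v $ j \<in> gauss_int" using j by (simp add: p_in_Leaf)
  then have "v $ j = 0" by (rule gauss_int_small) (use \<delta> in \<open>simp add: v_def axis_def\<close>)
  then show False using \<delta> by (simp add: v_def axis_def)
qed

end

section \<open>Existence\<close>

lemma ex_distinct5:
  assumes "CARD('n::finite) \<ge> 5"
  shows "\<exists>f :: nat \<Rightarrow> 'n. inj_on f {..<5}"
  using assms card_le_inj[of "{..<5::nat}" "UNIV :: 'n set"] by auto

lemma ex_twistor_data:
  assumes "CARD('n::finite) \<ge> 5"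
  shows "\<exists>(i0::'n) m c eps al. twistor_data i0 m c eps al"
proof -
  obtain g :: "nat \<Rightarrow> 'n" where g: "inj_on g {..<5}" using ex_distinct5[OF assms] by blast
  \<comment> \<open>\<open>i0\<close> is the sphere coordinate, \<open>i1, i2\<close> are
    \<open>a, b\<close> and \<open>i3, i4\<close> are \<open>a', b'\<close>.\<close>
  define i0 i1 i2 i3 i4 where ix: "i0 = g 0" "i1 = g 1" "i2 = g 2" "i3 = g 3" "i4 = g 4"
  have "g i = g j \<longleftrightarrow> i = j" if "i < 5" "j < 5" for i j using g that by (auto simp: inj_on_def)
  then have ne: "i0 \<noteq> i1" "i0 \<noteq> i2" "i0 \<noteq> i3" "i0 \<noteq> i4" "i1 \<noteq> i2" "i1 \<noteq> i3" "i1 \<noteq> i4"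
    "i2 \<noteq> i3" "i2 \<noteq> i4" "i3 \<noteq> i4" by (auto simp: ix)
  define m where "m k = (if k = i1 then i2 else if k = i2 then i1 else if k = i3 then i4 else if k = i4 then i3 else k)" for k
  define c where "c k = (if k = i1 then i3 else if k = i3 then i1 else if k = i2 then i4 else if k = i4 then i2 else k)" for k
  define eps :: "'n \<Rightarrow> complex" where "eps k = (if k = i1 \<or> k = i3 then 1 else if k = i2 \<or> k = i4 then -1 else 0)" for k
  define al :: "'n \<Rightarrow> complex" where "al k = (if k = i1 \<or> k = i2 then 2 else 1)" for k
  have "twistor_data i0 m c eps al"
  proof
    show "\<exists>k. eps k \<noteq> 0" by (rule exI[of _ i1]) (simp add: eps_def)
  qed (use ne in \<open>auto simp: m_def c_def eps_def al_def split: if_splits\<close>)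
  then show ?thesis by blast
qed

text \<open>Both coordinate patches have to fit into the prescribed point type.
  \<open>arctan\<close> squeezes real parts between -2 and 2, and a translation by 10 separates the
  copies.\<close>

lemma ex_two_copies: "\<exists>\<iota> :: bool \<times> (complex^'n::finite) \<Rightarrow> complex^'n. inj \<iota>"
proof -
  define h :: "bool \<Rightarrow> complex \<Rightarrow> complex" where "h s z = Complex (arctan (Re z) + (if s then 10 else 0)) (Im z)" for s z
  have h: "s = s' \<and> z = z'" if "h s z = h s' z'" for s s' z z'
  proof -
    have e: "arctan (Re z) + (if s then 10 else 0) = arctan (Re z') + (if s' then 10 else 0)" "Im z = Im z'"
      using that by (simp_all add: h_def)
    have b: "- 2 < arctan a \<and> arctan a < 2" for a
    proof -
      have "- (pi / 2) < arctan a" "arctan a < pi / 2" using arctan_bounded[of a] by blast+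
      then show ?thesis using pi_less_4 by linarith
    qed
    have "s = s'"
    proof (rule ccontr)
      assume "s \<noteq> s'"
      then have "arctan (Re z) + 10 = arctan (Re z') \<or> arctan (Re z) = arctan (Re z') + 10" using e(1) by (cases s) auto
      then show False using b[of "Re z"] b[of "Re z'"] by linarith
    qed
    then show ?thesis using e by (simp add: complex_eq_iff arctan_eq_iff)
  qed
  have "inj (\<lambda>a::bool \<times> (complex^'n). \<chi> k. h (fst a) (snd a $ k))"
  proof (rule injI)
    fix a b :: "bool \<times> (complex^'n)"
    assume "(\<chi> k. h (fst a) (snd a $ k)) = (\<chi> k. h (fst b) (snd b $ k))"
    then have "h (fst a) (snd a $ k) = h (fst b) (snd b $ k)" for k by (simp add: vec_eq_iff)
    from h[OF this] show "a = b" by (simp add: prod_eq_iff vec_eq_iff)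
  qed
  then show ?thesis by blast
qed

context twistor_data begin

text \<open>Points are the fibres of \<open>H\<close>, transported by the injection
  \<open>\<iota>\<close>, so equality of points is equality of values of \<open>H\<close>; the
  topology is declared to be the final one.\<close>

lemma ex_twistor_manifold: "\<exists>(X :: (complex^'n) set topology) p. twistor_manifold i0 m c eps al X p"
proof -
  obtain \<iota> :: "bool \<times> (complex^'n) \<Rightarrow> complex^'n" where \<iota>: "inj \<iota>" using ex_two_copies by blast
  define p where "p s y = \<iota> ` {(s', y'). H s' y' = H s y}" for s y
  define X where "X = topology (\<lambda>U. U \<subseteq> (\<Union>s. range (p s)) \<and> (\<forall>s. open (p s -` U)))"
  have "istopology (\<lambda>U. U \<subseteq> (\<Union>s. range (p s)) \<and> (\<forall>s. open (p s -` U)))"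
    unfolding istopology_def by (auto simp: vimage_Union)
  then have o: "openin X U \<longleftrightarrow> U \<subseteq> (\<Union>s. range (p s)) \<and> (\<forall>s. open (p s -` U))" for U
    by (simp add: X_def)
  have "p s y = p s' y' \<longleftrightarrow> H s y = H s' y'" for s y s' y'
    unfolding p_def inj_image_eq_iff[OF \<iota>] by auto
  then have "twistor_manifold i0 m c eps al X p" using o by unfold_locales auto
  then show ?thesis by blast
qed

end

theorem theorem1p2:
  assumes "CARD('n::finite) \<ge> 5"
  shows "\<exists>(X :: (complex^'n) set topology) (A :: ((complex^'n) set, 'n) chart set) f Es Ec Eu \<W>.
    complex_manifold X A \<and> compact_space X \<and> topspace X \<noteq> {} \<and>
    biholomorphism X A f \<and>
    partially_hyperbolic X A f Es Ec Eu \<and>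
    fibered X A f Ec \<W> \<and>
    real_analytic_subbundle_on X A (topspace X) Ec \<and>
    (\<forall>U. openin X U \<and> U \<noteq> {} \<longrightarrow> \<not> holomorphic_subbundle_on X A U Ec) \<and>
    \<not> holomorphic_foliation X A \<W>"
proof -
  obtain i0 :: 'n and m c eps al where "twistor_data i0 m c eps al" using ex_twistor_data[OF assms] by blast
  then interpret twistor_data i0 m c eps al .
  obtain X :: "(complex^'n) set topology" and p where "twistor_manifold i0 m c eps al X p"
    using ex_twistor_manifold by blast
  then interpret twistor_manifold i0 m c eps al X p .
  have "topspace X \<noteq> {}" using p.in_topspace[of False 0] by (metis empty_iff)
  then show ?thesis
    using complex_manifold_X compact_X biholomorphism_f partially_hyperbolic_f fibered_f real_analytic_Ec
      not_holomorphic_Ec not_holomorphic_leaves by blast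
qed

end
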